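(* Let $\Omega=(0,l\pi)$, $l>0$, with homogeneous Neumann boundary conditions, and suppose that a $(k_1,k_2)$-mode Hopf--steady state bifurcation with $k_1=k_2\ne0$ occurs at the trivial equilibrium when $\alpha=(0,0)$ for $$\dot u(t)=D(\alpha)\Delta u(t)+L(\alpha)u_t+G(u_t,\alpha).$$ Then the coefficients $a_{11},a_{23},a_{111},a_{123},b_{12},b_{112},b_{223}$ of the third order normal form on the center manifold $$\begin{aligned} \dot z_1&=a_1(\alpha)z_1+a_{11}z_1^2+a_{23}z_2\bar z_2+a_{111}z_1^3+a_{123}z_1z_2\bar z_2+h.o.t.,\\ \dot z_2&=\mathrm i\omega_0z_2+b_2(\alpha)z_2+b_{12}z_1z_2+b_{112}z_1^2z_2+b_{223}z_2^2\bar z_2+h.o.t. \end{aligned}$$ (together with the complex conjugate of the second equation) are $$\begin{aligned} a_{11}=&a_{23}=b_{12}=0,\\ a_{111}=&\tfrac14\psi_1(0)C_{\phi_1\phi_1\phi_1}+\psi_1(0)Q_{\phi_1}(h_{200}^0+\tfrac1{\sqrt2}h_{200}^{2k_1}),\\ a_{123}=&\tfrac32\psi_1(0)C_{\phi_1\phi_2\bar\phi_2}+\psi_1(0)[Q_{\phi_1}(h_{011}^0+\tfrac1{\sqrt2}h_{011}^{2k_1})+Q_{\phi_2}(h_{101}^0+\tfrac1{\sqrt2}h_{101}^{2k_1})+Q_{\bar\phi_2}(h_{110}^0+\tfrac1{\sqrt2}h_{110}^{2k_1})],\\ b_{112}=&\tfrac34\psi_2(0)C_{\phi_1\phi_1\phi_2}+\psi_2(0)[Q_{\phi_1}(h_{110}^0+\tfrac1{\sqrt2}h_{110}^{2k_1})+Q_{\phi_2}(h_{200}^0+\tfrac1{\sqrt2}h_{200}^{2k_1})],\\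 b_{223}=&\tfrac34\psi_2(0)C_{\phi_2\phi_2\bar\phi_2}+\psi_2(0)[Q_{\phi_2}(h_{011}^0+\tfrac1{\sqrt2}h_{011}^{2k_1})+Q_{\bar\phi_2}(h_{020}^0+\tfrac1{\sqrt2}h_{020}^{2k_1})], \end{aligned}$$ where, for $\theta\in[-r,0]$, $$\begin{aligned} h_{200}^0(\theta)&\equiv-\tfrac12\Big[\int_{-r}^0d\eta_0(\theta)\Big]^{-1}Q_{\phi_1\phi_1},& h_{200}^{2k_1}(\theta)&\equiv-\tfrac1{2\sqrt2}\Big[\int_{-r}^0d\eta_{2k_1}(\theta)\Big]^{-1}Q_{\phi_1\phi_1},\\ h_{011}^0(\theta)&\equiv-\Big[\int_{-r}^0d\eta_0(\theta)\Big]^{-1}Q_{\phi_2\bar\phi_2},& h_{011}^{2k_1}(\theta)&\equiv-\tfrac1{\sqrt2}\Big[\int_{-r}^0d\eta_{2k_1}(\theta)\Big]^{-1}Q_{\phi_2\bar\phi_2}, \end{aligned}$$ $$\begin{aligned} h_{020}^0(\theta)&=\tfrac12\Big[2\mathrm i\omega_0I-\int_{-r}^0e^{2\mathrm i\omega_0s}d\eta_0(s)\Big]^{-1}Q_{\phi_2\phi_2}e^{2\mathrm i\omega_0\theta},\\ h_{020}^{2k_1}(\theta)&=\tfrac1{2\sqrt2}\Big[2\mathrm i\omega_0I-\int_{-r}^0e^{2\mathrm i\omega_0s}d\eta_{2k_1}(s)\Big]^{-1}Q_{\phi_2\phi_2}e^{2\mathrm i\omega_0\theta},\\ h_{110}^0(\theta)&=\Big[\mathrm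 i\omega_0I-\int_{-r}^0e^{\mathrm i\omega_0s}d\eta_0(s)\Big]^{-1}Q_{\phi_1\phi_2}e^{\mathrm i\omega_0\theta},\\ h_{110}^{2k_1}(\theta)&=\tfrac1{\sqrt2}\Big[\mathrm i\omega_0I-\int_{-r}^0e^{\mathrm i\omega_0s}d\eta_{2k_1}(s)\Big]^{-1}Q_{\phi_1\phi_2}e^{\mathrm i\omega_0\theta}, \end{aligned}$$ and $h_{002}^0=\overline{h_{020}^0}$, $h_{002}^{2k_1}=\overline{h_{020}^{2k_1}}$, $h_{101}^0=\overline{h_{110}^0}$, $h_{101}^{2k_1}=\overline{h_{110}^{2k_1}}$.
   Context: **Equation.** $\Omega=(0,l\pi)$, $l>0$; $X$ is a Hilbert space of complex-valued functions on $[0,l\pi]$ with $\langle u,v\rangle=\frac1{l\pi}\int_0^{l\pi}u\bar v\,dx$. With homogeneous Neumann conditions, $-\Delta$ has eigenvalues $\mu_k=k^2/l^2$, $k\in\mathbb N_0$, with orthonormal eigenfunctions $\beta_0=1$, $\beta_k(x)=\sqrt2\cos(kx/l)$. Fix $m\in\mathbb N$, $r>0$; $\mathcal C=C([-r,0];X^m)$ and $C([-r,0];\mathbb C^m)$ carry the sup norm. $u_t(\theta)=u(t+\theta)$. $dom(\Delta)$ is the set of $u\in (W^{2,2})^m$ satisfying the Neumann condition. $D(\alpha)=\mathrm{diag}(d_1(\alpha),\dots,d_m(\alpha))$, $d_i(0)>0$; $\alpha=(\alpha_1,\alpha_2)$ lies in a neighborhood $V$ of $0\in\mathbb R^2$;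 $\alpha\mapsto L(\alpha)$ is a $C^1$ map into bounded linear operators $\mathcal C\to X^m$; $G:\mathcal C\times V\to X^m$ is $C^k$, $k\ge3$, with $G(0,\alpha)=0$ and $D_\varphi G(0,\alpha)=0$. $L$ and $G$ are real on real functions. $L_0=L(0)$, $D_0=D(0)$. Formal Taylor expansions: $L(\alpha)=L_0+\frac12L_1(\alpha)+\cdots$, $D(\alpha)=D_0+\frac12D_1(\alpha)+\cdots$ with $L_1,D_1$ linear in $\alpha$, and $G(v,0)=\frac1{2!}Q(v,v)+\frac1{3!}C(v,v,v)+O(|v|^4)$ with $Q,C$ symmetric multilinear (extended complex-multilinearly). Write $Q_{XY}=Q_XY=Q(X,Y)$, $C_{XYZ}=C(X,Y,Z)$. These operators act pointwise in $x$: $L(\alpha)(\varphi\beta)=(L(\alpha)\varphi)\beta$, $Q(\varphi\beta,\psi\beta')=Q(\varphi,\psi)\beta\beta'$, and similarly for $C$, for $\varphi,\psi\in C([-r,0];\mathbb C^m)$ and scalar functions $\beta,\beta'$ of $x$. For vector functions $\langle v,\beta_k\rangle$ is taken componentwise. **Definition ($(k_1,k_2)$-mode Hopf--steady state bifurcation).** The following four hypotheses hold. (H1) $D_0\Delta$ generates a $C_0$-semigroup $T(t)$ on $X^m$ with $|T(t)|\le Me^{\omega t}$, $t\ge0$, for some $M\ge1$, $\omega\in\mathbb R$, and $T(t)$ is compact for every $t>0$. (H2) $L_0$ extends to a bounded linear operator from $B\mathcal C$ to $X^m$, where $B\mathcal C$ is the space (sup norm) of functions $[-r,0]\to X^m$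 continuous on $[-r,0)$ with a limit as $\theta\to0^-$. (H3) For each $k\in\mathbb N_0$, $L_0$ maps $\mathcal B_k=\{\langle v(\cdot),\beta_k\rangle\beta_k:v\in\mathcal C\}$ into $\mathrm{span}\{e_i\beta_k:1\le i\le m\}$, $e_i$ the canonical basis. (H4) For $\alpha\in V$, the characteristic equation $\det(\lambda I+\mu_kD(\alpha)-L(\alpha)(e^{\lambda\cdot}I))=0$ with $k=k_1$ has a simple real root $\gamma(\alpha)$ with $\gamma(0)=0$, $\frac{\partial\gamma}{\partial\alpha_2}(0)\ne0$; with $k=k_2$ it has a pair of simple complex conjugate roots $\nu(\alpha)\pm\mathrm i\omega(\alpha)$ with $\nu(0)=0$, $\omega(0)=\omega_0>0$, $\frac{\partial\nu}{\partial\alpha_1}(0)\ne0$; all other eigenvalues (over all $k\in\mathbb N_0$) have nonzero real part. **Bases.** $\eta_k$ is the $m\times m$ matrix function of bounded variation with $-\mu_kD_0\psi(0)+L_0\psi=\int_{-r}^0d\eta_k(\theta)\psi(\theta)$ for $\psi\in C([-r,0];\mathbb C^m)$. For $\psi\in C([0,r];\mathbb C^{m*})$ (row vectors), $(\psi,\varphi)_k=\psi(0)\varphi(0)-\int_{-r}^0\int_0^\theta\psi(\xi-\theta)\,d\eta_k(\theta)\varphi(\xi)\,d\xi$. $\phi_1(\theta)\equiv\phi_1(0)$ (real) spans the eigenspace for $\lambda=0$ of $\dot z=-\mu_{k_1}D_0z+L_0z_t$; $\phi_2(\theta)=\phi_2(0)e^{\mathrm i\omega_0\theta}$ that for $\mathrm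 i\omega_0$ of $\dot z=-\mu_{k_2}D_0z+L_0z_t$; $\psi_1(s)\equiv\psi_1(0)$ (real) and $\psi_2(s)=\psi_2(0)e^{-\mathrm i\omega_0s}$ are the corresponding adjoint eigenvectors. With $\Phi_1=\phi_1$, $\Psi_1=\psi_1$, $\Phi_2=(\phi_2,\bar\phi_2)$, $\Psi_2=(\psi_2,\bar\psi_2)^T$ one normalizes $(\Psi_i,\Phi_i)_{k_i}=I$. **Reduction.** $\pi\phi=\sum_{i=1,2}\Phi_i(\Psi_i,\langle\phi(\cdot),\beta_{k_i}\rangle)_{k_i}\beta_{k_i}$ (extended to $B\mathcal C$); $X_0(\theta)=0$ for $\theta<0$, $X_0(0)=I$; $\mathcal Q^1=\{\phi\in\mathcal C:\dot\phi\in\mathcal C,\ \phi(0)\in dom(\Delta),\ \pi\phi=0\}$; $A_1\phi=\dot\phi+X_0[L_0\phi+D_0\Delta\phi(0)-\dot\phi(0)]$ on $\mathcal Q^1$. Writing the solution as $w(z)+y$, $w(z)=\phi_1z_1\beta_{k_1}+(\phi_2z_2+\bar\phi_2\bar z_2)\beta_{k_2}$, $z=(z_1,z_2,\bar z_2)$, $y\in\mathcal Q^1$, the equation becomes $\dot z=Bz+\frac1{2!}f_2^1+\frac1{3!}f_3^1+\cdots$, $\dot y=A_1y+\frac1{2!}f_2^2+\cdots$, with $B=\mathrm{diag}(0,\mathrm i\omega_0,-\mathrm i\omega_0)$, $F_2(v,\alpha)=L_1(\alpha)v+D_1(\alpha)\Delta v(0)+Q(v,v)$, $F_3(v,0)=C(v,v,v)$,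 $f_j^1$ having components $\psi_1(0)\langle F_j,\beta_{k_1}\rangle$, $\psi_2(0)\langle F_j,\beta_{k_2}\rangle$, $\bar\psi_2(0)\langle F_j,\beta_{k_2}\rangle$, and $f_2^2=(I-\pi)X_0F_2$, all evaluated at $v=w(z)+y$. **Normal form.** Let $(M_j^1p)(z,\alpha)=D_zp\,Bz-Bp$ on homogeneous $\mathbb C^3$-valued polynomials of degree $j$. The complement of $\mathrm{Im}(M_2^1)$ is spanned by $z_1^2e_1,z_2\bar z_2e_1,z_1\alpha_ie_1,z_1z_2e_2,z_2\alpha_ie_2,z_1\bar z_2e_3,\bar z_2\alpha_ie_3$ and that of $\mathrm{Im}(M_3^1)$ (with $\alpha=0$) by $z_1^3e_1,z_1z_2\bar z_2e_1,z_1^2z_2e_2,z_2^2\bar z_2e_2,z_1^2\bar z_2e_3,z_2\bar z_2^2e_3$; $\mathrm{Proj}$ is projection onto these complements along the remaining monomials. $U_2^1$ is the combination of the remaining quadratic monomials in $z$ with $M_2^1U_2^1=f_2^1(z,0,0)-\mathrm{Proj}f_2^1(z,0,0)$; $U_2^2=2h$, where $h(z)=h_{200}z_1^2+h_{020}z_2^2+h_{002}\bar z_2^2+h_{110}z_1z_2+h_{101}z_1\bar z_2+h_{011}z_2\bar z_2$ has coefficients in $\mathcal Q^1$ and is the unique solution of $D_zh(z)Bz-A_1h(z)=\frac12f_2^2(z,0,0)$; $h_q^k=\langle h_q,\beta_k\rangle$. After $(z,y)=(\hat z,\hat y)+\frac1{2!}U_2(\hat z)$, $U_2=(U_2^1,U_2^2)$,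 the normal form on the local center manifold is $\dot z=Bz+\frac12g_2^1(z,0,\alpha)+\frac1{3!}g_3^1(z,0,0)+h.o.t.$, $g_2^1(z,0,\alpha)=\mathrm{Proj}f_2^1(z,0,\alpha)$, $g_3^1(z,0,0)=\mathrm{Proj}\{f_3^1(z,0,0)+\frac32[(D_{(z,y)}f_2^1(z,y,0))_{y=0}U_2(z)-D_zU_2^1(z)g_2^1(z,0,0)]\}$; $h.o.t.$ stands for terms of order $\ge4$ in $(z,\alpha)$ and all terms of order $\ge3$ that involve $\alpha$. Also $a_1(\alpha)=\frac12\psi_1(0)(L_1(\alpha)\phi_1-\mu_{k_1}D_1(\alpha)\phi_1(0))$, $b_2(\alpha)=\frac12\psi_2(0)(L_1(\alpha)\phi_2-\mu_{k_2}D_1(\alpha)\phi_2(0))$. *)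

theory Defs
  imports "HOL-Analysis.Analysis"
begin

text \<open>
  A reaction-diffusion equation with delay on the interval from 0 to \<open>\<ell>\<pi>\<close>,
  \<open>u' = D(\<alpha>)\<Delta>u + L(\<alpha>)u\<^sub>t + G(u\<^sub>t,\<alpha>)\<close>,
  the hypotheses of a Hopf--steady state bifurcation, and the third-order normal form.

  \<^item> The phase space \<open>X\<close> is a type of class \<open>real_inner\<close> and \<open>complete_space\<close> together with a map
    \<open>rep\<close> choosing for each element a representing complex function on the interval (elements are
    functions modulo null sets).  The norm of \<open>X\<close> is only required to dominate the \<open>L\<^sup>2\<close> norm, while
    the pairings with the eigenfunctions use the \<open>L\<^sup>2\<close> product.  So \<open>X = L\<^sup>2\<close> is one instance and
    \<open>W\<^sup>2\<^sup>,\<^sup>2\<close> with Neumann conditions another; the latter matters because on \<open>L\<^sup>2\<close>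
    itself no bounded \<open>Q\<close>, \<open>C\<close> other than 0 act pointwise.
  \<^item> \<open>X\<^sup>m\<close> is \<open>'x ^ 'm\<close>.
  \<^item> The history space \<open>C([-r,0];X\<^sup>m)\<close> is realised isometrically as the subspace \<open>hist_space\<close> of
    those bounded continuous functions on the whole line that are constant to the left of \<open>-r\<close> and
    to the right of 0.  Operators on it are total on the ambient type and factor through
    restriction to \<open>[-r,0]\<close>.
  \<^item> \<open>C([-r,0];\<complex>\<^sup>m)\<close> consists of plain functions, of which only the values on \<open>[-r,0]\<close> matter.
\<close>

record (overloaded) ('x, 'm) rdde =
  ell :: real
  rep :: "'x::{real_inner,complete_space} \<Rightarrow> real \<Rightarrow> complex"
  delay :: real
  nbhd :: "(real \<times> real) set"
  diffus :: "real \<times> real \<Rightarrow> real ^ ('m::finite)"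
  Lop :: "real \<times> real \<Rightarrow> (real \<Rightarrow>\<^sub>C ('x ^ 'm)) \<Rightarrow>\<^sub>L ('x ^ 'm)"
  Gop :: "(real \<Rightarrow>\<^sub>C ('x ^ 'm)) \<times> (real \<times> real) \<Rightarrow> 'x ^ 'm"
  Qop :: "(real \<Rightarrow>\<^sub>C ('x ^ 'm)) \<Rightarrow> (real \<Rightarrow>\<^sub>C ('x ^ 'm)) \<Rightarrow> 'x ^ 'm"
  Cop :: "(real \<Rightarrow>\<^sub>C ('x ^ 'm)) \<Rightarrow> (real \<Rightarrow>\<^sub>C ('x ^ 'm)) \<Rightarrow> (real \<Rightarrow>\<^sub>C ('x ^ 'm)) \<Rightarrow> 'x ^ 'm"
  eta :: "nat \<Rightarrow> real \<Rightarrow> complex ^ 'm ^ 'm"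
  k1 :: nat
  k2 :: nat
  omega0 :: real
  phi10 :: "complex ^ 'm"
  phi20 :: "complex ^ 'm"
  psi10 :: "complex ^ 'm"
  psi20 :: "complex ^ 'm"

type_synonym ('x, 'm) history = "real \<Rightarrow>\<^sub>C ('x ^ 'm)"


subsection \<open>The function space\<close>

definition dom_int :: "('x::{real_inner,complete_space}, 'm::finite) rdde \<Rightarrow> real set" where
  "dom_int S = {0..ell S * pi}"

definition rep_eq ::
  "('x::{real_inner,complete_space}, 'm::finite) rdde \<Rightarrow> 'x \<Rightarrow> (real \<Rightarrow> complex) \<Rightarrow> bool" where
  "rep_eq S u f \<longleftrightarrow> (AE x in lebesgue_on (dom_int S). rep S u x = f x)"

definition square_int :: "real set \<Rightarrow> (real \<Rightarrow> complex) \<Rightarrow> bool" where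
  "square_int I f \<longleftrightarrow> f \<in> borel_measurable (lebesgue_on I) \<and>
     integrable (lebesgue_on I) (\<lambda>x. (cmod (f x))\<^sup>2)"

definition l2prod ::
  "('x::{real_inner,complete_space}, 'm::finite) rdde \<Rightarrow> (real \<Rightarrow> complex) \<Rightarrow> (real \<Rightarrow> complex) \<Rightarrow> complex"
  where
  "l2prod S f g = of_real (1 / (ell S * pi)) * (LINT x|lebesgue_on (dom_int S). f x * cnj (g x))"

definition mu :: "('x::{real_inner,complete_space}, 'm::finite) rdde \<Rightarrow> nat \<Rightarrow> real" where
  "mu S k = (real k)\<^sup>2 / (ell S)\<^sup>2"

definition eigfun :: "('x::{real_inner,complete_space}, 'm::finite) rdde \<Rightarrow> nat \<Rightarrow> real \<Rightarrow> complex" where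
  "eigfun S k x = of_real (if k = 0 then 1 else sqrt 2 * cos (real k * x / ell S))"

definition beta :: "('x::{real_inner,complete_space}, 'm::finite) rdde \<Rightarrow> nat \<Rightarrow> 'x" where
  "beta S k = (THE u. rep_eq S u (eigfun S k))"

definition cscale :: "('x::{real_inner,complete_space}, 'm::finite) rdde \<Rightarrow> complex \<Rightarrow> 'x \<Rightarrow> 'x" where
  "cscale S c u = (THE v. rep_eq S v (\<lambda>x. c * rep S u x))"

definition function_space :: "('x::{real_inner,complete_space}, 'm::finite) rdde \<Rightarrow> bool" where
  "function_space S \<longleftrightarrow>
     ell S > 0 \<and>
     (\<forall>u. square_int (dom_int S) (rep S u)) \<and>
     (\<forall>u v. rep_eq S (u + v) (\<lambda>x. rep S u x + rep S v x)) \<and>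
     (\<forall>a u. rep_eq S (a *\<^sub>R u) (\<lambda>x. of_real a * rep S u x)) \<and>
     (\<forall>u v. rep_eq S u (rep S v) \<longrightarrow> u = v) \<and>
     (\<forall>c u. \<exists>v. rep_eq S v (\<lambda>x. c * rep S u x) \<and> norm v = cmod c * norm u) \<and>
     (\<forall>k. \<exists>u. rep_eq S u (eigfun S k)) \<and>
     (\<exists>K. \<forall>u. sqrt (Re (l2prod S (rep S u) (rep S u))) \<le> K * norm u)"

definition vscale ::
  "('x::{real_inner,complete_space}, 'm::finite) rdde \<Rightarrow> complex \<Rightarrow> 'x ^ 'm \<Rightarrow> 'x ^ 'm" where
  "vscale S c v = (\<chi> i. cscale S c (v $ i))"

definition vtens ::
  "('x::{real_inner,complete_space}, 'm::finite) rdde \<Rightarrow> complex ^ 'm \<Rightarrow> 'x \<Rightarrow> 'x ^ 'm" where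
  "vtens S c b = (\<chi> i. cscale S (c $ i) b)"

definition mode :: "('x::{real_inner,complete_space}, 'm::finite) rdde \<Rightarrow> nat \<Rightarrow> 'x ^ 'm \<Rightarrow> complex ^ 'm" where
  "mode S k v = (\<chi> i. l2prod S (rep S (v $ i)) (eigfun S k))"

definition real_vec :: "('x::{real_inner,complete_space}, 'm::finite) rdde \<Rightarrow> 'x ^ 'm \<Rightarrow> bool" where
  "real_vec S v \<longleftrightarrow> (\<forall>i. AE x in lebesgue_on (dom_int S). rep S (v $ i) x \<in> \<real>)"


subsection \<open>The Neumann Laplacian\<close>

text \<open>\<open>sobolev22 b u u' u''\<close>: \<open>u\<close> is in \<open>W\<^sup>2\<^sup>,\<^sup>2(0,b)\<close>, with \<open>u'\<close> the (absolutely) continuous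
  representative of its derivative and \<open>u''\<close> its second derivative.\<close>

definition sobolev22 ::
  "real \<Rightarrow> (real \<Rightarrow> complex) \<Rightarrow> (real \<Rightarrow> complex) \<Rightarrow> (real \<Rightarrow> complex) \<Rightarrow> bool" where
  "sobolev22 b u u' u'' \<longleftrightarrow>
     square_int {0..b} u'' \<and>
     (\<forall>x\<in>{0..b}. u' x = u' 0 + (LINT t|lebesgue_on {0..x}. u'' t)) \<and>
     (\<exists>c. AE x in lebesgue_on {0..b}. u x = c + (LINT t|lebesgue_on {0..x}. u' t))"

definition has_lap :: "('x::{real_inner,complete_space}, 'm::finite) rdde \<Rightarrow> 'x \<Rightarrow> 'x \<Rightarrow> bool" where
  "has_lap S u v \<longleftrightarrow>
     (\<exists>u'. sobolev22 (ell S * pi) (rep S u) u' (rep S v) \<and> u' 0 = 0 \<and> u' (ell S * pi) = 0)"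

definition dom_lap :: "('x::{real_inner,complete_space}, 'm::finite) rdde \<Rightarrow> ('x ^ 'm) set" where
  "dom_lap S = {v. \<forall>i. \<exists>w. has_lap S (v $ i) w}"

definition lap :: "('x::{real_inner,complete_space}, 'm::finite) rdde \<Rightarrow> 'x ^ 'm \<Rightarrow> 'x ^ 'm" where
  "lap S v = (\<chi> i. THE w. has_lap S (v $ i) w)"

definition diag_app :: "real ^ 'm \<Rightarrow> 'x::real_vector ^ ('m::finite) \<Rightarrow> 'x ^ 'm" where
  "diag_app d v = (\<chi> i. (d $ i) *\<^sub>R (v $ i))"


subsection \<open>History spaces\<close>

definition hist ::
  "('x::{real_inner,complete_space}, 'm::finite) rdde \<Rightarrow> (real \<Rightarrow> 'x ^ 'm) \<Rightarrow> ('x, 'm) history" where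
  "hist S f = Bcontfun (ext_cont f (- delay S) 0)"

definition hist_space :: "('x::{real_inner,complete_space}, 'm::finite) rdde \<Rightarrow> ('x, 'm) history set" where
  "hist_space S = {\<phi>. hist S (apply_bcontfun \<phi>) = \<phi>}"

definition cont_hist ::
  "('x::{real_inner,complete_space}, 'm::finite) rdde \<Rightarrow> (real \<Rightarrow> 'b::topological_space) \<Rightarrow> bool" where
  "cont_hist S f \<longleftrightarrow> continuous_on {- delay S..0} f"

definition hscale ::
  "('x::{real_inner,complete_space}, 'm::finite) rdde \<Rightarrow> complex \<Rightarrow> ('x, 'm) history \<Rightarrow> ('x, 'm) history" where
  "hscale S c \<phi> = hist S (\<lambda>\<theta>. vscale S c (apply_bcontfun \<phi> \<theta>))"

definition tens ::
  "('x::{real_inner,complete_space}, 'm::finite) rdde \<Rightarrow> (real \<Rightarrow> complex ^ 'm) \<Rightarrow> 'x \<Rightarrow> ('x, 'm) history" where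
  "tens S \<phi> b = hist S (\<lambda>\<theta>. vtens S (\<phi> \<theta>) b)"

definition real_hist :: "('x::{real_inner,complete_space}, 'm::finite) rdde \<Rightarrow> ('x, 'm) history \<Rightarrow> bool" where
  "real_hist S \<phi> \<longleftrightarrow> (\<forall>\<theta>\<in>{- delay S..0}. real_vec S (apply_bcontfun \<phi> \<theta>))"

text \<open>Functions on \<open>[-r,0]\<close> that are continuous on \<open>[-r,0)\<close> with a limit at \<open>0-\<close>.\<close>

definition jump_space :: "('x::{real_inner,complete_space}, 'm::finite) rdde \<Rightarrow> (real \<Rightarrow> 'x ^ 'm) set" where
  "jump_space S = {f. continuous_on {- delay S..<0} f \<and> (\<exists>w. (f \<longlongrightarrow> w) (at_left 0))}"

definition X0 :: "'b::zero \<Rightarrow> real \<Rightarrow> 'b" where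
  "X0 v \<theta> = (if \<theta> = 0 then v else 0)"

text \<open>An operator acting pointwise in \<open>x\<close> also acts on \<open>\<complex>\<^sup>m\<close>-valued histories, which are identified
  with histories constant in \<open>x\<close> (recall \<open>\<beta>\<^sub>0 = 1\<close>).\<close>

definition hat1 ::
  "('x::{real_inner,complete_space}, 'm::finite) rdde \<Rightarrow> (('x, 'm) history \<Rightarrow> 'x ^ 'm)
   \<Rightarrow> (real \<Rightarrow> complex ^ 'm) \<Rightarrow> complex ^ 'm" where
  "hat1 S T \<phi> = mode S 0 (T (tens S \<phi> (beta S 0)))"

definition Qhat ::
  "('x::{real_inner,complete_space}, 'm::finite) rdde \<Rightarrow> (real \<Rightarrow> complex ^ 'm)
   \<Rightarrow> (real \<Rightarrow> complex ^ 'm) \<Rightarrow> complex ^ 'm" where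
  "Qhat S \<phi> \<psi> = mode S 0 (Qop S (tens S \<phi> (beta S 0)) (tens S \<psi> (beta S 0)))"

definition Chat ::
  "('x::{real_inner,complete_space}, 'm::finite) rdde \<Rightarrow> (real \<Rightarrow> complex ^ 'm)
   \<Rightarrow> (real \<Rightarrow> complex ^ 'm) \<Rightarrow> (real \<Rightarrow> complex ^ 'm) \<Rightarrow> complex ^ 'm" where
  "Chat S \<phi> \<psi> \<chi>' =
     mode S 0 (Cop S (tens S \<phi> (beta S 0)) (tens S \<psi> (beta S 0)) (tens S \<chi>' (beta S 0)))"


subsection \<open>The equation\<close>

text \<open>\<open>k\<close> times continuously Frechet differentiable on \<open>U\<close>: \<open>D j x\<close> is the \<open>j\<close>-th derivative at
  \<open>x\<close>, a bounded multilinear map acting on lists of length \<open>j\<close>; differentiability and continuity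
  refer to the norm of multilinear maps.\<close>

definition Ck_on ::
  "nat \<Rightarrow> 'a::real_normed_vector set \<Rightarrow> ('a \<Rightarrow> 'b::real_normed_vector) \<Rightarrow> bool" where
  "Ck_on k U f \<longleftrightarrow> (\<exists>D :: nat \<Rightarrow> 'a \<Rightarrow> 'a list \<Rightarrow> 'b.
     (\<forall>x\<in>U. D 0 x [] = f x) \<and>
     (\<forall>j\<le>k. \<forall>x\<in>U. \<exists>K. \<forall>hs. length hs = j \<longrightarrow> norm (D j x hs) \<le> K * prod_list (map norm hs)) \<and>
     (\<forall>j<k. \<forall>x\<in>U. \<forall>hs. length hs = j \<longrightarrow> linear (\<lambda>v. D (Suc j) x (v # hs))) \<and>
     (\<forall>j<k. \<forall>x\<in>U. \<forall>e>0. \<exists>\<delta>>0. \<forall>v. norm v < \<delta> \<and> x + v \<in> U \<longrightarrow>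
        (\<forall>hs. length hs = j \<longrightarrow>
          norm (D j (x + v) hs - D j x hs - D (Suc j) x (v # hs))
            \<le> e * norm v * prod_list (map norm hs))) \<and>
     (\<forall>x\<in>U. \<forall>e>0. \<exists>\<delta>>0. \<forall>y\<in>U. dist y x < \<delta> \<longrightarrow>
        (\<forall>hs. length hs = k \<longrightarrow> norm (D k y hs - D k x hs) \<le> e * prod_list (map norm hs))))"

definition linear_part :: "('x::{real_inner,complete_space}, 'm::finite) rdde \<Rightarrow> bool" where
  "linear_part S \<longleftrightarrow>
     delay S > 0 \<and> open (nbhd S) \<and> 0 \<in> nbhd S \<and>
     (\<forall>i. diffus S 0 $ i > 0) \<and> diffus S differentiable at 0 \<and>
     (\<forall>\<alpha> \<phi>. Lop S \<alpha> \<phi> = Lop S \<alpha> (hist S (apply_bcontfun \<phi>))) \<and>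
     (\<forall>\<alpha>\<in>nbhd S. \<forall>c. \<forall>\<phi>\<in>hist_space S. Lop S \<alpha> (hscale S c \<phi>) = vscale S c (Lop S \<alpha> \<phi>)) \<and>
     (\<forall>\<alpha>\<in>nbhd S. \<forall>\<phi>\<in>hist_space S. real_hist S \<phi> \<longrightarrow> real_vec S (Lop S \<alpha> \<phi>)) \<and>
     (\<exists>L'. (\<forall>\<alpha>\<in>nbhd S. (Lop S has_derivative blinfun_apply (L' \<alpha>)) (at \<alpha>)) \<and>
           continuous_on (nbhd S) L')"

text \<open>The Taylor polynomial of \<open>G(\<cdot>,0)\<close> is taken along real functions; \<open>Q\<close> and \<open>C\<close> are then
  complex multilinear.  The remainder \<open>o(|v|\<^sup>3)\<close> is what smoothness of class \<open>C\<^sup>3\<close> provides, and is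
  implied by \<open>O(|v|\<^sup>4)\<close>.\<close>

definition nonlinear_part :: "('x::{real_inner,complete_space}, 'm::finite) rdde \<Rightarrow> bool" where
  "nonlinear_part S \<longleftrightarrow>
     (\<exists>k\<ge>3. Ck_on k (UNIV \<times> nbhd S) (Gop S)) \<and>
     (\<forall>\<phi> \<alpha>. Gop S (\<phi>, \<alpha>) = Gop S (hist S (apply_bcontfun \<phi>), \<alpha>)) \<and>
     (\<forall>\<alpha>\<in>nbhd S. Gop S (0, \<alpha>) = 0 \<and> ((\<lambda>\<phi>. Gop S (\<phi>, \<alpha>)) has_derivative (\<lambda>_. 0)) (at 0)) \<and>
     (\<forall>\<alpha>\<in>nbhd S. \<forall>\<phi>\<in>hist_space S. real_hist S \<phi> \<longrightarrow> real_vec S (Gop S (\<phi>, \<alpha>))) \<and>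
     bounded_bilinear (Qop S) \<and>
     (\<forall>u v. Qop S u v = Qop S v u) \<and>
     (\<forall>u v. Qop S u v = Qop S (hist S (apply_bcontfun u)) v) \<and>
     (\<forall>c. \<forall>u\<in>hist_space S. \<forall>v. Qop S (hscale S c u) v = vscale S c (Qop S u v)) \<and>
     (\<forall>u v. linear (Cop S u v)) \<and>
     (\<exists>K. \<forall>u v w. norm (Cop S u v w) \<le> K * norm u * norm v * norm w) \<and>
     (\<forall>u v w. Cop S u v w = Cop S v u w \<and> Cop S u v w = Cop S u w v) \<and>
     (\<forall>u v w. Cop S u v w = Cop S (hist S (apply_bcontfun u)) v w) \<and>
     (\<forall>c. \<forall>u\<in>hist_space S. \<forall>v w. Cop S (hscale S c u) v w = vscale S c (Cop S u v w)) \<and>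
     ((\<lambda>v. norm (Gop S (v, 0) - (1/2) *\<^sub>R Qop S v v - (1/6) *\<^sub>R Cop S v v v) / norm v ^ 3) \<longlongrightarrow> 0)
       (at 0 within {v \<in> hist_space S. real_hist S v})"

definition pointwise :: "('x::{real_inner,complete_space}, 'm::finite) rdde \<Rightarrow> bool" where
  "pointwise S \<longleftrightarrow>
     (\<forall>\<alpha>\<in>nbhd S. \<forall>\<phi> b. cont_hist S \<phi> \<longrightarrow>
        Lop S \<alpha> (tens S \<phi> b) = vtens S (hat1 S (Lop S \<alpha>) \<phi>) b) \<and>
     (\<forall>\<phi> \<psi> b b'. cont_hist S \<phi> \<and> cont_hist S \<psi> \<longrightarrow> (\<forall>i.
        rep_eq S (Qop S (tens S \<phi> b) (tens S \<psi> b') $ i)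
          (\<lambda>x. Qhat S \<phi> \<psi> $ i * rep S b x * rep S b' x))) \<and>
     (\<forall>\<phi> \<psi> \<rho> b b' b''. cont_hist S \<phi> \<and> cont_hist S \<psi> \<and> cont_hist S \<rho> \<longrightarrow> (\<forall>i.
        rep_eq S (Cop S (tens S \<phi> b) (tens S \<psi> b') (tens S \<rho> b'') $ i)
          (\<lambda>x. Chat S \<phi> \<psi> \<rho> $ i * rep S b x * rep S b' x * rep S b'' x)))"

text \<open>\<open>L(\<alpha>) = L\<^sub>0 + L\<^sub>1(\<alpha>)/2 + \<dots>\<close> and \<open>D(\<alpha>) = D\<^sub>0 + D\<^sub>1(\<alpha>)/2 + \<dots>\<close>\<close>

definition L1 ::
  "('x::{real_inner,complete_space}, 'm::finite) rdde \<Rightarrow> real \<times> real \<Rightarrow> ('x, 'm) history \<Rightarrow>\<^sub>L ('x ^ 'm)" where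
  "L1 S \<alpha> = 2 *\<^sub>R frechet_derivative (Lop S) (at 0) \<alpha>"

definition d1 :: "('x::{real_inner,complete_space}, 'm::finite) rdde \<Rightarrow> real \<times> real \<Rightarrow> real ^ 'm" where
  "d1 S \<alpha> = 2 *\<^sub>R frechet_derivative (diffus S) (at 0) \<alpha>"


subsection \<open>Hypotheses of the bifurcation\<close>

definition c0_semigroup :: "(real \<Rightarrow> 'b::real_normed_vector \<Rightarrow>\<^sub>L 'b) \<Rightarrow> bool" where
  "c0_semigroup T \<longleftrightarrow>
     T 0 = id_blinfun \<and> (\<forall>s\<ge>0. \<forall>t\<ge>0. T (s + t) = T s o\<^sub>L T t) \<and>
     (\<forall>u. ((\<lambda>t. T t u) \<longlongrightarrow> u) (at_right 0))"

definition H1 :: "('x::{real_inner,complete_space}, 'm::finite) rdde \<Rightarrow> bool" where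
  "H1 S \<longleftrightarrow> (\<exists>T :: real \<Rightarrow> ('x ^ 'm) \<Rightarrow>\<^sub>L ('x ^ 'm).
     c0_semigroup T \<and>
     (\<forall>u w. ((\<lambda>t. (1 / t) *\<^sub>R (T t u - u)) \<longlongrightarrow> w) (at_right 0) \<longleftrightarrow>
            u \<in> dom_lap S \<and> w = diag_app (diffus S 0) (lap S u)) \<and>
     (\<exists>M\<ge>1. \<exists>\<omega>. \<forall>t\<ge>0. norm (T t) \<le> M * exp (\<omega> * t)) \<and>
     (\<forall>t>0. compact (closure (blinfun_apply (T t) ` cball 0 1))))"

definition H2 :: "('x::{real_inner,complete_space}, 'm::finite) rdde \<Rightarrow> bool" where
  "H2 S \<longleftrightarrow> (\<exists>Lt :: (real \<Rightarrow> 'x ^ 'm) \<Rightarrow> 'x ^ 'm.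
     (\<forall>f\<in>jump_space S. \<forall>g\<in>jump_space S. Lt (\<lambda>\<theta>. f \<theta> + g \<theta>) = Lt f + Lt g) \<and>
     (\<forall>c. \<forall>f\<in>jump_space S. Lt (\<lambda>\<theta>. vscale S c (f \<theta>)) = vscale S c (Lt f)) \<and>
     (\<exists>K. \<forall>f\<in>jump_space S. norm (Lt f) \<le> K * (SUP \<theta>\<in>{- delay S..0}. norm (f \<theta>))) \<and>
     (\<forall>\<phi>\<in>hist_space S. Lt (apply_bcontfun \<phi>) = Lop S 0 \<phi>))"

definition H3 :: "('x::{real_inner,complete_space}, 'm::finite) rdde \<Rightarrow> bool" where
  "H3 S \<longleftrightarrow> (\<forall>k. \<forall>v\<in>hist_space S.
     Lop S 0 (tens S (\<lambda>\<theta>. mode S k (apply_bcontfun v \<theta>)) (beta S k))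
       \<in> range (\<lambda>c. vtens S c (beta S k)))"

definition cdiag :: "real ^ 'm \<Rightarrow> complex ^ 'm ^ ('m::finite)" where
  "cdiag d = (\<chi> i j. if i = j then of_real (d $ i) else 0)"

definition char_matrix ::
  "('x::{real_inner,complete_space}, 'm::finite) rdde \<Rightarrow> nat \<Rightarrow> real \<times> real \<Rightarrow> complex \<Rightarrow> complex ^ 'm ^ 'm" where
  "char_matrix S k \<alpha> \<zeta> = mat \<zeta> + mu S k *\<^sub>R cdiag (diffus S \<alpha>)
     - (\<chi> i j. hat1 S (Lop S \<alpha>) (\<lambda>\<theta>. exp (\<zeta> * of_real \<theta>) *s axis j 1) $ i)"

definition char_fun ::
  "('x::{real_inner,complete_space}, 'm::finite) rdde \<Rightarrow> nat \<Rightarrow> real \<times> real \<Rightarrow> complex \<Rightarrow> complex" where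
  "char_fun S k \<alpha> \<zeta> = det (char_matrix S k \<alpha> \<zeta>)"

definition simple_root :: "(complex \<Rightarrow> complex) \<Rightarrow> complex \<Rightarrow> bool" where
  "simple_root f \<zeta> \<longleftrightarrow> f \<zeta> = 0 \<and> deriv f \<zeta> \<noteq> 0"

definition H4 :: "('x::{real_inner,complete_space}, 'm::finite) rdde \<Rightarrow> bool" where
  "H4 S \<longleftrightarrow> (\<exists>\<gamma> \<nu> \<omega> :: real \<times> real \<Rightarrow> real.
     \<gamma> 0 = 0 \<and> \<nu> 0 = 0 \<and> \<omega> 0 = omega0 S \<and> omega0 S > 0 \<and>
     (\<exists>c. c \<noteq> 0 \<and> ((\<lambda>s. \<gamma> (0, s)) has_real_derivative c) (at 0)) \<and>
     (\<exists>c. c \<noteq> 0 \<and> ((\<lambda>s. \<nu> (s, 0)) has_real_derivative c) (at 0)) \<and>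
     (\<forall>\<alpha>\<in>nbhd S.
        simple_root (char_fun S (k1 S) \<alpha>) (of_real (\<gamma> \<alpha>)) \<and>
        simple_root (char_fun S (k2 S) \<alpha>) (Complex (\<nu> \<alpha>) (\<omega> \<alpha>)) \<and>
        simple_root (char_fun S (k2 S) \<alpha>) (Complex (\<nu> \<alpha>) (- \<omega> \<alpha>)) \<and>
        (\<forall>k \<zeta>. char_fun S k \<alpha> \<zeta> = 0 \<and>
            \<not> (k = k1 S \<and> \<zeta> = of_real (\<gamma> \<alpha>)) \<and>
            \<not> (k = k2 S \<and> (\<zeta> = Complex (\<nu> \<alpha>) (\<omega> \<alpha>) \<or> \<zeta> = Complex (\<nu> \<alpha>) (- \<omega> \<alpha>)))
          \<longrightarrow> Re \<zeta> \<noteq> 0)))"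

definition hopf_steady_state :: "('x::{real_inner,complete_space}, 'm::finite) rdde \<Rightarrow> bool" where
  "hopf_steady_state S \<longleftrightarrow> H1 S \<and> H2 S \<and> H3 S \<and> H4 S"


subsection \<open>Eigenvectors, adjoint eigenvectors and the bilinear pairing\<close>

definition bounded_var :: "real \<Rightarrow> real \<Rightarrow> (real \<Rightarrow> complex) \<Rightarrow> bool" where
  "bounded_var a b e \<longleftrightarrow>
     (\<exists>K. \<forall>d. d division_of {a..b} \<longrightarrow> (\<Sum>I\<in>d. cmod (e (Sup I) - e (Inf I))) \<le> K)"

text \<open>Riemann--Stieltjes integral of \<open>g\<close> against \<open>e\<close>.\<close>

definition has_rs_integral ::
  "real \<Rightarrow> real \<Rightarrow> (real \<Rightarrow> complex) \<Rightarrow> (real \<Rightarrow> complex) \<Rightarrow> complex \<Rightarrow> bool" where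
  "has_rs_integral a b e g J \<longleftrightarrow> (\<forall>\<epsilon>>0. \<exists>\<delta>>0. \<forall>p.
     p tagged_division_of {a..b} \<and> (\<lambda>x. ball x \<delta>) fine p \<longrightarrow>
     cmod ((\<Sum>(x, I)\<in>p. (e (Sup I) - e (Inf I)) * g x) - J) < \<epsilon>)"

definition rs_integral :: "real \<Rightarrow> real \<Rightarrow> (real \<Rightarrow> complex) \<Rightarrow> (real \<Rightarrow> complex) \<Rightarrow> complex" where
  "rs_integral a b e g = (THE J. has_rs_integral a b e g J)"

definition eta_int ::
  "('x::{real_inner,complete_space}, 'm::finite) rdde \<Rightarrow> nat \<Rightarrow> (real \<Rightarrow> complex) \<Rightarrow> complex ^ 'm ^ 'm" where
  "eta_int S k g = (\<chi> i j. rs_integral (- delay S) 0 (\<lambda>\<theta>. eta S k \<theta> $ i $ j) g)"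

definition mode_rhs ::
  "('x::{real_inner,complete_space}, 'm::finite) rdde \<Rightarrow> nat \<Rightarrow> (real \<Rightarrow> complex ^ 'm) \<Rightarrow> complex ^ 'm" where
  "mode_rhs S k \<psi> = - (mu S k *\<^sub>R (cdiag (diffus S 0) *v \<psi> 0)) + hat1 S (Lop S 0) \<psi>"

definition eta_represents :: "('x::{real_inner,complete_space}, 'm::finite) rdde \<Rightarrow> bool" where
  "eta_represents S \<longleftrightarrow> (\<forall>k.
     (\<forall>i j. bounded_var (- delay S) 0 (\<lambda>\<theta>. eta S k \<theta> $ i $ j)) \<and>
     (\<forall>\<psi>. cont_hist S \<psi> \<longrightarrow> mode_rhs S k \<psi> =
        (\<chi> i. \<Sum>j\<in>UNIV. rs_integral (- delay S) 0 (\<lambda>\<theta>. eta S k \<theta> $ i $ j) (\<lambda>\<theta>. \<psi> \<theta> $ j))))"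

definition rowdot :: "complex ^ 'm \<Rightarrow> complex ^ ('m::finite) \<Rightarrow> complex" where
  "rowdot p v = (\<Sum>i\<in>UNIV. p $ i * v $ i)"

definition vcnj :: "complex ^ 'm \<Rightarrow> complex ^ ('m::finite)" where
  "vcnj v = (\<chi> i. cnj (v $ i))"

text \<open>The inner integral from 0 to \<open>\<theta> \<le> 0\<close> is written as minus the one over \<open>[\<theta>,0]\<close>.\<close>

definition pairing ::
  "('x::{real_inner,complete_space}, 'm::finite) rdde \<Rightarrow> nat \<Rightarrow> (real \<Rightarrow> complex ^ 'm)
   \<Rightarrow> (real \<Rightarrow> complex ^ 'm) \<Rightarrow> complex" where
  "pairing S k \<psi> \<phi> = rowdot (\<psi> 0) (\<phi> 0)
     - (\<Sum>i\<in>UNIV. \<Sum>j\<in>UNIV. rs_integral (- delay S) 0 (\<lambda>\<theta>. eta S k \<theta> $ i $ j)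
          (\<lambda>\<theta>. - integral {\<theta>..0} (\<lambda>\<xi>. \<psi> (\<xi> - \<theta>) $ i * \<phi> \<xi> $ j)))"

definition eigenspace ::
  "('x::{real_inner,complete_space}, 'm::finite) rdde \<Rightarrow> nat \<Rightarrow> complex \<Rightarrow> (real \<Rightarrow> complex ^ 'm) set" where
  "eigenspace S k \<zeta> = {\<phi>.
     (\<forall>\<theta>\<in>{- delay S..0}. (\<phi> has_vector_derivative \<zeta> *s \<phi> \<theta>) (at \<theta> within {- delay S..0})) \<and>
     \<zeta> *s \<phi> 0 = mode_rhs S k \<phi>}"

text \<open>Eigenfunctions on \<open>[0,r]\<close> of the formal adjoint \<open>\<psi> \<mapsto> -\<psi>'\<close>, with
  \<open>-\<psi>'(0) = \<integral> \<psi>(-\<theta>) d\<eta>\<^sub>k(\<theta>)\<close>.\<close>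

definition adj_eigenspace ::
  "('x::{real_inner,complete_space}, 'm::finite) rdde \<Rightarrow> nat \<Rightarrow> complex \<Rightarrow> (real \<Rightarrow> complex ^ 'm) set" where
  "adj_eigenspace S k \<zeta> = {\<psi>.
     (\<forall>s\<in>{0..delay S}. (\<psi> has_vector_derivative - (\<zeta> *s \<psi> s)) (at s within {0..delay S})) \<and>
     \<zeta> *s \<psi> 0 = (\<chi> j. \<Sum>i\<in>UNIV.
        rs_integral (- delay S) 0 (\<lambda>\<theta>. eta S k \<theta> $ i $ j) (\<lambda>\<theta>. \<psi> (- \<theta>) $ i))}"

definition spans_eigenspace ::
  "('x::{real_inner,complete_space}, 'm::finite) rdde \<Rightarrow> nat \<Rightarrow> complex \<Rightarrow> (real \<Rightarrow> complex ^ 'm) \<Rightarrow> bool" where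
  "spans_eigenspace S k \<zeta> \<phi> \<longleftrightarrow> \<phi> \<in> eigenspace S k \<zeta> \<and> \<phi> 0 \<noteq> 0 \<and>
     (\<forall>\<chi>'\<in>eigenspace S k \<zeta>. \<exists>c. \<forall>\<theta>\<in>{- delay S..0}. \<chi>' \<theta> = c *s \<phi> \<theta>)"

definition phi1 :: "('x::{real_inner,complete_space}, 'm::finite) rdde \<Rightarrow> real \<Rightarrow> complex ^ 'm" where
  "phi1 S \<theta> = phi10 S"

definition phi2 :: "('x::{real_inner,complete_space}, 'm::finite) rdde \<Rightarrow> real \<Rightarrow> complex ^ 'm" where
  "phi2 S \<theta> = exp (\<i> * of_real (omega0 S * \<theta>)) *s phi20 S"

definition phi2c :: "('x::{real_inner,complete_space}, 'm::finite) rdde \<Rightarrow> real \<Rightarrow> complex ^ 'm" where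
  "phi2c S \<theta> = vcnj (phi2 S \<theta>)"

definition psi1 :: "('x::{real_inner,complete_space}, 'm::finite) rdde \<Rightarrow> real \<Rightarrow> complex ^ 'm" where
  "psi1 S s = psi10 S"

definition psi2 :: "('x::{real_inner,complete_space}, 'm::finite) rdde \<Rightarrow> real \<Rightarrow> complex ^ 'm" where
  "psi2 S s = exp (- \<i> * of_real (omega0 S * s)) *s psi20 S"

definition psi2c :: "('x::{real_inner,complete_space}, 'm::finite) rdde \<Rightarrow> real \<Rightarrow> complex ^ 'm" where
  "psi2c S s = vcnj (psi2 S s)"

definition bases :: "('x::{real_inner,complete_space}, 'm::finite) rdde \<Rightarrow> bool" where
  "bases S \<longleftrightarrow>
     eta_represents S \<and>
     (\<forall>i. phi10 S $ i \<in> \<real>) \<and> (\<forall>i. psi10 S $ i \<in> \<real>) \<and>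
     spans_eigenspace S (k1 S) 0 (phi1 S) \<and>
     spans_eigenspace S (k2 S) (\<i> * of_real (omega0 S)) (phi2 S) \<and>
     psi1 S \<in> adj_eigenspace S (k1 S) 0 \<and>
     psi2 S \<in> adj_eigenspace S (k2 S) (\<i> * of_real (omega0 S)) \<and>
     pairing S (k1 S) (psi1 S) (phi1 S) = 1 \<and>
     pairing S (k2 S) (psi2 S) (phi2 S) = 1 \<and>
     pairing S (k2 S) (psi2 S) (phi2c S) = 0 \<and>
     pairing S (k2 S) (psi2c S) (phi2 S) = 0 \<and>
     pairing S (k2 S) (psi2c S) (phi2c S) = 1"


subsection \<open>Decomposition of the phase space\<close>

definition spec_proj ::
  "('x::{real_inner,complete_space}, 'm::finite) rdde \<Rightarrow> (real \<Rightarrow> 'x ^ 'm) \<Rightarrow> real \<Rightarrow> 'x ^ 'm" where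
  "spec_proj S \<phi> \<theta> =
     vtens S (pairing S (k1 S) (psi1 S) (\<lambda>\<xi>. mode S (k1 S) (\<phi> \<xi>)) *s phi1 S \<theta>) (beta S (k1 S)) +
     vtens S (pairing S (k2 S) (psi2 S) (\<lambda>\<xi>. mode S (k2 S) (\<phi> \<xi>)) *s phi2 S \<theta> +
              pairing S (k2 S) (psi2c S) (\<lambda>\<xi>. mode S (k2 S) (\<phi> \<xi>)) *s phi2c S \<theta>) (beta S (k2 S))"

definition Q1 :: "('x::{real_inner,complete_space}, 'm::finite) rdde \<Rightarrow> ('x, 'm) history set" where
  "Q1 S = {\<phi> \<in> hist_space S.
     (\<exists>\<phi>'. cont_hist S \<phi>' \<and> (\<forall>\<theta>\<in>{- delay S..0}.
        (apply_bcontfun \<phi> has_vector_derivative \<phi>' \<theta>) (at \<theta> within {- delay S..0}))) \<and>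
     apply_bcontfun \<phi> 0 \<in> dom_lap S \<and>
     (\<forall>\<theta>\<in>{- delay S..0}. spec_proj S (apply_bcontfun \<phi>) \<theta> = 0)}"

definition hderiv ::
  "('x::{real_inner,complete_space}, 'm::finite) rdde \<Rightarrow> ('x, 'm) history \<Rightarrow> real \<Rightarrow> 'x ^ 'm" where
  "hderiv S \<phi> \<theta> = vector_derivative (apply_bcontfun \<phi>) (at \<theta> within {- delay S..0})"

definition A1 ::
  "('x::{real_inner,complete_space}, 'm::finite) rdde \<Rightarrow> ('x, 'm) history \<Rightarrow> real \<Rightarrow> 'x ^ 'm" where
  "A1 S \<phi> \<theta> = hderiv S \<phi> \<theta> +
     X0 (Lop S 0 \<phi> + diag_app (diffus S 0) (lap S (apply_bcontfun \<phi> 0)) - hderiv S \<phi> 0) \<theta>"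

text \<open>The variables \<open>z\<close> are treated as three independent complex variables, the third one
  standing for the conjugate of the second.\<close>

definition wmap ::
  "('x::{real_inner,complete_space}, 'm::finite) rdde \<Rightarrow> complex ^ 3 \<Rightarrow> ('x, 'm) history" where
  "wmap S z = tens S (\<lambda>\<theta>. (z $ 1) *s phi1 S \<theta>) (beta S (k1 S)) +
     tens S (\<lambda>\<theta>. (z $ 2) *s phi2 S \<theta> + (z $ 3) *s phi2c S \<theta>) (beta S (k2 S))"

definition Bmap :: "('x::{real_inner,complete_space}, 'm::finite) rdde \<Rightarrow> complex ^ 3 \<Rightarrow> complex ^ 3" where
  "Bmap S z = vector [0, \<i> * of_real (omega0 S) * z $ 2, - \<i> * of_real (omega0 S) * z $ 3]"

definition F2 ::
  "('x::{real_inner,complete_space}, 'm::finite) rdde \<Rightarrow> ('x, 'm) history \<Rightarrow> real \<times> real \<Rightarrow> 'x ^ 'm" where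
  "F2 S v \<alpha> = L1 S \<alpha> v + diag_app (d1 S \<alpha>) (lap S (apply_bcontfun v 0)) + Qop S v v"

definition F3 ::
  "('x::{real_inner,complete_space}, 'm::finite) rdde \<Rightarrow> ('x, 'm) history \<Rightarrow> 'x ^ 'm" where
  "F3 S v = Cop S v v v"

definition centre_part ::
  "('x::{real_inner,complete_space}, 'm::finite) rdde \<Rightarrow> 'x ^ 'm \<Rightarrow> complex ^ 3" where
  "centre_part S F = vector [rowdot (psi1 S 0) (mode S (k1 S) F),
     rowdot (psi2 S 0) (mode S (k2 S) F), rowdot (psi2c S 0) (mode S (k2 S) F)]"

definition f21 ::
  "('x::{real_inner,complete_space}, 'm::finite) rdde \<Rightarrow> complex ^ 3 \<Rightarrow> ('x, 'm) history
   \<Rightarrow> real \<times> real \<Rightarrow> complex ^ 3" where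
  "f21 S z y \<alpha> = centre_part S (F2 S (wmap S z + y) \<alpha>)"

definition f31 ::
  "('x::{real_inner,complete_space}, 'm::finite) rdde \<Rightarrow> complex ^ 3 \<Rightarrow> ('x, 'm) history \<Rightarrow> complex ^ 3" where
  "f31 S z y = centre_part S (F3 S (wmap S z + y))"

definition f22 ::
  "('x::{real_inner,complete_space}, 'm::finite) rdde \<Rightarrow> complex ^ 3 \<Rightarrow> ('x, 'm) history
   \<Rightarrow> real \<times> real \<Rightarrow> real \<Rightarrow> 'x ^ 'm" where
  "f22 S z y \<alpha> \<theta> = X0 (F2 S (wmap S z + y) \<alpha>) \<theta> - spec_proj S (X0 (F2 S (wmap S z + y) \<alpha>)) \<theta>"


subsection \<open>Normal form\<close>

text \<open>The index \<open>(((a,b,c),(d,e)),j)\<close> stands for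
  \<open>z\<^sub>1\<^sup>a z\<^sub>2\<^sup>b z\<^sub>3\<^sup>c \<alpha>\<^sub>1\<^sup>d \<alpha>\<^sub>2\<^sup>e\<close> times the \<open>j\<close>-th unit vector.\<close>

type_synonym mono_index = "((nat \<times> nat \<times> nat) \<times> (nat \<times> nat)) \<times> 3"

definition zmono :: "nat \<times> nat \<times> nat \<Rightarrow> complex ^ 3 \<Rightarrow> complex" where
  "zmono q z = (case q of (a, b, c) \<Rightarrow> (z $ 1) ^ a * (z $ 2) ^ b * (z $ 3) ^ c)"

definition vmono :: "mono_index \<Rightarrow> complex ^ 3 \<Rightarrow> real \<times> real \<Rightarrow> complex ^ 3" where
  "vmono n z \<alpha> = (case n of ((q, (d, e)), j) \<Rightarrow>
     axis j (zmono q z * of_real (fst \<alpha> ^ d * snd \<alpha> ^ e)))"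

definition monoms :: "nat \<Rightarrow> mono_index set" where
  "monoms N = {(((a, b, c), (d, e)), j) | a b c d e j. a + b + c + d + e = N}"

definition poly_coeffs ::
  "nat \<Rightarrow> (complex ^ 3 \<Rightarrow> real \<times> real \<Rightarrow> complex ^ 3) \<Rightarrow> mono_index \<Rightarrow> complex" where
  "poly_coeffs N p = (THE c. (\<forall>n. n \<notin> monoms N \<longrightarrow> c n = 0) \<and>
     (\<forall>z \<alpha>. p z \<alpha> = (\<Sum>n\<in>monoms N. c n *s vmono n z \<alpha>)))"

definition compl2 :: "mono_index set" where
  "compl2 = {(((2,0,0),(0,0)),1), (((0,1,1),(0,0)),1), (((1,0,0),(1,0)),1), (((1,0,0),(0,1)),1),
             (((1,1,0),(0,0)),2), (((0,1,0),(1,0)),2), (((0,1,0),(0,1)),2),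
             (((1,0,1),(0,0)),3), (((0,0,1),(1,0)),3), (((0,0,1),(0,1)),3)}"

definition compl3 :: "mono_index set" where
  "compl3 = {(((3,0,0),(0,0)),1), (((1,1,1),(0,0)),1),
             (((2,1,0),(0,0)),2), (((0,2,1),(0,0)),2),
             (((2,0,1),(0,0)),3), (((0,1,2),(0,0)),3)}"

definition Proj ::
  "nat \<Rightarrow> mono_index set \<Rightarrow> (complex ^ 3 \<Rightarrow> real \<times> real \<Rightarrow> complex ^ 3)
   \<Rightarrow> complex ^ 3 \<Rightarrow> real \<times> real \<Rightarrow> complex ^ 3" where
  "Proj N K p z \<alpha> = (\<Sum>n\<in>K. poly_coeffs N p n *s vmono n z \<alpha>)"

definition M1 ::
  "('x::{real_inner,complete_space}, 'm::finite) rdde \<Rightarrow> (complex ^ 3 \<Rightarrow> complex ^ 3)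
   \<Rightarrow> complex ^ 3 \<Rightarrow> complex ^ 3" where
  "M1 S p z = frechet_derivative p (at z) (Bmap S z) - Bmap S (p z)"

definition g21 ::
  "('x::{real_inner,complete_space}, 'm::finite) rdde \<Rightarrow> complex ^ 3 \<Rightarrow> real \<times> real \<Rightarrow> complex ^ 3" where
  "g21 S = Proj 2 compl2 (\<lambda>z \<alpha>. f21 S z 0 \<alpha>)"

definition is_U21 ::
  "('x::{real_inner,complete_space}, 'm::finite) rdde \<Rightarrow> (complex ^ 3 \<Rightarrow> complex ^ 3) \<Rightarrow> bool" where
  "is_U21 S U \<longleftrightarrow>
     (\<exists>c. \<forall>z. U z = (\<Sum>n\<in>{n \<in> monoms 2 - compl2. snd (fst n) = (0, 0)}. c n *s vmono n z 0)) \<and>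
     (\<forall>z. M1 S U z = f21 S z 0 0 - g21 S z 0)"

definition quad :: "(nat \<times> nat \<times> nat) set" where
  "quad = {(2,0,0), (0,2,0), (0,0,2), (1,1,0), (1,0,1), (0,1,1)}"

definition hpoly ::
  "('x::{real_inner,complete_space}, 'm::finite) rdde \<Rightarrow> (nat \<times> nat \<times> nat \<Rightarrow> ('x, 'm) history)
   \<Rightarrow> complex ^ 3 \<Rightarrow> ('x, 'm) history" where
  "hpoly S h z = (\<Sum>q\<in>quad. hscale S (zmono q z) (h q))"

definition solves_h ::
  "('x::{real_inner,complete_space}, 'm::finite) rdde \<Rightarrow> (nat \<times> nat \<times> nat \<Rightarrow> ('x, 'm) history) \<Rightarrow> bool" where
  "solves_h S h \<longleftrightarrow> (\<forall>q\<in>quad. h q \<in> Q1 S) \<and>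
     (\<forall>z. \<forall>\<theta>\<in>{- delay S..0}.
        apply_bcontfun (frechet_derivative (hpoly S h) (at z) (Bmap S z)) \<theta> - A1 S (hpoly S h z) \<theta>
          = (1/2) *\<^sub>R f22 S z 0 0 \<theta>)"

definition is_unique_h ::
  "('x::{real_inner,complete_space}, 'm::finite) rdde \<Rightarrow> (nat \<times> nat \<times> nat \<Rightarrow> ('x, 'm) history) \<Rightarrow> bool" where
  "is_unique_h S h \<longleftrightarrow> solves_h S h \<and> (\<forall>h'. solves_h S h' \<longrightarrow> (\<forall>q\<in>quad. h' q = h q))"

text \<open>At \<open>\<alpha> = 0\<close> the Laplacian drops out of \<open>f\<^sub>2\<^sup>1\<close>, so its derivative in \<open>y\<close> exists on the
  whole history space and not only along \<open>Q1\<close>.\<close>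

definition g31 ::
  "('x::{real_inner,complete_space}, 'm::finite) rdde \<Rightarrow> (complex ^ 3 \<Rightarrow> complex ^ 3)
   \<Rightarrow> (nat \<times> nat \<times> nat \<Rightarrow> ('x, 'm) history) \<Rightarrow> complex ^ 3 \<Rightarrow> complex ^ 3" where
  "g31 S U h z = Proj 3 compl3 (\<lambda>z _. f31 S z 0 + (3/2) *\<^sub>R
     (frechet_derivative (\<lambda>(z, y). f21 S z y 0) (at (z, 0)) (U z, 2 *\<^sub>R hpoly S h z)
      - frechet_derivative U (at z) (g21 S z 0))) z 0"

text \<open>The normal form on the centre manifold without the higher-order terms.\<close>

definition normal_form ::
  "('x::{real_inner,complete_space}, 'm::finite) rdde \<Rightarrow> (complex ^ 3 \<Rightarrow> complex ^ 3)
   \<Rightarrow> (nat \<times> nat \<times> nat \<Rightarrow> ('x, 'm) history) \<Rightarrow> complex ^ 3 \<Rightarrow> real \<times> real \<Rightarrow> complex ^ 3" where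
  "normal_form S U h z \<alpha> = Bmap S z + (1/2) *\<^sub>R g21 S z \<alpha> + (1/6) *\<^sub>R g31 S U h z"

definition a1 :: "('x::{real_inner,complete_space}, 'm::finite) rdde \<Rightarrow> real \<times> real \<Rightarrow> complex" where
  "a1 S \<alpha> = (1/2) * rowdot (psi1 S 0)
     (hat1 S (L1 S \<alpha>) (phi1 S) - mu S (k1 S) *\<^sub>R (cdiag (d1 S \<alpha>) *v phi1 S 0))"

definition b2 :: "('x::{real_inner,complete_space}, 'm::finite) rdde \<Rightarrow> real \<times> real \<Rightarrow> complex" where
  "b2 S \<alpha> = (1/2) * rowdot (psi2 S 0)
     (hat1 S (L1 S \<alpha>) (phi2 S) - mu S (k2 S) *\<^sub>R (cdiag (d1 S \<alpha>) *v phi2 S 0))"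

definition normal_form_coeffs ::
  "('x::{real_inner,complete_space}, 'm::finite) rdde \<Rightarrow> (complex ^ 3 \<Rightarrow> complex ^ 3)
   \<Rightarrow> (nat \<times> nat \<times> nat \<Rightarrow> ('x, 'm) history) \<Rightarrow> complex \<Rightarrow> complex \<Rightarrow> complex \<Rightarrow> complex
   \<Rightarrow> complex \<Rightarrow> complex \<Rightarrow> complex \<Rightarrow> bool" where
  "normal_form_coeffs S U h a11 a23 a111 a123 b12 b112 b223 \<longleftrightarrow> (\<forall>z \<alpha>.
     normal_form S U h z \<alpha> = vector [
       a1 S \<alpha> * z $ 1 + a11 * (z $ 1)\<^sup>2 + a23 * z $ 2 * z $ 3
         + a111 * (z $ 1) ^ 3 + a123 * z $ 1 * z $ 2 * z $ 3,
       \<i> * of_real (omega0 S) * z $ 2 + b2 S \<alpha> * z $ 2 + b12 * z $ 1 * z $ 2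
         + b112 * (z $ 1)\<^sup>2 * z $ 2 + b223 * (z $ 2)\<^sup>2 * z $ 3,
       - \<i> * of_real (omega0 S) * z $ 3 + cnj (b2 S \<alpha>) * z $ 3 + cnj b12 * z $ 1 * z $ 3
         + cnj b112 * (z $ 1)\<^sup>2 * z $ 3 + cnj b223 * z $ 2 * (z $ 3)\<^sup>2])"

definition hmode ::
  "('x::{real_inner,complete_space}, 'm::finite) rdde \<Rightarrow> (nat \<times> nat \<times> nat \<Rightarrow> ('x, 'm) history)
   \<Rightarrow> nat \<times> nat \<times> nat \<Rightarrow> nat \<Rightarrow> real \<Rightarrow> complex ^ 'm" where
  "hmode S h q k \<theta> = mode S k (apply_bcontfun (h q) \<theta>)"

text \<open>The combination \<open>h\<^sub>q\<^sup>0 + h\<^sub>q\<^sup>2\<^sup>k / \<surd>2\<close> with \<open>k = k\<^sub>1\<close>.\<close>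

definition hcomb ::
  "('x::{real_inner,complete_space}, 'm::finite) rdde \<Rightarrow> (nat \<times> nat \<times> nat \<Rightarrow> ('x, 'm) history)
   \<Rightarrow> nat \<times> nat \<times> nat \<Rightarrow> real \<Rightarrow> complex ^ 'm" where
  "hcomb S h q \<theta> = hmode S h q 0 \<theta> + of_real (1 / sqrt 2) *s hmode S h q (2 * k1 S) \<theta>"

definition expiw :: "('x::{real_inner,complete_space}, 'm::finite) rdde \<Rightarrow> nat \<Rightarrow> real \<Rightarrow> complex" where
  "expiw S n \<theta> = exp (of_nat n * \<i> * of_real (omega0 S * \<theta>))"

definition res_matrix ::
  "('x::{real_inner,complete_space}, 'm::finite) rdde \<Rightarrow> nat \<Rightarrow> nat \<Rightarrow> complex ^ 'm ^ 'm" where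
  "res_matrix S n k = mat (of_nat n * \<i> * of_real (omega0 S)) - eta_int S k (expiw S n)"

end

theory Submission
  imports Defs
begin

text \<open>
  Both critical eigenvalues belong to the same mode \<open>k = k\<^sub>1 = k\<^sub>2 \<noteq> 0\<close>, so every critical history is
  \<open>w = \<phi> \<beta>\<^sub>k\<close> for a single function \<open>\<phi>\<close> of \<open>\<theta>\<close>.  The proof rests on products of eigenfunctions:
  \<open>\<beta>\<^sub>k\<^sup>2 = \<beta>\<^sub>0 + \<beta>\<^sub>2\<^sub>k / \<surd>2\<close> and \<open>\<beta>\<^sub>k \<beta>\<^sub>2\<^sub>k = (\<beta>\<^sub>k + \<beta>\<^sub>3\<^sub>k) / \<surd>2\<close>.

  Since \<open>\<beta>\<^sub>k\<^sup>2\<close> has no component along \<open>\<beta>\<^sub>k\<close>, the form \<open>Q(w,w)\<close> vanishes after pairing with the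
  adjoint eigenvectors (\<open>centre_Q_zero\<close>).  Hence no quadratic monomial in \<open>z\<close> survives, which gives
  \<open>a\<^sub>1\<^sub>1 = a\<^sub>2\<^sub>3 = b\<^sub>1\<^sub>2 = 0\<close>, and all terms of the cubic normal form that contain the change of variables
  \<open>U\<^sub>2\<^sup>1\<close> drop out.  What is left at third order is \<open>C(w,w,w)/6 + Q(w,h)\<close>, expanded in monomials
  (\<open>cubic_expansion\<close>) and restricted to the resonant ones (\<open>g31_eq\<close>).  The numerical factors come from
  \<open>\<langle>\<beta>\<^sub>k\<^sup>3, \<beta>\<^sub>k\<rangle> = 3/2\<close>, \<open>\<langle>\<beta>\<^sub>0 \<beta>\<^sub>k, \<beta>\<^sub>k\<rangle> = 1\<close> and \<open>\<langle>\<beta>\<^sub>2\<^sub>k \<beta>\<^sub>k, \<beta>\<^sub>k\<rangle> = 1/\<surd>2\<close>.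

  The equation for \<open>h\<close> is forced by \<open>Q(w,w)/2\<close>, that is, only in the modes \<open>0\<close> and \<open>2k\<close>.  Trying
  \<open>a e\<^sup>\<zeta>\<^sup>\<theta> \<beta>\<^sub>j\<close> for the coefficient of a monomial that \<open>B\<close> multiplies by \<open>\<zeta>\<close> reduces the equation to a linear
  system with the characteristic matrix of mode \<open>j\<close> at \<open>\<zeta>\<close> (\<open>solves_hsol\<close>).  These matrices are
  invertible, because \<open>\<zeta>\<close> is purely imaginary or zero and all eigenvalues on the imaginary axis belong to mode \<open>k\<close>
  (\<open>char_matrix_invertible\<close>).  As the solution \<open>h\<close> is unique, it is this explicit one.

  The third component of the normal form is the conjugate of the second because \<open>L\<close>, \<open>Q\<close> and \<open>C\<close>
  commute with conjugation.  For \<open>Q\<close> and \<open>C\<close> this has to be extracted from the reality of \<open>G\<close>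
  through its Taylor expansion (\<open>taylor_forms_real\<close>).
\<close>


section \<open>The function space\<close>

lemma bounded_linear_vecI:
  fixes f :: "'a::real_normed_vector \<Rightarrow> 'b::real_normed_vector ^ 'n"
  assumes "\<And>i. bounded_linear (\<lambda>x. f x $ i)"
  shows "bounded_linear f"
proof -
  obtain K where K: "\<And>i x. norm (f x $ i) \<le> norm x * K i"
    using bounded_linear.bounded[OF assms] by metis
  show ?thesis
  proof (rule bounded_linear_intro[where K = "\<Sum>i\<in>UNIV. K i"])
    fix x y :: 'a and r :: real
    show "f (x + y) = f x + f y"
      by (simp add: vec_eq_iff linear_add[OF bounded_linear.linear[OF assms]])
    show "f (r *\<^sub>R x) = r *\<^sub>R f x"
      by (simp add: vec_eq_iff linear_scale[OF bounded_linear.linear[OF assms]])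
    have "norm (f x) \<le> (\<Sum>i\<in>UNIV. norm (f x $ i))"
      unfolding norm_vec_def by (rule L2_set_le_sum) simp
    also have "\<dots> \<le> norm x * (\<Sum>i\<in>UNIV. K i)"
      by (simp add: sum_distrib_left K sum_mono)
    finally show "norm (f x) \<le> norm x * (\<Sum>i\<in>UNIV. K i)" .
  qed
qed

locale function_model =
  fixes S :: "('x::{real_inner,complete_space}, 'm::finite) rdde"
  assumes function_space: "function_space S"
begin

lemma ell_pos: "ell S > 0"
  using function_space by (simp add: function_space_def)

lemma len_pos: "ell S * pi > 0"
  using ell_pos by simp

lemma square_int_rep: "square_int (dom_int S) (rep S u)"
  using function_space by (simp add: function_space_def)

lemma rep_eq_self: "rep_eq S u (rep S u)"
  by (simp add: rep_eq_def)

lemma rep_eq_unique: "rep_eq S u f \<Longrightarrow> rep_eq S v f \<Longrightarrow> u = v"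
proof -
  assume "rep_eq S u f" "rep_eq S v f"
  then have "rep_eq S u (rep S v)"
    unfolding rep_eq_def by eventually_elim simp
  then show "u = v"
    using function_space by (simp add: function_space_def)
qed

lemma rep_eq_add:
  assumes "rep_eq S u f" "rep_eq S v g"
  shows "rep_eq S (u + v) (\<lambda>x. f x + g x)"
proof -
  have "rep_eq S (u + v) (\<lambda>x. rep S u x + rep S v x)"
    using function_space by (simp add: function_space_def)
  with assms show ?thesis
    unfolding rep_eq_def by eventually_elim simp
qed

lemma rep_eq_scaleR:
  assumes "rep_eq S u f"
  shows "rep_eq S (a *\<^sub>R u) (\<lambda>x. of_real a * f x)"
proof -
  have "rep_eq S (a *\<^sub>R u) (\<lambda>x. of_real a * rep S u x)"
    using function_space by (simp add: function_space_def)
  with assms show ?thesis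
    unfolding rep_eq_def by eventually_elim simp
qed

lemma rep_eq_cscale_aux:
  "rep_eq S (cscale S c u) (\<lambda>x. c * rep S u x) \<and> norm (cscale S c u) = cmod c * norm u"
proof -
  have "\<forall>c u. \<exists>v. rep_eq S v (\<lambda>x. c * rep S u x) \<and> norm v = cmod c * norm u"
    using function_space unfolding function_space_def by (elim conjE)
  then obtain v where v: "rep_eq S v (\<lambda>x. c * rep S u x)" "norm v = cmod c * norm u"
    by blast
  have "cscale S c u = v"
    unfolding cscale_def using v rep_eq_unique by blast
  with v show ?thesis by simp
qed

lemma norm_cscale: "norm (cscale S c u) = cmod c * norm u"
  using rep_eq_cscale_aux by blast

lemma rep_eq_cscale:
  assumes "rep_eq S u f"
  shows "rep_eq S (cscale S c u) (\<lambda>x. c * f x)"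
  using conjunct1[OF rep_eq_cscale_aux[of c u]] assms
  unfolding rep_eq_def by eventually_elim simp

lemma rep_eq_beta: "rep_eq S (beta S k) (eigfun S k)"
proof -
  have "\<forall>k. \<exists>u. rep_eq S u (eigfun S k)"
    using function_space unfolding function_space_def by (elim conjE)
  then obtain u where u: "rep_eq S u (eigfun S k)"
    by blast
  have "beta S k = u"
    unfolding beta_def using u rep_eq_unique by blast
  with u show ?thesis by simp
qed

lemma rep_eq_cong:
  assumes "rep_eq S u f" "\<And>x. f x = g x"
  shows "rep_eq S u g"
  using assms by (simp add: rep_eq_def)

lemma cscale_add_left: "cscale S (c + d) u = cscale S c u + cscale S d u"
  by (rule rep_eq_unique[OF rep_eq_cscale[OF rep_eq_self]])
     (rule rep_eq_cong[OF rep_eq_add[OF rep_eq_cscale[OF rep_eq_self] rep_eq_cscale[OF rep_eq_self]]],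
      simp add: algebra_simps)

lemma cscale_add_right: "cscale S c (u + v) = cscale S c u + cscale S c v"
  by (rule rep_eq_unique[OF rep_eq_cscale[OF rep_eq_add[OF rep_eq_self rep_eq_self]]])
     (rule rep_eq_cong[OF rep_eq_add[OF rep_eq_cscale[OF rep_eq_self] rep_eq_cscale[OF rep_eq_self]]],
      simp add: algebra_simps)

lemma cscale_cscale: "cscale S c (cscale S d u) = cscale S (c * d) u"
  by (rule rep_eq_unique[OF rep_eq_cscale[OF rep_eq_cscale[OF rep_eq_self]]])
     (rule rep_eq_cong[OF rep_eq_cscale[OF rep_eq_self]], simp add: algebra_simps)

lemma cscale_of_real: "cscale S (of_real a) u = a *\<^sub>R u"
  by (rule rep_eq_unique[OF rep_eq_cscale[OF rep_eq_self] rep_eq_scaleR[OF rep_eq_self]])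

lemma scaleR_cscale: "a *\<^sub>R cscale S c u = cscale S (a *\<^sub>R c) u"
  by (simp add: cscale_of_real[symmetric] cscale_cscale scaleR_conv_of_real)

lemma cscale_scaleR: "cscale S c (a *\<^sub>R u) = a *\<^sub>R cscale S c u"
  by (simp add: cscale_of_real[symmetric] cscale_cscale mult.commute)

lemma bounded_linear_cscale_left: "bounded_linear (\<lambda>c. cscale S c u)"
  by (rule bounded_linear_intro[where K = "norm u"])
     (simp_all add: cscale_add_left scaleR_cscale norm_cscale)

lemma bounded_linear_cscale_right: "bounded_linear (cscale S c)"
  by (rule bounded_linear_intro[where K = "cmod c"])
     (simp_all add: cscale_add_right cscale_scaleR norm_cscale mult.commute)

lemma vtens_nth [simp]: "vtens S c b $ i = cscale S (c $ i) b"
  by (simp add: vtens_def)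

lemma vscale_nth [simp]: "vscale S c v $ i = cscale S c (v $ i)"
  by (simp add: vscale_def)

lemma bounded_linear_vtens: "bounded_linear (\<lambda>c. vtens S c b)"
  by (rule bounded_linear_vecI)
     (simp add: bounded_linear_compose[OF bounded_linear_cscale_left bounded_linear_vec_nth])

lemmas vtens_add = linear_add[OF bounded_linear.linear[OF bounded_linear_vtens]]
lemmas vtens_zero [simp] = linear_0[OF bounded_linear.linear[OF bounded_linear_vtens]]
lemmas vtens_diff = linear_diff[OF bounded_linear.linear[OF bounded_linear_vtens]]
lemmas vtens_scaleR = linear_scale[OF bounded_linear.linear[OF bounded_linear_vtens]]

lemma vscale_vtens: "vscale S c (vtens S a b) = vtens S (c *s a) b"
  by (simp add: vec_eq_iff cscale_cscale)

lemma bounded_linear_vscale_left: "bounded_linear (\<lambda>c. vscale S c v)"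
  by (rule bounded_linear_vecI) (simp add: bounded_linear_cscale_left)

lemma bounded_linear_vscale_right: "bounded_linear (vscale S c)"
  by (rule bounded_linear_vecI)
     (simp add: bounded_linear_compose[OF bounded_linear_cscale_right bounded_linear_vec_nth])

lemma norm_vscale: "norm (vscale S c v) = cmod c * norm v"
  by (simp add: norm_vec_def norm_cscale L2_set_right_distrib)


subsection \<open>Pairing with the eigenfunctions\<close>

lemma sets_dom_int [measurable, simp]: "dom_int S \<in> sets lebesgue"
  by (simp add: dom_int_def)

lemma square_int_imp_integrable:
  assumes "square_int {0..b} f"
  shows "integrable (lebesgue_on {0..b}) f"
proof (rule Bochner_Integration.integrable_bound)
  have "finite_measure (lebesgue_on {0..b})"
    by (rule finite_measure_lebesgue_on) simp
  then interpret finite_measure "lebesgue_on {0..b}" .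
  show "integrable (lebesgue_on {0..b}) (\<lambda>x. 1 + (cmod (f x))\<^sup>2)"
    using assms by (simp add: square_int_def)
  show "f \<in> borel_measurable (lebesgue_on {0..b})"
    using assms by (simp add: square_int_def)
  have "y \<le> 1 + y\<^sup>2" for y :: real
    using zero_le_power2[of "y - 1/2"] by (simp add: power2_eq_square algebra_simps)
  then show "AE x in lebesgue_on {0..b}. norm (f x) \<le> norm (1 + (cmod (f x))\<^sup>2)"
    by (intro AE_I2) (simp add: abs_of_nonneg)
qed

lemma integrable_rep: "integrable (lebesgue_on (dom_int S)) (rep S u)"
  using square_int_imp_integrable square_int_rep[of u] by (simp add: dom_int_def)

lemma continuous_eigfun: "continuous_on A (eigfun S k)"
  unfolding eigfun_def using ell_pos by (cases "k = 0") (auto intro!: continuous_intros)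

lemma cmod_eigfun: "cmod (eigfun S k x) \<le> sqrt 2"
  by (auto simp: eigfun_def abs_mult mult_left_le)

lemma cnj_eigfun [simp]: "cnj (eigfun S k x) = eigfun S k x"
  by (simp add: eigfun_def)

lemma eigfun_0 [simp]: "eigfun S 0 x = 1"
  by (simp add: eigfun_def)

lemma measurable_eigfun [measurable]: "eigfun S k \<in> borel_measurable (lebesgue_on (dom_int S))"
  unfolding dom_int_def
  by (rule continuous_imp_measurable_on_sets_lebesgue[OF continuous_eigfun]) simp

lemma integrable_mult_eigfun:
  assumes "integrable (lebesgue_on (dom_int S)) f"
  shows "integrable (lebesgue_on (dom_int S)) (\<lambda>x. f x * eigfun S k x)"
proof (rule Bochner_Integration.integrable_bound)
  show "integrable (lebesgue_on (dom_int S)) (\<lambda>x. sqrt 2 * norm (f x))"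
    using assms by simp
  show "(\<lambda>x. f x * eigfun S k x) \<in> borel_measurable (lebesgue_on (dom_int S))"
    using assms by measurable
  show "AE x in lebesgue_on (dom_int S). norm (f x * eigfun S k x) \<le> norm (sqrt 2 * norm (f x))"
    using mult_right_mono[OF cmod_eigfun norm_ge_zero]
    by (intro AE_I2) (simp add: norm_mult mult.commute)
qed

abbreviation coeff :: "nat \<Rightarrow> 'x \<Rightarrow> complex" where
  "coeff k u \<equiv> l2prod S (rep S u) (eigfun S k)"

lemma coeff_rep_eq:
  assumes "rep_eq S u f" and [measurable]: "f \<in> borel_measurable (lebesgue_on (dom_int S))"
  shows "coeff k u = of_real (1 / (ell S * pi)) * (LINT x|lebesgue_on (dom_int S). f x * eigfun S k x)"
proof -
  have "(LINT x|lebesgue_on (dom_int S). rep S u x * eigfun S k x) =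
        (LINT x|lebesgue_on (dom_int S). f x * eigfun S k x)"
  proof (rule Bochner_Integration.integral_cong_AE)
    show m: "(\<lambda>x. rep S u x * eigfun S k x) \<in> borel_measurable (lebesgue_on (dom_int S))"
      using integrable_rep by measurable
    have *: "AE x in lebesgue_on (dom_int S). rep S u x * eigfun S k x = f x * eigfun S k x"
      using assms(1) unfolding rep_eq_def by eventually_elim simp
    then show "AE x in lebesgue_on (dom_int S). rep S u x * eigfun S k x = f x * eigfun S k x" .
    show "(\<lambda>x. f x * eigfun S k x) \<in> borel_measurable (lebesgue_on (dom_int S))"
      by measurable
  qed
  then show ?thesis by (simp add: l2prod_def)
qed


lemma coeff_add: "coeff k (u + v) = coeff k u + coeff k v"
proof -
  have "coeff k (u + v) = of_real (1 / (ell S * pi)) *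
      (LINT x|lebesgue_on (dom_int S). (rep S u x + rep S v x) * eigfun S k x)"
    by (rule coeff_rep_eq[OF rep_eq_add[OF rep_eq_self rep_eq_self]])
       (use integrable_rep in measurable)
  also have "\<dots> = coeff k u + coeff k v"
    by (simp add: l2prod_def ring_distribs
        Bochner_Integration.integral_add[OF integrable_mult_eigfun[OF integrable_rep]
          integrable_mult_eigfun[OF integrable_rep]])
  finally show ?thesis .
qed

lemma coeff_cscale: "coeff k (cscale S c u) = c * coeff k u"
proof -
  have "coeff k (cscale S c u) = of_real (1 / (ell S * pi)) *
      (LINT x|lebesgue_on (dom_int S). (c * rep S u x) * eigfun S k x)"
    by (rule coeff_rep_eq[OF rep_eq_cscale[OF rep_eq_self]])
       (use integrable_rep in measurable)
  also have "\<dots> = c * coeff k u"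
    by (simp add: l2prod_def mult.assoc)
  finally show ?thesis .
qed

text \<open>The mean of \<open>|f|\<close> is at most the root mean square, because the variance of \<open>|f|\<close> is nonnegative;
  this is how the norm of \<open>X\<close>, which dominates the \<open>L\<^sup>2\<close> norm, controls the pairings.\<close>

lemma mean_cmod_le:
  "(LINT x|lebesgue_on (dom_int S). cmod (rep S u x)) / (ell S * pi) \<le> sqrt (Re (l2prod S (rep S u) (rep S u)))"
proof -
  let ?M = "lebesgue_on (dom_int S)"
  let ?b = "ell S * pi"
  have "finite_measure ?M"
    by (rule finite_measure_lebesgue_on) (simp add: dom_int_def)
  then interpret finite_measure ?M .
  define a where "a = (LINT x|?M. cmod (rep S u x)) / ?b"
  have sq: "integrable ?M (\<lambda>x. (cmod (rep S u x))\<^sup>2)"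
    using square_int_rep by (simp add: square_int_def)
  have nrm: "integrable ?M (\<lambda>x. cmod (rep S u x))"
    using integrable_rep by simp
  have len: "measure ?M (space ?M) = ?b"
    using len_pos by (simp add: dom_int_def measure_restrict_space)
  have cst: "(LINT x|?M. c) = c * ?b" for c :: real
    using len by simp
  have "0 \<le> (LINT x|?M. (cmod (rep S u x) - a)\<^sup>2)"
    by simp
  also have "\<dots> = (LINT x|?M. (cmod (rep S u x))\<^sup>2 - 2 * a * cmod (rep S u x) + a\<^sup>2)"
    by (rule Bochner_Integration.integral_cong) (simp_all add: power2_diff)
  also have "\<dots> = (LINT x|?M. (cmod (rep S u x))\<^sup>2) - 2 * a * (LINT x|?M. cmod (rep S u x)) + a\<^sup>2 * ?b"
    using sq nrm cst by simp
  also have "\<dots> = (LINT x|?M. (cmod (rep S u x))\<^sup>2) - a\<^sup>2 * ?b"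
    using len_pos by (simp add: a_def power2_eq_square field_simps)
  finally have le: "a\<^sup>2 \<le> (LINT x|?M. (cmod (rep S u x))\<^sup>2) / ?b"
    using len_pos by (simp add: field_simps)
  have "(LINT x|?M. rep S u x * cnj (rep S u x)) = of_real (LINT x|?M. (cmod (rep S u x))\<^sup>2)"
    unfolding integral_complex_of_real[symmetric]
    by (simp only: complex_norm_square)
  then have "Re (l2prod S (rep S u) (rep S u)) = (LINT x|?M. (cmod (rep S u x))\<^sup>2) / ?b"
    by (simp add: l2prod_def)
  with le have "a \<le> sqrt (Re (l2prod S (rep S u) (rep S u)))"
    using real_le_rsqrt by metis
  then show ?thesis by (simp add: a_def)
qed

lemma bounded_linear_coeff: "bounded_linear (coeff k)"
proof -
  have "\<exists>K. \<forall>u. sqrt (Re (l2prod S (rep S u) (rep S u))) \<le> K * norm u"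
    using function_space unfolding function_space_def by (elim conjE)
  then obtain K where K: "\<And>u. sqrt (Re (l2prod S (rep S u) (rep S u))) \<le> K * norm u"
    by blast
  show ?thesis
  proof (rule bounded_linear_intro[where K = "sqrt 2 * K"])
    fix u v :: 'x and r :: real
    show "coeff k (u + v) = coeff k u + coeff k v"
      by (rule coeff_add)
    show "coeff k (r *\<^sub>R u) = r *\<^sub>R coeff k u"
      using coeff_cscale[where k = k and c = "of_real r" and u = u] by (simp add: cscale_of_real scaleR_conv_of_real)
    have "cmod (LINT x|lebesgue_on (dom_int S). rep S u x * eigfun S k x)
        \<le> (LINT x|lebesgue_on (dom_int S). sqrt 2 * cmod (rep S u x))"
    proof (intro Bochner_Integration.integral_norm_bound_integral integrable_mult_eigfun integrable_rep)
      show "integrable (lebesgue_on (dom_int S)) (\<lambda>x. sqrt 2 * cmod (rep S u x))"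
        using integrable_rep by simp
      show "norm (rep S u x * eigfun S k x) \<le> sqrt 2 * cmod (rep S u x)" for x
        using mult_right_mono[OF cmod_eigfun norm_ge_zero, of k x "rep S u x"]
        by (simp add: norm_mult mult.commute)
    qed
    then have "norm (coeff k u) \<le> sqrt 2 * ((LINT x|lebesgue_on (dom_int S). cmod (rep S u x)) / (ell S * pi))"
      using ell_pos by (simp add: l2prod_def norm_mult norm_divide divide_right_mono)
    also have "\<dots> \<le> sqrt 2 * (K * norm u)"
      by (intro mult_left_mono order_trans[OF mean_cmod_le K]) simp
    finally show "norm (coeff k u) \<le> norm u * (sqrt 2 * K)"
      by (simp add: mult_ac)
  qed
qed

lemma integral_cos:
  fixes n :: int
  shows "integral {0..ell S * pi} (\<lambda>x. cos (of_int n * x / ell S)) = (if n = 0 then ell S * pi else 0)"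
proof (cases "n = 0")
  case True
  then show ?thesis using len_pos by simp
next
  case False
  have "((\<lambda>x. cos (of_int n * x / ell S)) has_integral
      sin (of_int n * (ell S * pi) / ell S) * ell S / of_int n - sin (of_int n * 0 / ell S) * ell S / of_int n)
      {0..ell S * pi}"
  proof (rule fundamental_theorem_of_calculus)
    show "0 \<le> ell S * pi" using len_pos by simp
    fix x :: real
    show "((\<lambda>x. sin (of_int n * x / ell S) * ell S / of_int n) has_vector_derivative cos (of_int n * x / ell S))
        (at x within {0..ell S * pi})"
      unfolding has_real_derivative_iff_has_vector_derivative[symmetric]
      using False ell_pos by (auto intro!: derivative_eq_intros simp: field_simps)
  qed
  moreover have "sin (of_int n * (ell S * pi) / ell S) = 0"
    using ell_pos sin_times_pi_eq_0[of "of_int n"] by simp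
  ultimately show ?thesis
    using False by (simp add: integral_unique)
qed

lemma coeff_beta: "coeff k (beta S j) = (if j = k then 1 else 0)"
proof -
  define s where "s k = (if k = 0 then 1 else sqrt 2)" for k :: nat
  let ?c = "\<lambda>n x. cos (of_int n * x / ell S)"
  have e: "eigfun S k x = of_real (s k * ?c (int k) x)" for k x
    by (simp add: eigfun_def s_def)
  have prod: "eigfun S j x * eigfun S k x =
      of_real (s j * s k / 2 * (?c (int j - int k) x + ?c (int j + int k) x))" for x
  proof -
    have "cos (real j * x / ell S) * cos (real k * x / ell S) =
      (cos (real j * x / ell S - real k * x / ell S) + cos (real j * x / ell S + real k * x / ell S)) / 2"
      by (simp add: cos_add cos_diff)
    then have "s j * cos (real j * x / ell S) * (s k * cos (real k * x / ell S)) =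
        s j * s k / 2 * (?c (int j - int k) x + ?c (int j + int k) x)"
      by (simp add: left_diff_distrib distrib_right diff_divide_distrib add_divide_distrib)
    then show ?thesis
      unfolding e of_real_mult[symmetric] of_real_eq_iff by simp
  qed
  have "coeff k (beta S j) = of_real (1 / (ell S * pi)) *
      (LINT x|lebesgue_on (dom_int S). eigfun S j x * eigfun S k x)"
    by (rule coeff_rep_eq[OF rep_eq_beta]) measurable
  also have "(LINT x|lebesgue_on (dom_int S). eigfun S j x * eigfun S k x) =
      of_real (LINT x|lebesgue_on (dom_int S). s j * s k / 2 * (?c (int j - int k) x + ?c (int j + int k) x))"
    unfolding prod by (rule integral_complex_of_real)
  also have "(LINT x|lebesgue_on (dom_int S). s j * s k / 2 * (?c (int j - int k) x + ?c (int j + int k) x)) =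
      integral {0..ell S * pi} (\<lambda>x. s j * s k / 2 * (?c (int j - int k) x + ?c (int j + int k) x))"
    unfolding dom_int_def using ell_pos
    by (intro lebesgue_integral_eq_integral continuous_imp_integrable_real) (auto intro!: continuous_intros)
  also have "\<dots> = s j * s k / 2 * (integral {0..ell S * pi} (?c (int j - int k)) + integral {0..ell S * pi} (?c (int j + int k)))"
    using ell_pos
    by (subst integral_mult_right, subst integral_add) (auto intro!: integrable_continuous_real continuous_intros)
  also have "\<dots> = (if j = k then ell S * pi else 0)"
    unfolding integral_cos by (auto simp: s_def)
  finally show ?thesis
    using ell_pos by auto
qed

lemma mode_nth [simp]: "mode S k v $ i = coeff k (v $ i)"
  by (simp add: mode_def)

lemma bounded_linear_mode: "bounded_linear (mode S k)"
  by (rule bounded_linear_vecI)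
     (simp add: bounded_linear_compose[OF bounded_linear_coeff bounded_linear_vec_nth])

lemmas mode_add = linear_add[OF bounded_linear.linear[OF bounded_linear_mode]]
lemmas mode_zero [simp] = linear_0[OF bounded_linear.linear[OF bounded_linear_mode]]
lemmas mode_scaleR = linear_scale[OF bounded_linear.linear[OF bounded_linear_mode]]

lemma mode_vscale: "mode S k (vscale S c v) = c *s mode S k v"
  by (simp add: vec_eq_iff coeff_cscale)

lemma mode_vtens_beta: "mode S k (vtens S c (beta S j)) = (if j = k then c else 0)"
  by (simp add: vec_eq_iff coeff_cscale coeff_beta)


subsection \<open>Products of eigenfunctions\<close>

lemma eigfun_mult_self:
  assumes "k \<noteq> 0"
  shows "eigfun S k x * eigfun S k x = eigfun S 0 x + of_real (1 / sqrt 2) * eigfun S (2 * k) x"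
proof -
  have "cos (real (2 * k) * x / ell S) = 2 * (cos (real k * x / ell S))\<^sup>2 - 1"
    using cos_double_cos[of "real k * x / ell S"] by (simp add: mult.assoc)
  then have "(sqrt 2 * cos (real k * x / ell S)) * (sqrt 2 * cos (real k * x / ell S)) =
      1 + 1 / sqrt 2 * (sqrt 2 * cos (real (2 * k) * x / ell S))"
    by (simp add: power2_eq_square)
  then have "complex_of_real (sqrt 2 * cos (real k * x / ell S)) * of_real (sqrt 2 * cos (real k * x / ell S)) =
      of_real 1 + of_real (1 / sqrt 2) * of_real (sqrt 2 * cos (real (2 * k) * x / ell S))"
    unfolding of_real_mult[symmetric] of_real_add[symmetric] of_real_eq_iff .
  then show ?thesis
    using assms by (simp add: eigfun_def)
qed

lemma eigfun_mult_double:
  assumes "k \<noteq> 0"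
  shows "eigfun S k x * eigfun S (2 * k) x =
     of_real (1 / sqrt 2) * (eigfun S k x + eigfun S (3 * k) x)"
proof -
  define t where "t = real k * x / ell S"
  have t: "real (2 * k) * x / ell S = t + t" "real (3 * k) * x / ell S = t + (t + t)"
    by (simp_all add: t_def add_divide_distrib[symmetric])
  have "cos t * cos (t + t) = (cos (t + t - t) + cos (t + (t + t))) / 2"
    unfolding cos_add[of t "t + t"] cos_diff[of "t + t" t] by (simp add: algebra_simps)
  then have c: "cos t * cos (t + t) = (cos t + cos (t + (t + t))) / 2"
    by simp
  have "(sqrt 2 * cos t) * (sqrt 2 * cos (t + t)) = (sqrt 2 * sqrt 2) * (cos t * cos (t + t))"
    by (simp only: mult_ac)
  also have "\<dots> = 1 / sqrt 2 * (sqrt 2 * cos t + sqrt 2 * cos (t + (t + t)))"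
    unfolding c by (simp add: ring_distribs)
  finally have "complex_of_real (sqrt 2 * cos t) * of_real (sqrt 2 * cos (t + t)) =
      of_real (1 / sqrt 2) * (of_real (sqrt 2 * cos t) + of_real (sqrt 2 * cos (t + (t + t))))"
    unfolding of_real_mult[symmetric] of_real_add[symmetric] of_real_eq_iff .
  moreover have "eigfun S k x = of_real (sqrt 2 * cos t)"
      "eigfun S (2 * k) x = of_real (sqrt 2 * cos (t + t))"
      "eigfun S (3 * k) x = of_real (sqrt 2 * cos (t + (t + t)))"
    unfolding eigfun_def t unfolding t_def using assms by simp_all
  ultimately show ?thesis
    by (simp only:)
qed

end

section \<open>The Neumann Laplacian\<close>

lemma integral_zero_imp_zero:
  fixes f :: "real \<Rightarrow> 'a::euclidean_space"
  assumes "b > 0" "continuous_on {0..b} f" "\<And>x. x \<in> {0..b} \<Longrightarrow> integral {0..x} f = 0" "x \<in> {0..b}"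
  shows "f x = 0"
proof (rule vector_derivative_unique_within_closed_interval)
  show "0 < b" by fact
  show x: "x \<in> cbox 0 b" using assms(4) by simp
  show "((\<lambda>u. integral {0..u} f) has_vector_derivative f x) (at x within cbox 0 b)"
    using integral_has_vector_derivative[OF assms(2,4)] by simp
  show "((\<lambda>u. integral {0..u} f) has_vector_derivative 0) (at x within cbox 0 b)"
    by (rule has_vector_derivative_transform[where f = "\<lambda>_. 0"])
       (use assms(3) x in \<open>simp_all\<close>)
qed

lemma continuous_AE_eq_imp_eq:
  fixes f g :: "real \<Rightarrow> 'a::euclidean_space"
  assumes "b > 0" "continuous_on {0..b} f" "continuous_on {0..b} g"
    and "AE x in lebesgue_on {0..b}. f x = g x" and "x \<in> {0..b}"
  shows "f x = g x"
proof -
  have "AE x in lebesgue. x \<in> {0..b} \<longrightarrow> f x = g x"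
    using assms(4) by (subst (asm) AE_restrict_space_iff) simp_all
  then obtain N where N: "negligible N" "{x. \<not> (x \<in> {0..b} \<longrightarrow> f x = g x)} \<subseteq> N"
    unfolding eventually_ae_filter_negligible by blast
  have "f x - g x = 0"
  proof (rule integral_zero_imp_zero[OF assms(1) _ _ assms(5)])
    show "continuous_on {0..b} (\<lambda>x. f x - g x)"
      using assms(2,3) by (rule continuous_on_diff)
    fix y assume "y \<in> {0..b}"
    then have "integral {0..y} (\<lambda>x. f x - g x) = integral {0..y} (\<lambda>_. 0)"
      using N by (intro integral_spike[OF N(1)]) auto
    then show "integral {0..y} (\<lambda>x. f x - g x) = 0" by simp
  qed
  then show ?thesis by simp
qed

text \<open>At almost every point the right difference quotients of the indefinite integral converge to the
  value of the function; here they are all zero.\<close>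

lemma integral_zero_imp_AE_zero:
  fixes f :: "real \<Rightarrow> 'a::euclidean_space"
  assumes "f integrable_on {0..b}" "\<And>x. x \<in> {0..b} \<Longrightarrow> integral {0..x} f = 0"
  shows "AE x in lebesgue_on {0..b}. f x = 0"
proof -
  define g where "g x = (if x \<in> {0..b} then f x else 0)" for x
  have gUNIV: "g integrable_on UNIV"
    unfolding g_def using assms(1) integrable_restrict_UNIV by blast
  then have gint: "g integrable_on cbox a c" for a c
    using integrable_on_subcbox by blast
  obtain N where N: "negligible N" "\<And>x e. \<lbrakk>x \<notin> N; 0 < e\<rbrakk> \<Longrightarrow>
       \<exists>d>0. \<forall>h. 0 < h \<and> h < d \<longrightarrow> norm (integral (cbox x (x + h *\<^sub>R One)) g /\<^sub>R h ^ DIM(real) - g x) < e"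
    using integrable_ccontinuous_explicit[OF gint] by blast
  have zero: "f x = 0" if x: "x \<in> {0..b}" "x \<notin> insert b N" for x
  proof (rule ccontr)
    assume "f x \<noteq> 0"
    then obtain d where d: "d > 0"
      "\<And>h. 0 < h \<and> h < d \<Longrightarrow> norm (integral (cbox x (x + h *\<^sub>R One)) g /\<^sub>R h ^ DIM(real) - g x) < norm (f x)"
      using N(2)[of x "norm (f x)"] x by auto
    \<comment> \<open>The endpoint \<open>b\<close> was excluded so that a right neighbourhood of \<open>x\<close> stays inside the interval.\<close>
    define h where "h = min (d / 2) (b - x)"
    have h: "0 < h" "h < d" "x + h \<le> b"
      using d(1) x by (auto simp: h_def)
    have "integral {0..x} f + integral {x..x + h} f = integral {0..x + h} f"
      using x h by (intro Henstock_Kurzweil_Integration.integral_combine integrable_subinterval_real[OF assms(1)]) auto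
    then have "integral {x..x + h} f = 0"
      using assms(2) x h by simp
    moreover have "integral {x..x + h} g = integral {x..x + h} f"
      using x h by (intro integral_cong) (auto simp: g_def)
    ultimately have "norm (g x) < norm (f x)"
      using d(2)[of h] h by simp
    then show False
      using x by (simp add: g_def)
  qed
  have "AE x in lebesgue. x \<in> {0..b} \<longrightarrow> f x = 0"
    unfolding eventually_ae_filter_negligible
    using zero N(1) by (intro exI[of _ "insert b N"]) auto
  then show ?thesis
    by (subst AE_restrict_space_iff) simp_all
qed

lemma LINT_eq_integral:
  assumes "integrable (lebesgue_on {0..b}) (f :: real \<Rightarrow> complex)" "x \<in> {0..b}"
  shows "(LINT t|lebesgue_on {0..x}. f t) = integral {0..x} f"
proof (rule lebesgue_integral_eq_integral)
  show "integrable (lebesgue_on {0..x}) f"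
  proof -
    have "set_integrable lebesgue {0..b} f"
      using assms(1) by (simp add: integrable_restrict_space set_integrable_def)
    then have "set_integrable lebesgue {0..x} f"
      by (rule set_integrable_subset) (use assms(2) in auto)
    then show ?thesis
      by (simp add: integrable_restrict_space set_integrable_def)
  qed
qed simp

context function_model
begin

text \<open>Both antiderivatives in the definition can be undone: \<open>u'\<close> is continuous, so it is determined
  everywhere, and then its density is determined almost everywhere.\<close>

lemma has_lap_unique:
  assumes "has_lap S u v" "has_lap S u w"
  shows "v = w"
proof -
  define b where "b = ell S * pi"
  have b: "b > 0" using len_pos by (simp add: b_def)
  obtain p where p: "sobolev22 b (rep S u) p (rep S v)" "p 0 = 0"
    using assms(1) by (auto simp: has_lap_def b_def)
  obtain q where q: "sobolev22 b (rep S u) q (rep S w)" "q 0 = 0"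
    using assms(2) by (auto simp: has_lap_def b_def)
  have rep_int: "integrable (lebesgue_on {0..b}) (rep S y)" for y
    using integrable_rep[of y] by (simp add: dom_int_def b_def)
  have rep_on: "rep S y integrable_on {0..b}" for y
    by (rule integrable_on_lebesgue_on[OF rep_int]) simp
  have first: "f x = integral {0..x} (rep S y)" if "sobolev22 b (rep S u) f (rep S y)" "f 0 = 0" "x \<in> {0..b}" for f y x
    using that LINT_eq_integral[OF rep_int that(3)] by (simp add: sobolev22_def)
  have cont: "continuous_on {0..b} f" if "sobolev22 b (rep S u) f (rep S y)" "f 0 = 0" for f y
    using indefinite_integral_continuous_1[OF rep_on[of y]]
    by (rule continuous_on_eq) (simp add: first[OF that])
  have second: "\<exists>c. AE x in lebesgue_on {0..b}. rep S u x = c + integral {0..x} f"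
    if f: "sobolev22 b (rep S u) f (rep S y)" "f 0 = 0" for f y
  proof -
    have eq: "(LINT t|lebesgue_on {0..x}. f t) = integral {0..x} f" if "x \<in> {0..b}" for x
      by (rule LINT_eq_integral[OF continuous_imp_integrable_real[OF cont[OF f]] that])
    obtain c where c: "AE x in lebesgue_on {0..b}. rep S u x = c + (LINT t|lebesgue_on {0..x}. f t)"
      using f by (auto simp: sobolev22_def)
    have "AE x in lebesgue_on {0..b}. x \<in> {0..b}"
      by (rule AE_I2) simp
    with c have "AE x in lebesgue_on {0..b}. rep S u x = c + integral {0..x} f"
      by eventually_elim (simp add: eq)
    then show ?thesis by blast
  qed
  obtain c d where "AE x in lebesgue_on {0..b}. rep S u x = c + integral {0..x} p"
      "AE x in lebesgue_on {0..b}. rep S u x = d + integral {0..x} q"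
    using second[OF p] second[OF q] by blast
  then have "AE x in lebesgue_on {0..b}. c + integral {0..x} p = d + integral {0..x} q"
    by eventually_elim simp
  then have eq: "c + integral {0..x} p = d + integral {0..x} q" if "x \<in> {0..b}" for x
    using that b
    by (intro continuous_AE_eq_imp_eq[where f = "\<lambda>x. c + integral {0..x} p" and b = b])
       (auto intro!: continuous_intros indefinite_integral_continuous_1 integrable_continuous_real cont[OF p] cont[OF q])
  have pq: "p x = q x" if "x \<in> {0..b}" for x
  proof -
    have "p x - q x = 0"
    proof (rule integral_zero_imp_zero[OF b _ _ that])
      show "continuous_on {0..b} (\<lambda>x. p x - q x)"
        by (intro continuous_on_diff cont[OF p] cont[OF q])
      fix y assume y: "y \<in> {0..b}"
      have "integral {0..y} (\<lambda>x. p x - q x) = integral {0..y} p - integral {0..y} q"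
        using y cont[OF p] cont[OF q]
        by (intro integral_diff integrable_continuous_real) (auto elim: continuous_on_subset)
      with eq[OF y] eq[of 0] b show "integral {0..y} (\<lambda>x. p x - q x) = 0"
        by simp
    qed
    then show ?thesis by simp
  qed
  have "AE x in lebesgue_on {0..b}. rep S v x - rep S w x = 0"
  proof (rule integral_zero_imp_AE_zero)
    show "(\<lambda>x. rep S v x - rep S w x) integrable_on {0..b}"
      by (intro integrable_diff rep_on)
    fix y assume y: "y \<in> {0..b}"
    then have "rep S z integrable_on {0..y}" for z
      by (intro integrable_subinterval_real[OF rep_on]) auto
    then have "integral {0..y} (\<lambda>x. rep S v x - rep S w x) = integral {0..y} (rep S v) - integral {0..y} (rep S w)"
      by (intro integral_diff)
    also have "\<dots> = 0"
      using first[OF p y] first[OF q y] pq[OF y] by simp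
    finally show "integral {0..y} (\<lambda>x. rep S v x - rep S w x) = 0" .
  qed
  then have "rep_eq S v (rep S w)"
    unfolding rep_eq_def dom_int_def b_def by simp
  then show "v = w"
    using rep_eq_unique rep_eq_self by blast
qed

lemma has_lap_smooth:
  assumes f: "\<And>x. (f has_vector_derivative f' x) (at x)"
    and f': "\<And>x. (f' has_vector_derivative f'' x) (at x)"
    and bdry: "f' 0 = 0" "f' (ell S * pi) = 0"
    and u: "rep_eq S u f" and v: "rep_eq S v f''"
  shows "has_lap S u v"
proof -
  define b where "b = ell S * pi"
  have b: "b > 0" using len_pos by (simp add: b_def)
  have rep_int: "integrable (lebesgue_on {0..b}) (rep S v)"
    using integrable_rep[of v] by (simp add: dom_int_def b_def)
  have "AE x in lebesgue. x \<in> {0..b} \<longrightarrow> rep S v x = f'' x"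
    using v unfolding rep_eq_def dom_int_def b_def[symmetric] by (subst (asm) AE_restrict_space_iff) simp_all
  then obtain N where N: "negligible N" "{x. \<not> (x \<in> {0..b} \<longrightarrow> rep S v x = f'' x)} \<subseteq> N"
    unfolding eventually_ae_filter_negligible by blast
  have first: "f' x = f' 0 + (LINT t|lebesgue_on {0..x}. rep S v t)" if x: "x \<in> {0..b}" for x
  proof -
    have "(f'' has_integral f' x - f' 0) {0..x}"
      using x by (intro fundamental_theorem_of_calculus has_vector_derivative_at_within[OF f']) auto
    moreover have "rep S v t = f'' t" if "t \<in> {0..x} - N" for t
    proof -
      have "t \<in> {0..b}" "t \<notin> N" using that x by auto
      with N(2) show ?thesis by blast
    qed
    ultimately have "(rep S v has_integral f' x - f' 0) {0..x}"
      using has_integral_spike[OF N(1)] by blast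
    then show ?thesis
      using LINT_eq_integral[OF rep_int x] by (simp add: integral_unique)
  qed
  have f'_cont: "continuous_on A f'" for A
    by (intro continuous_at_imp_continuous_on ballI has_vector_derivative_continuous[OF f'])
  have second: "f x = f 0 + (LINT t|lebesgue_on {0..x}. f' t)" if x: "x \<in> {0..b}" for x
  proof -
    have "(f' has_integral f x - f 0) {0..x}"
      using x by (intro fundamental_theorem_of_calculus has_vector_derivative_at_within[OF f]) auto
    then show ?thesis
      using LINT_eq_integral[OF continuous_imp_integrable_real[OF f'_cont] x] by (simp add: integral_unique)
  qed
  have "AE x in lebesgue_on {0..b}. x \<in> {0..b}"
    by (rule AE_I2) simp
  then have "AE x in lebesgue_on {0..b}. rep S u x = f 0 + (LINT t|lebesgue_on {0..x}. f' t)"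
    using u unfolding rep_eq_def dom_int_def b_def[symmetric]
    by eventually_elim (metis second)
  moreover have "square_int {0..b} (rep S v)"
    using square_int_rep[of v] by (simp add: dom_int_def b_def)
  ultimately have "sobolev22 b (rep S u) f' (rep S v)"
    unfolding sobolev22_def using first by blast
  then show ?thesis
    unfolding has_lap_def b_def using bdry by blast
qed

lemma has_lap_modes:
  "has_lap S (cscale S a (beta S j) + cscale S c (beta S k))
     (cscale S (- (mu S j *\<^sub>R a)) (beta S j) + cscale S (- (mu S k *\<^sub>R c)) (beta S k))"
proof -
  define d :: "nat \<Rightarrow> real \<Rightarrow> complex" where "d k x = of_real (- sqrt 2 * (real k / ell S) * sin (real k * x / ell S))" for k x
  have e1: "(eigfun S k has_vector_derivative d k x) (at x)" for k x
  proof (cases "k = 0")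
    case False
    have "((\<lambda>x. sqrt 2 * cos (real k * x / ell S)) has_real_derivative
        (- sqrt 2 * (real k / ell S) * sin (real k * x / ell S))) (at x)"
      using ell_pos by (auto intro!: derivative_eq_intros simp: field_simps)
    then show ?thesis
      using False has_vector_derivative_of_real by (simp add: eigfun_def[abs_def] d_def del: of_real_mult of_real_minus)
  qed (simp add: eigfun_def[abs_def] d_def)
  have e2: "(d k has_vector_derivative of_real (- mu S k) * eigfun S k x) (at x)" for k x
  proof -
    have "((\<lambda>x. - sqrt 2 * (real k / ell S) * sin (real k * x / ell S)) has_real_derivative
        (- mu S k * (if k = 0 then 1 else sqrt 2 * cos (real k * x / ell S)))) (at x)"
      using ell_pos by (auto intro!: derivative_eq_intros simp: field_simps mu_def power2_eq_square)
    then have "(d k has_vector_derivative of_real (- mu S k * (if k = 0 then 1 else sqrt 2 * cos (real k * x / ell S)))) (at x)"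
      unfolding d_def[abs_def] by (rule has_vector_derivative_of_real)
    then show ?thesis
      by (simp only: eigfun_def of_real_mult)
  qed
  show ?thesis
  proof (rule has_lap_smooth)
    show "((\<lambda>x. a * eigfun S j x + c * eigfun S k x) has_vector_derivative a * d j x + c * d k x) (at x)" for x
      by (intro derivative_intros has_vector_derivative_mult_right e1)
    show "((\<lambda>x. a * d j x + c * d k x) has_vector_derivative
        a * (of_real (- mu S j) * eigfun S j x) + c * (of_real (- mu S k) * eigfun S k x)) (at x)" for x
      by (intro derivative_intros has_vector_derivative_mult_right e2)
    show "a * d j 0 + c * d k 0 = 0"
      by (simp add: d_def)
    have "sin (real k * (ell S * pi) / ell S) = 0" for k
      using ell_pos sin_npi[of k] by simp
    then show "a * d j (ell S * pi) + c * d k (ell S * pi) = 0"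
      by (simp add: d_def)
    show "rep_eq S (cscale S a (beta S j) + cscale S c (beta S k)) (\<lambda>x. a * eigfun S j x + c * eigfun S k x)"
      by (intro rep_eq_add rep_eq_cscale rep_eq_beta)
    show "rep_eq S (cscale S (- (mu S j *\<^sub>R a)) (beta S j) + cscale S (- (mu S k *\<^sub>R c)) (beta S k))
        (\<lambda>x. a * (of_real (- mu S j) * eigfun S j x) + c * (of_real (- mu S k) * eigfun S k x))"
      by (rule rep_eq_cong[OF rep_eq_add[OF rep_eq_cscale[OF rep_eq_beta] rep_eq_cscale[OF rep_eq_beta]]])
         (simp add: scaleR_conv_of_real)
  qed
qed

lemma lap_modes:
  "vtens S a (beta S j) + vtens S c (beta S k) \<in> dom_lap S"
  "lap S (vtens S a (beta S j) + vtens S c (beta S k)) =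
     vtens S (- (mu S j *\<^sub>R a)) (beta S j) + vtens S (- (mu S k *\<^sub>R c)) (beta S k)"
proof -
  show "vtens S a (beta S j) + vtens S c (beta S k) \<in> dom_lap S"
    unfolding dom_lap_def using has_lap_modes by fastforce
  have "(THE w. has_lap S (cscale S (a $ i) (beta S j) + cscale S (c $ i) (beta S k)) w) =
      cscale S (- (mu S j *\<^sub>R a $ i)) (beta S j) + cscale S (- (mu S k *\<^sub>R c $ i)) (beta S k)" for i
    using has_lap_modes has_lap_unique by blast
  then show "lap S (vtens S a (beta S j) + vtens S c (beta S k)) =
     vtens S (- (mu S j *\<^sub>R a)) (beta S j) + vtens S (- (mu S k *\<^sub>R c)) (beta S k)"
    by (simp add: lap_def vec_eq_iff)
qed

end

section \<open>Histories\<close>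

lemma bounded_linear_vcnj: "bounded_linear vcnj"
  by (rule bounded_linear_vecI)
     (simp add: vcnj_def bounded_linear_compose[OF bounded_linear_cnj bounded_linear_vec_nth])

lemma vcnj_nth [simp]: "vcnj v $ i = cnj (v $ i)"
  by (simp add: vcnj_def)

lemma vcnj_simps [simp]:
  "vcnj (vcnj v) = v" "vcnj (u + v) = vcnj u + vcnj v" "vcnj (c *s v) = cnj c *s vcnj v" "vcnj 0 = 0"
  "vcnj (- v) = - vcnj v" "vcnj (u - v) = vcnj u - vcnj v"
  by (simp_all add: vec_eq_iff)

lemma bounded_linear_smult_vec:
  "bounded_linear (\<lambda>v :: complex ^ 'n. c *s v)" "bounded_linear (\<lambda>c. c *s (v :: complex ^ 'n))"
  by (rule bounded_linear_vecI,
      simp add: bounded_linear_compose[OF bounded_linear_mult_right bounded_linear_vec_nth]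
        bounded_linear_mult_left)+

lemma continuous_on_smult_vec [continuous_intros]:
  fixes f :: "'a::topological_space \<Rightarrow> complex"
  shows "continuous_on A f \<Longrightarrow> continuous_on A g \<Longrightarrow> continuous_on A (\<lambda>x. f x *s g x :: complex ^ 'n)"
  unfolding vector_scalar_mult_def by (intro continuous_intros)

locale delay_model = function_model S
  for S :: "('x::{real_inner,complete_space}, 'm::finite) rdde" +
  assumes linear_part: "linear_part S"
    and nonlinear_part: "nonlinear_part S"
    and pointwise: "pointwise S"
begin

lemma delay_pos: "delay S > 0"
  using linear_part unfolding linear_part_def by (elim conjE)

text \<open>The retraction of the line onto \<open>[-r,0]\<close> through which histories factor.\<close>

abbreviation cl :: "real \<Rightarrow> real" where
  "cl \<equiv> clamp (- delay S) 0"

lemma cl_in: "cl \<theta> \<in> {- delay S..0}"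
  using clamp_in_interval[of "- delay S" 0 \<theta>] delay_pos by (simp add: cbox_interval)

lemma cl_id: "\<theta> \<in> {- delay S..0} \<Longrightarrow> cl \<theta> = \<theta>"
  by (rule clamp_cancel_cbox) (simp add: cbox_interval)

lemma apply_hist:
  assumes "continuous_on {- delay S..0} f"
  shows "apply_bcontfun (hist S f) \<theta> = f (cl \<theta>)"
proof -
  have "continuous_on (cbox (- delay S) 0) f"
    using assms by (simp add: cbox_interval)
  then have "ext_cont f (- delay S) 0 \<in> bcontfun"
    using clamp_continuous_on[of "- delay S" 0 f UNIV]
      clamp_bounded[of f "- delay S" 0] compact_imp_bounded[OF compact_continuous_image[of "cbox (- delay S) 0" f]]
    by (simp add: bcontfun_def ext_cont_def[abs_def])
  then show ?thesis
    by (simp add: hist_def Bcontfun_inverse ext_cont_def)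
qed

lemma hist_cong:
  assumes "\<And>\<theta>. \<theta> \<in> {- delay S..0} \<Longrightarrow> f \<theta> = g \<theta>"
  shows "hist S f = hist S g"
  using assms[OF cl_in] by (simp add: hist_def ext_cont_def)

lemma tens_cong:
  assumes "\<And>\<theta>. \<theta> \<in> {- delay S..0} \<Longrightarrow> \<phi> \<theta> = \<psi> \<theta>"
  shows "tens S \<phi> b = tens S \<psi> b"
  unfolding tens_def using assms by (intro hist_cong) simp

lemma hist_space_iff: "u \<in> hist_space S \<longleftrightarrow> (\<forall>\<theta>. apply_bcontfun u \<theta> = apply_bcontfun u (cl \<theta>))"
  unfolding hist_space_def mem_Collect_eq
  by (metis apply_hist bcontfun_eqI continuous_on_apply_bcontfun)

lemma hist_space_add: "u \<in> hist_space S \<Longrightarrow> v \<in> hist_space S \<Longrightarrow> u + v \<in> hist_space S"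
  unfolding hist_space_iff by (metis plus_bcontfun.rep_eq)

lemma hist_space_scaleR: "u \<in> hist_space S \<Longrightarrow> a *\<^sub>R u \<in> hist_space S"
  unfolding hist_space_iff by (metis scaleR_bcontfun.rep_eq)

lemma apply_hscale: "apply_bcontfun (hscale S c u) \<theta> = vscale S c (apply_bcontfun u (cl \<theta>))"
  unfolding hscale_def
  by (rule apply_hist) (intro bounded_linear.continuous_on[OF bounded_linear_vscale_right] continuous_on_apply_bcontfun)

lemma bounded_linear_hscale_left: "bounded_linear (\<lambda>c. hscale S c u)"
proof (rule bounded_linear_intro[where K = "norm u"])
  fix c d :: complex and r :: real
  show "hscale S (c + d) u = hscale S c u + hscale S d u"
    by (rule bcontfun_eqI)
       (simp add: apply_hscale linear_add[OF bounded_linear.linear[OF bounded_linear_vscale_left]])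
  show "hscale S (r *\<^sub>R c) u = r *\<^sub>R hscale S c u"
    by (rule bcontfun_eqI)
       (simp add: apply_hscale linear_scale[OF bounded_linear.linear[OF bounded_linear_vscale_left]])
  show "norm (hscale S c u) \<le> norm c * norm u"
    by (rule norm_bound) (simp add: apply_hscale norm_vscale mult_left_mono norm_bounded)
qed

lemma hscale_add_right: "hscale S c (u + v) = hscale S c u + hscale S c v"
  by (rule bcontfun_eqI)
     (simp add: apply_hscale linear_add[OF bounded_linear.linear[OF bounded_linear_vscale_right]])

lemma cont_hist_const: "cont_hist S (\<lambda>_. c)"
  by (simp add: cont_hist_def)

lemma cont_hist_add:
  "cont_hist S (\<phi> :: real \<Rightarrow> complex ^ 'm) \<Longrightarrow> cont_hist S \<psi> \<Longrightarrow> cont_hist S (\<lambda>\<theta>. \<phi> \<theta> + \<psi> \<theta>)"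
  unfolding cont_hist_def by (rule continuous_on_add)

lemma cont_hist_smult:
  "cont_hist S f \<Longrightarrow> cont_hist S (\<phi> :: real \<Rightarrow> complex ^ 'm) \<Longrightarrow> cont_hist S (\<lambda>\<theta>. f \<theta> *s \<phi> \<theta>)"
  unfolding cont_hist_def by (rule continuous_on_smult_vec)

lemma cont_hist_vcnj: "cont_hist S (\<phi> :: real \<Rightarrow> complex ^ 'm) \<Longrightarrow> cont_hist S (\<lambda>\<theta>. vcnj (\<phi> \<theta>))"
  unfolding cont_hist_def by (rule bounded_linear.continuous_on[OF bounded_linear_vcnj])

lemma cont_hist_exp: "cont_hist S (\<lambda>\<theta>. exp (c * of_real \<theta>) :: complex)"
  unfolding cont_hist_def by (intro continuous_intros)

lemmas cont_hist_intros = cont_hist_const cont_hist_add cont_hist_smult cont_hist_vcnj cont_hist_exp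

lemma apply_tens: "cont_hist S \<phi> \<Longrightarrow> apply_bcontfun (tens S \<phi> b) \<theta> = vtens S (\<phi> (cl \<theta>)) b"
  unfolding tens_def cont_hist_def
  by (rule apply_hist) (rule bounded_linear.continuous_on[OF bounded_linear_vtens])

lemma tens_in_hist_space: "cont_hist S \<phi> \<Longrightarrow> tens S \<phi> b \<in> hist_space S"
  by (simp add: hist_space_iff apply_tens cl_id[OF cl_in])

lemma tens_add:
  "cont_hist S \<phi> \<Longrightarrow> cont_hist S \<psi> \<Longrightarrow> tens S (\<lambda>\<theta>. \<phi> \<theta> + \<psi> \<theta>) b = tens S \<phi> b + tens S \<psi> b"
  by (rule bcontfun_eqI) (simp add: apply_tens cont_hist_add vtens_add)

lemma hscale_tens: "cont_hist S \<phi> \<Longrightarrow> hscale S c (tens S \<phi> b) = tens S (\<lambda>\<theta>. c *s \<phi> \<theta>) b"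
  by (rule bcontfun_eqI)
     (simp add: apply_hscale apply_tens cont_hist_smult cont_hist_const vscale_vtens cl_id[OF cl_in])

end

section \<open>Operators acting pointwise\<close>

definition rpart :: "complex ^ 'm \<Rightarrow> complex ^ 'm::finite" where
  "rpart v = (1 / 2) *s (v + vcnj v)"

definition ipart :: "complex ^ 'm \<Rightarrow> complex ^ 'm::finite" where
  "ipart v = (- \<i> / 2) *s (v - vcnj v)"

lemma rpart_ipart:
  "vcnj (rpart v) = rpart v" "vcnj (ipart v) = ipart v" "v = rpart v + \<i> *s ipart v"
  by (simp_all add: rpart_def ipart_def vec_eq_iff algebra_simps)

context delay_model
begin

text \<open>Split a function into its real and imaginary parts.  Two different maps are allowed so that the rule
  can be applied to one argument of a multilinear form after the other arguments have been conjugated.\<close>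

lemma conj_linear_extend:
  fixes H K :: "(real \<Rightarrow> complex ^ 'm) \<Rightarrow> complex ^ 'm"
  assumes addH: "\<And>\<phi> \<psi>. cont_hist S \<phi> \<Longrightarrow> cont_hist S \<psi> \<Longrightarrow> H (\<lambda>\<theta>. \<phi> \<theta> + \<psi> \<theta>) = H \<phi> + H \<psi>"
    and addK: "\<And>\<phi> \<psi>. cont_hist S \<phi> \<Longrightarrow> cont_hist S \<psi> \<Longrightarrow> K (\<lambda>\<theta>. \<phi> \<theta> + \<psi> \<theta>) = K \<phi> + K \<psi>"
    and scaleH: "\<And>c \<phi>. cont_hist S \<phi> \<Longrightarrow> H (\<lambda>\<theta>. c *s \<phi> \<theta>) = c *s H \<phi>"
    and scaleK: "\<And>c \<phi>. cont_hist S \<phi> \<Longrightarrow> K (\<lambda>\<theta>. c *s \<phi> \<theta>) = c *s K \<phi>"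
    and real: "\<And>\<phi>. cont_hist S \<phi> \<Longrightarrow> (\<And>\<theta>. vcnj (\<phi> \<theta>) = \<phi> \<theta>) \<Longrightarrow> H \<phi> = vcnj (K \<phi>)"
    and \<phi>: "cont_hist S \<phi>"
  shows "H (\<lambda>\<theta>. vcnj (\<phi> \<theta>)) = vcnj (K \<phi>)"
proof -
  let ?r = "\<lambda>\<theta>. rpart (\<phi> \<theta>)" and ?i = "\<lambda>\<theta>. ipart (\<phi> \<theta>)"
  have r: "cont_hist S ?r"
    unfolding rpart_def by (intro cont_hist_intros \<phi>)
  have "ipart v = (- \<i> / 2) *s (v + (-1) *s vcnj v)" for v :: "complex ^ 'm"
    by (simp add: ipart_def vec_eq_iff)
  then have i: "cont_hist S ?i"
    by (simp only:) (intro cont_hist_intros \<phi>)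
  have "vcnj (\<phi> \<theta>) = ?r \<theta> + (- \<i>) *s ?i \<theta>" for \<theta>
    by (subst rpart_ipart(3)) (simp only: vcnj_simps rpart_ipart complex_cnj_i)
  then have "H (\<lambda>\<theta>. vcnj (\<phi> \<theta>)) = H ?r + (- \<i>) *s H ?i"
    using addH[OF r cont_hist_smult[OF cont_hist_const i, of "- \<i>"]] scaleH[OF i, of "- \<i>"] by simp
  also have "\<dots> = vcnj (K ?r) + (- \<i>) *s vcnj (K ?i)"
    using real[OF r] real[OF i] by (simp add: rpart_ipart)
  also have "\<dots> = vcnj (K ?r + \<i> *s K ?i)"
    by simp
  also have "K ?r + \<i> *s K ?i = K (\<lambda>\<theta>. ?r \<theta> + \<i> *s ?i \<theta>)"
    using addK[OF r cont_hist_smult[OF cont_hist_const i, of "\<i>"]] scaleK[OF i, of "\<i>"] by simp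
  also have "\<dots> = K \<phi>"
    by (simp flip: rpart_ipart(3))
  finally show ?thesis .
qed

lemma coeff_real:
  assumes "AE x in lebesgue_on (dom_int S). rep S u x \<in> \<real>"
  shows "cnj (coeff 0 u) = coeff 0 u"
proof -
  have "cnj (LINT x|lebesgue_on (dom_int S). rep S u x) = (LINT x|lebesgue_on (dom_int S). cnj (rep S u x))"
    by simp
  also have "\<dots> = (LINT x|lebesgue_on (dom_int S). rep S u x)"
  proof (rule Bochner_Integration.integral_cong_AE)
    show "AE x in lebesgue_on (dom_int S). cnj (rep S u x) = rep S u x"
      using assms by eventually_elim (simp add: Reals_cnj_iff)
    show "rep S u \<in> borel_measurable (lebesgue_on (dom_int S))"
      using integrable_rep by (rule borel_measurable_integrable)
    then show "(\<lambda>x. cnj (rep S u x)) \<in> borel_measurable (lebesgue_on (dom_int S))"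
      using integrable_rep by (auto intro!: borel_measurable_integrable)
  qed
  finally show ?thesis
    by (simp add: l2prod_def)
qed

lemma mode_real: "real_vec S v \<Longrightarrow> vcnj (mode S 0 v) = mode S 0 v"
  by (simp add: real_vec_def vec_eq_iff coeff_real)

lemma real_hist_tens:
  assumes "cont_hist S \<phi>" "\<And>\<theta>. vcnj (\<phi> \<theta>) = \<phi> \<theta>"
  shows "real_hist S (tens S \<phi> (beta S 0))"
proof -
  have "AE x in lebesgue_on (dom_int S). rep S (cscale S (\<phi> \<theta> $ i) (beta S 0)) x \<in> \<real>" for \<theta> i
  proof -
    have "cnj (\<phi> \<theta> $ i) = \<phi> \<theta> $ i"
      using assms(2)[of \<theta>] vcnj_nth by metis
    then have re: "\<phi> \<theta> $ i \<in> \<real>"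
      by (simp add: Reals_cnj_iff)
    show ?thesis
      using rep_eq_cscale[OF rep_eq_beta, of "\<phi> \<theta> $ i" 0]
      unfolding rep_eq_def by eventually_elim (simp add: re)
  qed
  then show ?thesis
    by (simp add: real_hist_def real_vec_def apply_tens assms(1))
qed


subsection \<open>Linear operators acting pointwise\<close>

lemma hat1_add:
  fixes T :: "('x, 'm) history \<Rightarrow>\<^sub>L ('x ^ 'm)"
  shows "cont_hist S \<phi> \<Longrightarrow> cont_hist S \<psi> \<Longrightarrow> hat1 S T (\<lambda>\<theta>. \<phi> \<theta> + \<psi> \<theta>) = hat1 S T \<phi> + hat1 S T \<psi>"
  by (simp add: hat1_def tens_add blinfun.add_right mode_add)

lemma bounded_linear_hat1: "bounded_linear (\<lambda>T. hat1 S (blinfun_apply T) \<phi>)"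
  unfolding hat1_def
  by (rule bounded_linear_compose[OF bounded_linear_mode blinfun.bounded_linear_left])

text \<open>Each clause is stated as the vanishing of a bounded linear expression in \<open>T\<close>, the form in which it
  is inherited by derivatives of \<open>L(\<alpha>)\<close> with respect to the parameters.\<close>

definition pointwise_op :: "(('x, 'm) history \<Rightarrow>\<^sub>L ('x ^ 'm)) \<Rightarrow> bool" where
  "pointwise_op T \<longleftrightarrow> (\<forall>\<phi>. cont_hist S \<phi> \<longrightarrow>
     (\<forall>b. blinfun_apply T (tens S \<phi> b) - vtens S (hat1 S T \<phi>) b = 0) \<and>
     (\<forall>c. hat1 S T (\<lambda>\<theta>. c *s \<phi> \<theta>) - c *s hat1 S T \<phi> = 0) \<and>
     hat1 S T (\<lambda>\<theta>. vcnj (\<phi> \<theta>)) - vcnj (hat1 S T \<phi>) = 0)"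

lemma pointwise_opD:
  assumes "pointwise_op T" "cont_hist S \<phi>"
  shows "blinfun_apply T (tens S \<phi> b) = vtens S (hat1 S T \<phi>) b"
    "hat1 S T (\<lambda>\<theta>. c *s \<phi> \<theta>) = c *s hat1 S T \<phi>"
    "hat1 S T (\<lambda>\<theta>. vcnj (\<phi> \<theta>)) = vcnj (hat1 S T \<phi>)"
  using assms unfolding pointwise_op_def right_minus_eq by simp_all

lemma pointwise_op_Lop:
  assumes \<alpha>: "\<alpha> \<in> nbhd S"
  shows "pointwise_op (Lop S \<alpha>)"
proof -
  have lin: "\<forall>\<alpha>\<in>nbhd S. \<forall>c. \<forall>\<phi>\<in>hist_space S. Lop S \<alpha> (hscale S c \<phi>) = vscale S c (Lop S \<alpha> \<phi>)"
    and re: "\<forall>\<alpha>\<in>nbhd S. \<forall>\<phi>\<in>hist_space S. real_hist S \<phi> \<longrightarrow> real_vec S (Lop S \<alpha> \<phi>)"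
    using linear_part unfolding linear_part_def by - ((elim conjE, assumption)+)
  have pw: "\<forall>\<alpha>\<in>nbhd S. \<forall>\<phi> b. cont_hist S \<phi> \<longrightarrow> Lop S \<alpha> (tens S \<phi> b) = vtens S (hat1 S (Lop S \<alpha>) \<phi>) b"
    using pointwise unfolding pointwise_def by (elim conjE)
  have scale: "hat1 S (Lop S \<alpha>) (\<lambda>\<theta>. c *s \<phi> \<theta>) = c *s hat1 S (Lop S \<alpha>) \<phi>" if "cont_hist S \<phi>"
    for c and \<phi> :: "real \<Rightarrow> complex ^ 'm"
    using lin \<alpha> that tens_in_hist_space[OF that]
    by (simp add: hat1_def hscale_tens[symmetric] mode_vscale)
  have "hat1 S (Lop S \<alpha>) (\<lambda>\<theta>. vcnj (\<phi> \<theta>)) = vcnj (hat1 S (Lop S \<alpha>) \<phi>)" if "cont_hist S \<phi>"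
    for \<phi> :: "real \<Rightarrow> complex ^ 'm"
  proof (rule conj_linear_extend[OF hat1_add hat1_add scale scale _ that])
    fix \<psi> :: "real \<Rightarrow> complex ^ 'm" assume "cont_hist S \<psi>" "\<And>\<theta>. vcnj (\<psi> \<theta>) = \<psi> \<theta>"
    then have "real_vec S (Lop S \<alpha> (tens S \<psi> (beta S 0)))"
      using re \<alpha> tens_in_hist_space real_hist_tens by blast
    then show "hat1 S (Lop S \<alpha>) \<psi> = vcnj (hat1 S (Lop S \<alpha>) \<psi>)"
      by (simp add: hat1_def mode_real)
  qed
  with scale show ?thesis
    using pw \<alpha> by (simp add: pointwise_op_def)
qed

lemma zero_in_nbhd: "0 \<in> nbhd S" and open_nbhd: "open (nbhd S)"
  using linear_part unfolding linear_part_def by - ((elim conjE, assumption)+)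

lemma Lop_has_derivative: "(Lop S has_derivative frechet_derivative (Lop S) (at 0)) (at 0)"
proof -
  have "\<exists>L'. (\<forall>\<alpha>\<in>nbhd S. (Lop S has_derivative blinfun_apply (L' \<alpha>)) (at \<alpha>)) \<and> continuous_on (nbhd S) L'"
    using linear_part unfolding linear_part_def by (elim conjE)
  then show ?thesis
    using zero_in_nbhd frechet_derivative_works differentiableI by metis
qed

text \<open>Differentiating \<open>F(L(\<alpha>)) = 0\<close> at \<open>\<alpha> = 0\<close>.\<close>

lemma L1_linear_condition:
  fixes F :: "(('x, 'm) history \<Rightarrow>\<^sub>L ('x ^ 'm)) \<Rightarrow> 'c::real_normed_vector"
  assumes F: "bounded_linear F" and zero: "\<And>\<alpha>. \<alpha> \<in> nbhd S \<Longrightarrow> F (Lop S \<alpha>) = 0"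
  shows "F (L1 S \<alpha>) = 0"
proof -
  have "((\<lambda>\<alpha>. F (Lop S \<alpha>)) has_derivative (\<lambda>\<alpha>. F (frechet_derivative (Lop S) (at 0) \<alpha>))) (at 0)"
    by (rule bounded_linear.has_derivative[OF F Lop_has_derivative])
  moreover have "((\<lambda>\<alpha>. F (Lop S \<alpha>)) has_derivative (\<lambda>_. 0)) (at 0)"
    by (rule has_derivative_transform_within_open[OF _ open_nbhd zero_in_nbhd, where f = "\<lambda>_. 0"])
       (simp_all add: zero)
  ultimately have "(\<lambda>\<alpha>. F (frechet_derivative (Lop S) (at 0) \<alpha>)) = (\<lambda>_. 0)"
    by (rule has_derivative_unique)
  then have "F (frechet_derivative (Lop S) (at 0) \<alpha>) = 0"
    by (rule fun_cong)
  then show ?thesis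
    by (simp add: L1_def linear_scale[OF bounded_linear.linear[OF F]])
qed

lemma pointwise_op_L1: "pointwise_op (L1 S \<alpha>)"
  unfolding pointwise_op_def
proof (intro allI impI conjI)
  fix \<phi> :: "real \<Rightarrow> complex ^ 'm" and b :: 'x and c :: complex
  assume \<phi>: "cont_hist S \<phi>"
  note D = pointwise_opD[OF pointwise_op_Lop \<phi>]
  show "blinfun_apply (L1 S \<alpha>) (tens S \<phi> b) - vtens S (hat1 S (L1 S \<alpha>) \<phi>) b = 0"
    by (rule L1_linear_condition)
       (auto intro!: bounded_linear_sub blinfun.bounded_linear_left
         bounded_linear_compose[OF bounded_linear_vtens bounded_linear_hat1] simp: D)
  show "hat1 S (L1 S \<alpha>) (\<lambda>\<theta>. c *s \<phi> \<theta>) - c *s hat1 S (L1 S \<alpha>) \<phi> = 0"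
    by (rule L1_linear_condition)
       (auto intro!: bounded_linear_sub bounded_linear_hat1
         bounded_linear_compose[OF bounded_linear_smult_vec(1) bounded_linear_hat1] simp: D)
  show "hat1 S (L1 S \<alpha>) (\<lambda>\<theta>. vcnj (\<phi> \<theta>)) - vcnj (hat1 S (L1 S \<alpha>) \<phi>) = 0"
    by (rule L1_linear_condition)
       (auto intro!: bounded_linear_sub bounded_linear_hat1
         bounded_linear_compose[OF bounded_linear_vcnj bounded_linear_hat1] simp: D)
qed


subsection \<open>The quadratic and cubic forms\<close>

lemma Q_bilinear: "bounded_bilinear (Qop S)"
  and Q_sym: "\<forall>u v. Qop S u v = Qop S v u"
  and Q_hscale: "\<forall>c. \<forall>u\<in>hist_space S. \<forall>v. Qop S (hscale S c u) v = vscale S c (Qop S u v)"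
  and C_linear: "\<forall>u v. linear (Cop S u v)"
  and C_sym: "\<forall>u v w. Cop S u v w = Cop S v u w \<and> Cop S u v w = Cop S u w v"
  and C_hscale: "\<forall>c. \<forall>u\<in>hist_space S. \<forall>v w. Cop S (hscale S c u) v w = vscale S c (Cop S u v w)"
  and G_taylor: "((\<lambda>v. norm (Gop S (v, 0) - (1/2) *\<^sub>R Qop S v v - (1/6) *\<^sub>R Cop S v v v) / norm v ^ 3) \<longlongrightarrow> 0)
       (at 0 within {v \<in> hist_space S. real_hist S v})"
  and G_real: "\<forall>\<alpha>\<in>nbhd S. \<forall>\<phi>\<in>hist_space S. real_hist S \<phi> \<longrightarrow> real_vec S (Gop S (\<phi>, \<alpha>))"
  using nonlinear_part unfolding nonlinear_part_def by - ((elim conjE, assumption)+)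


text \<open>Along a real direction \<open>v\<close> the remainder \<open>G(tv,0) - t\<^sup>2Q(v,v)/2 - t\<^sup>3C(v,v,v)/6\<close> is \<open>o(t\<^sup>3)\<close>
  and \<open>G\<close> is real, so the imaginary parts \<open>q\<close> and \<open>c\<close> of the two forms satisfy \<open>q/t + c \<rightarrow> 0\<close>.\<close>

lemma taylor_forms_real:
  assumes v: "v \<in> hist_space S" "real_hist S v"
  shows "vcnj (mode S 0 (Qop S v v)) = mode S 0 (Qop S v v)"
    and "vcnj (mode S 0 (Cop S v v v)) = mode S 0 (Cop S v v v)"
proof -
  have "Im (mode S 0 (Qop S v v) $ i) = 0 \<and> Im (mode S 0 (Cop S v v v) $ i) = 0" for i
  proof (cases "v = 0")
    case True
    then show ?thesis
      using bounded_bilinear.zero_left[OF Q_bilinear] linear_0[OF C_linear[rule_format]] by simp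
  next
    case False
    define P where "P w = Im (mode S 0 w $ i)" for w
    have P: "bounded_linear P"
      unfolding P_def
      by (intro bounded_linear_compose[OF bounded_linear_Im] bounded_linear_compose[OF bounded_linear_vec_nth]
          bounded_linear_mode)
    interpret P: bounded_linear P by fact
    obtain K where K: "\<And>w. norm (P w) \<le> norm w * K"
      using P.bounded by blast
    have P_real: "P w = 0" if "real_vec S w" for w
    proof -
      have "cnj (mode S 0 w $ i) = mode S 0 w $ i"
        using mode_real[OF that] vcnj_nth by metis
      then show ?thesis
        by (simp add: P_def complex_eq_iff)
    qed
    define q where "q = P (Qop S v v) / 2"
    define c where "c = P (Cop S v v v) / 6"
    define R where "R w = Gop S (w, 0) - (1/2) *\<^sub>R Qop S w w - (1/6) *\<^sub>R Cop S w w w" for w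
    have real_tv: "t *\<^sub>R v \<in> {v \<in> hist_space S. real_hist S v}" for t
    proof -
      have "real_hist S (t *\<^sub>R v)"
        unfolding real_hist_def real_vec_def
      proof (intro ballI allI)
        fix \<theta> i assume \<theta>: "\<theta> \<in> {- delay S..0}"
        have "AE x in lebesgue_on (dom_int S). rep S (apply_bcontfun v \<theta> $ i) x \<in> \<real>"
          using v(2) \<theta> by (simp add: real_hist_def real_vec_def)
        with rep_eq_scaleR[OF rep_eq_self, of t "apply_bcontfun v \<theta> $ i"]
        show "AE x in lebesgue_on (dom_int S). rep S (apply_bcontfun (t *\<^sub>R v) \<theta> $ i) x \<in> \<real>"
          unfolding rep_eq_def by eventually_elim simp
      qed
      then show ?thesis using v(1) hist_space_scaleR by blast
    qed
    have PR: "P (R (t *\<^sub>R v)) = - (t\<^sup>2 * q + t ^ 3 * c)" for t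
    proof -
      have "real_vec S (Gop S (t *\<^sub>R v, 0))"
        using G_real zero_in_nbhd real_tv[of t] by blast
      moreover have "Qop S (t *\<^sub>R v) (t *\<^sub>R v) = t\<^sup>2 *\<^sub>R Qop S v v"
        by (simp add: bounded_bilinear.scaleR_left[OF Q_bilinear] bounded_bilinear.scaleR_right[OF Q_bilinear]
            power2_eq_square)
      moreover have "Cop S (t *\<^sub>R v) (t *\<^sub>R v) (t *\<^sub>R v) = t ^ 3 *\<^sub>R Cop S v v v"
      proof -
        have s3: "Cop S x y (t *\<^sub>R z) = t *\<^sub>R Cop S x y z" for x y z
          by (rule linear_scale[OF C_linear[rule_format]])
        have s2: "Cop S x (t *\<^sub>R y) z = t *\<^sub>R Cop S x y z" for x y z
          using C_sym s3 by metis
        have s1: "Cop S (t *\<^sub>R x) y z = t *\<^sub>R Cop S x y z" for x y z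
          using C_sym s2 by metis
        show ?thesis
          by (simp only: s1 s2 s3 scaleR_scaleR power3_eq_cube mult.assoc)
      qed
      ultimately show ?thesis
        by (simp add: R_def P.diff P.scaleR P_real q_def c_def)
    qed
    have "filterlim (\<lambda>t. t *\<^sub>R v) (at 0 within {v \<in> hist_space S. real_hist S v}) (at_right 0)"
      unfolding filterlim_at
    proof
      show "\<forall>\<^sub>F t in at_right 0. t *\<^sub>R v \<in> {v \<in> hist_space S. real_hist S v} \<and> t *\<^sub>R v \<noteq> 0"
        using eventually_at_right_less[of "0::real"] by eventually_elim (use real_tv False in auto)
      show "((\<lambda>t. t *\<^sub>R v) \<longlongrightarrow> 0) (at_right 0)"
        by (auto intro!: tendsto_eq_intros)
    qed
    then have "((\<lambda>t. norm (R (t *\<^sub>R v)) / norm (t *\<^sub>R v) ^ 3) \<longlongrightarrow> 0) (at_right 0)"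
      unfolding R_def by (rule filterlim_compose[OF G_taylor])
    then have lim: "((\<lambda>t. (norm v ^ 3 * K) * (norm (R (t *\<^sub>R v)) / norm (t *\<^sub>R v) ^ 3)) \<longlongrightarrow> 0) (at_right 0)"
      by (rule tendsto_mult_right_zero)
    have qc: "((\<lambda>t. q / t + c) \<longlongrightarrow> 0) (at_right 0)"
    proof (rule Lim_null_comparison[OF _ lim])
      show "\<forall>\<^sub>F t in at_right 0. norm (q / t + c) \<le> (norm v ^ 3 * K) * (norm (R (t *\<^sub>R v)) / norm (t *\<^sub>R v) ^ 3)"
        using eventually_at_right_less[of "0::real"]
      proof eventually_elim
        case (elim t)
        have "q / t + c = (t\<^sup>2 * q + t ^ 3 * c) / t ^ 3"
          using elim by (simp add: field_simps power2_eq_square power3_eq_cube)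
        then have "norm (q / t + c) = norm (P (R (t *\<^sub>R v))) / t ^ 3"
          using elim by (simp only: PR norm_minus_cancel norm_divide) simp
        also have "\<dots> \<le> norm (R (t *\<^sub>R v)) * K / t ^ 3"
          using K elim by (intro divide_right_mono) auto
        also have "\<dots> = (norm v ^ 3 * K) * (norm (R (t *\<^sub>R v)) / norm (t *\<^sub>R v) ^ 3)"
          using elim False by (simp add: power_mult_distrib)
        finally show ?case .
      qed
    qed
    have t0: "((\<lambda>t. t) \<longlongrightarrow> (0::real)) (at_right 0)"
      by (rule tendsto_ident_at)
    have "((\<lambda>t. t * (q / t + c)) \<longlongrightarrow> 0) (at_right 0)"
      using tendsto_mult[OF t0 qc] by simp
    moreover have "\<forall>\<^sub>F t in at_right 0. t * (q / t + c) = q + t * c"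
      using eventually_at_right_less[of "0::real"] by eventually_elim (simp add: field_simps)
    ultimately have "((\<lambda>t. q + t * c) \<longlongrightarrow> 0) (at_right 0)"
      using tendsto_cong by fastforce
    moreover have "((\<lambda>t. q + t * c) \<longlongrightarrow> q + 0 * c) (at_right 0)"
      by (intro tendsto_intros t0)
    ultimately have q: "q = 0"
      using tendsto_unique[OF trivial_limit_at_right_real] by fastforce
    with qc have "((\<lambda>t. c) \<longlongrightarrow> 0) (at_right (0::real))"
      by simp
    then have "c = 0"
      using tendsto_unique[OF trivial_limit_at_right_real tendsto_const] by fastforce
    with q show ?thesis
      by (simp add: q_def c_def P_def)
  qed
  then show "vcnj (mode S 0 (Qop S v v)) = mode S 0 (Qop S v v)"
    and "vcnj (mode S 0 (Cop S v v v)) = mode S 0 (Cop S v v v)"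
    by (simp_all add: vec_eq_iff complex_eq_iff)
qed

lemma Qhat_sym: "Qhat S \<phi> \<psi> = Qhat S \<psi> \<phi>"
  unfolding Qhat_def using Q_sym by metis

lemma Qhat_add_left:
  "cont_hist S \<phi> \<Longrightarrow> cont_hist S \<psi> \<Longrightarrow> Qhat S (\<lambda>\<theta>. \<phi> \<theta> + \<psi> \<theta>) \<zeta> = Qhat S \<phi> \<zeta> + Qhat S \<psi> \<zeta>"
  by (simp add: Qhat_def tens_add bounded_bilinear.add_left[OF Q_bilinear] mode_add)

lemma Qhat_scale_left: "cont_hist S \<phi> \<Longrightarrow> Qhat S (\<lambda>\<theta>. c *s \<phi> \<theta>) \<zeta> = c *s Qhat S \<phi> \<zeta>"
  using Q_hscale tens_in_hist_space by (simp add: Qhat_def hscale_tens[symmetric] mode_vscale)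

lemma Qhat_add_right:
  "cont_hist S \<phi> \<Longrightarrow> cont_hist S \<psi> \<Longrightarrow> Qhat S \<zeta> (\<lambda>\<theta>. \<phi> \<theta> + \<psi> \<theta>) = Qhat S \<zeta> \<phi> + Qhat S \<zeta> \<psi>"
  using Qhat_add_left Qhat_sym by simp

lemma Qhat_scale_right: "cont_hist S \<phi> \<Longrightarrow> Qhat S \<zeta> (\<lambda>\<theta>. c *s \<phi> \<theta>) = c *s Qhat S \<zeta> \<phi>"
  using Qhat_scale_left Qhat_sym by simp

lemma Chat_sym: "Chat S \<phi> \<psi> \<zeta> = Chat S \<psi> \<phi> \<zeta>" "Chat S \<phi> \<psi> \<zeta> = Chat S \<phi> \<zeta> \<psi>"
  unfolding Chat_def using C_sym by metis+

lemma Chat_add3: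
  "cont_hist S \<phi> \<Longrightarrow> cont_hist S \<psi> \<Longrightarrow> Chat S \<zeta> \<rho> (\<lambda>\<theta>. \<phi> \<theta> + \<psi> \<theta>) = Chat S \<zeta> \<rho> \<phi> + Chat S \<zeta> \<rho> \<psi>"
  by (simp add: Chat_def tens_add linear_add[OF C_linear[rule_format]] mode_add)

lemma Chat_scale1: "cont_hist S \<phi> \<Longrightarrow> Chat S (\<lambda>\<theta>. c *s \<phi> \<theta>) \<zeta> \<rho> = c *s Chat S \<phi> \<zeta> \<rho>"
  using C_hscale tens_in_hist_space by (simp add: Chat_def hscale_tens[symmetric] mode_vscale)

lemma Chat_add2:
  "cont_hist S \<phi> \<Longrightarrow> cont_hist S \<psi> \<Longrightarrow> Chat S \<zeta> (\<lambda>\<theta>. \<phi> \<theta> + \<psi> \<theta>) \<rho> = Chat S \<zeta> \<phi> \<rho> + Chat S \<zeta> \<psi> \<rho>"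
  by (simp only: Chat_sym(2)[where \<zeta> = \<rho>] Chat_add3)

lemma Chat_add1:
  "cont_hist S \<phi> \<Longrightarrow> cont_hist S \<psi> \<Longrightarrow> Chat S (\<lambda>\<theta>. \<phi> \<theta> + \<psi> \<theta>) \<zeta> \<rho> = Chat S \<phi> \<zeta> \<rho> + Chat S \<psi> \<zeta> \<rho>"
  by (simp only: Chat_sym(1)[where \<psi> = \<zeta>] Chat_add2)

lemma Chat_scale2: "cont_hist S \<phi> \<Longrightarrow> Chat S \<zeta> (\<lambda>\<theta>. c *s \<phi> \<theta>) \<rho> = c *s Chat S \<zeta> \<phi> \<rho>"
  by (simp only: Chat_sym(1)[where \<phi> = \<zeta>] Chat_scale1)

lemma Chat_scale3: "cont_hist S \<phi> \<Longrightarrow> Chat S \<zeta> \<rho> (\<lambda>\<theta>. c *s \<phi> \<theta>) = c *s Chat S \<zeta> \<rho> \<phi>"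
  by (simp only: Chat_sym(2)[where \<psi> = \<rho>] Chat_scale2)

lemmas Qhat_linear = Qhat_add_left Qhat_add_right Qhat_scale_left Qhat_scale_right
lemmas Chat_linear = Chat_add1 Chat_add2 Chat_add3 Chat_scale1 Chat_scale2 Chat_scale3

text \<open>Polarization: the form is real on the diagonal, and its off-diagonal values are real combinations of
  diagonal ones.\<close>

lemma Qhat_real:
  assumes "cont_hist S \<phi>" "cont_hist S \<psi>" "\<And>\<theta>. vcnj (\<phi> \<theta>) = \<phi> \<theta>" "\<And>\<theta>. vcnj (\<psi> \<theta>) = \<psi> \<theta>"
  shows "vcnj (Qhat S \<phi> \<psi>) = Qhat S \<phi> \<psi>"
proof -
  have diag: "vcnj (Qhat S \<zeta> \<zeta>) = Qhat S \<zeta> \<zeta>" if "cont_hist S \<zeta>" "\<And>\<theta>. vcnj (\<zeta> \<theta>) = \<zeta> \<theta>" for \<zeta>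
    unfolding Qhat_def using that by (intro taylor_forms_real tens_in_hist_space real_hist_tens)
  have "Qhat S (\<lambda>\<theta>. \<phi> \<theta> + \<psi> \<theta>) (\<lambda>\<theta>. \<phi> \<theta> + \<psi> \<theta>) = Qhat S \<phi> \<phi> + 2 *s Qhat S \<phi> \<psi> + Qhat S \<psi> \<psi>"
    using assms by (simp add: Qhat_linear cont_hist_intros Qhat_sym[of \<psi> \<phi>] vec_eq_iff)
  then have "2 *s Qhat S \<phi> \<psi> = Qhat S (\<lambda>\<theta>. \<phi> \<theta> + \<psi> \<theta>) (\<lambda>\<theta>. \<phi> \<theta> + \<psi> \<theta>) - Qhat S \<phi> \<phi> - Qhat S \<psi> \<psi>"
    by simp
  moreover have "vcnj \<dots> = \<dots>"
    using assms by (simp add: diag cont_hist_intros)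
  ultimately have "vcnj (2 *s Qhat S \<phi> \<psi>) = 2 *s Qhat S \<phi> \<psi>"
    by simp
  then show ?thesis
    by (simp add: vec_eq_iff)
qed

text \<open>The conjugation rule is extended from real functions to complex ones in one argument at a time.\<close>

lemma Qhat_cnj:
  assumes "cont_hist S \<phi>" "cont_hist S \<psi>"
  shows "Qhat S (\<lambda>\<theta>. vcnj (\<phi> \<theta>)) (\<lambda>\<theta>. vcnj (\<psi> \<theta>)) = vcnj (Qhat S \<phi> \<psi>)"
proof -
  have real2: "Qhat S (\<lambda>\<theta>. vcnj (\<zeta> \<theta>)) \<rho> = vcnj (Qhat S \<zeta> \<rho>)"
    if "cont_hist S \<zeta>" "cont_hist S \<rho>" "\<And>\<theta>. vcnj (\<rho> \<theta>) = \<rho> \<theta>" for \<zeta> \<rho>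
    by (rule conj_linear_extend[where H = "\<lambda>\<zeta>. Qhat S \<zeta> \<rho>" and K = "\<lambda>\<zeta>. Qhat S \<zeta> \<rho>"])
       (use that in \<open>simp_all add: Qhat_linear Qhat_real\<close>)
  show ?thesis
    by (rule conj_linear_extend[where H = "Qhat S (\<lambda>\<theta>. vcnj (\<phi> \<theta>))" and K = "Qhat S \<phi>"])
       (use assms in \<open>simp_all add: Qhat_linear real2\<close>)
qed

text \<open>The same in two steps: the sum of the cubic form at \<open>\<phi> + \<psi>\<close> and at \<open>\<psi> - \<phi>\<close> isolates
  \<open>C(\<phi>,\<phi>,\<psi>)\<close>, which is then polarized in its first two arguments.\<close>

lemma Chat_real:
  assumes "cont_hist S \<phi>" "cont_hist S \<psi>" "cont_hist S \<zeta>"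
    and "\<And>\<theta>. vcnj (\<phi> \<theta>) = \<phi> \<theta>" "\<And>\<theta>. vcnj (\<psi> \<theta>) = \<psi> \<theta>" "\<And>\<theta>. vcnj (\<zeta> \<theta>) = \<zeta> \<theta>"
  shows "vcnj (Chat S \<phi> \<psi> \<zeta>) = Chat S \<phi> \<psi> \<zeta>"
proof -
  have diag: "vcnj (Chat S \<zeta> \<zeta> \<zeta>) = Chat S \<zeta> \<zeta> \<zeta>" if "cont_hist S \<zeta>" "\<And>\<theta>. vcnj (\<zeta> \<theta>) = \<zeta> \<theta>" for \<zeta>
    unfolding Chat_def using that by (intro taylor_forms_real tens_in_hist_space real_hist_tens)
  have two: "vcnj (Chat S \<phi> \<phi> \<psi>) = Chat S \<phi> \<phi> \<psi>"
    if c: "cont_hist S \<phi>" "cont_hist S \<psi>" and r: "\<And>\<theta>. vcnj (\<phi> \<theta>) = \<phi> \<theta>" "\<And>\<theta>. vcnj (\<psi> \<theta>) = \<psi> \<theta>" for \<phi> \<psi>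
  proof -
    \<comment> \<open>The sign is kept symbolic so that multilinear expansion treats it as a scalar.\<close>
    define d :: complex where "d = -1"
    let ?p = "\<lambda>\<theta>. \<phi> \<theta> + \<psi> \<theta>" and ?m = "\<lambda>\<theta>. d *s \<phi> \<theta> + \<psi> \<theta>"
    have m: "cont_hist S ?m" "\<And>\<theta>. vcnj (?m \<theta>) = ?m \<theta>"
      by (intro cont_hist_intros c, simp add: r d_def)
    have "Chat S ?m ?m ?m = (d * d * d) *s Chat S \<phi> \<phi> \<phi> + (3 * d * d) *s Chat S \<phi> \<phi> \<psi> +
        (3 * d) *s Chat S \<phi> \<psi> \<psi> + Chat S \<psi> \<psi> \<psi>"
      using c by (simp add: Chat_linear cont_hist_intros Chat_sym(1)[of \<psi> \<phi>] Chat_sym(2)[of _ \<psi> \<phi>]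
          vec_eq_iff algebra_simps)
    moreover have "Chat S ?p ?p ?p = Chat S \<phi> \<phi> \<phi> + 3 *s Chat S \<phi> \<phi> \<psi> +
        3 *s Chat S \<phi> \<psi> \<psi> + Chat S \<psi> \<psi> \<psi>"
      using c by (simp add: Chat_linear cont_hist_intros Chat_sym(1)[of \<psi> \<phi>] Chat_sym(2)[of _ \<psi> \<phi>]
          vec_eq_iff algebra_simps)
    ultimately have "6 *s Chat S \<phi> \<phi> \<psi> = Chat S ?p ?p ?p + Chat S ?m ?m ?m - 2 *s Chat S \<psi> \<psi> \<psi>"
      by (simp add: vec_eq_iff) (simp add: d_def)
    moreover have "vcnj \<dots> = \<dots>"
      using c r diag[of ?p] diag[OF m] diag[of \<psi>] by (simp add: cont_hist_intros)
    ultimately have "vcnj (6 *s Chat S \<phi> \<phi> \<psi>) = 6 *s Chat S \<phi> \<phi> \<psi>"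
      by simp
    then show ?thesis
      by (simp add: vec_eq_iff)
  qed
  let ?p = "\<lambda>\<theta>. \<phi> \<theta> + \<psi> \<theta>"
  have "Chat S ?p ?p \<zeta> = Chat S \<phi> \<phi> \<zeta> + 2 *s Chat S \<phi> \<psi> \<zeta> + Chat S \<psi> \<psi> \<zeta>"
    using assms by (simp add: Chat_linear cont_hist_intros Chat_sym(1)[of \<psi> \<phi>] vec_eq_iff)
  then have "2 *s Chat S \<phi> \<psi> \<zeta> = Chat S ?p ?p \<zeta> - Chat S \<phi> \<phi> \<zeta> - Chat S \<psi> \<psi> \<zeta>"
    by simp
  moreover have "vcnj \<dots> = \<dots>"
    using assms by (simp add: two cont_hist_intros)
  ultimately have "vcnj (2 *s Chat S \<phi> \<psi> \<zeta>) = 2 *s Chat S \<phi> \<psi> \<zeta>"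
    by simp
  then show ?thesis
    by (simp add: vec_eq_iff)
qed

lemma Chat_cnj:
  assumes "cont_hist S \<phi>" "cont_hist S \<psi>" "cont_hist S \<zeta>"
  shows "Chat S (\<lambda>\<theta>. vcnj (\<phi> \<theta>)) (\<lambda>\<theta>. vcnj (\<psi> \<theta>)) (\<lambda>\<theta>. vcnj (\<zeta> \<theta>)) = vcnj (Chat S \<phi> \<psi> \<zeta>)"
proof -
  have real2: "Chat S (\<lambda>\<theta>. vcnj (\<mu> \<theta>)) \<rho> \<rho>' = vcnj (Chat S \<mu> \<rho> \<rho>')"
    if "cont_hist S \<mu>" "cont_hist S \<rho>" "\<And>\<theta>. vcnj (\<rho> \<theta>) = \<rho> \<theta>" "cont_hist S \<rho>'" "\<And>\<theta>. vcnj (\<rho>' \<theta>) = \<rho>' \<theta>" for \<mu> \<rho> \<rho>'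
    by (rule conj_linear_extend[where H = "\<lambda>\<mu>. Chat S \<mu> \<rho> \<rho>'" and K = "\<lambda>\<mu>. Chat S \<mu> \<rho> \<rho>'"])
       (use that in \<open>simp_all add: Chat_linear Chat_real\<close>)
  have real1: "Chat S (\<lambda>\<theta>. vcnj (\<mu> \<theta>)) (\<lambda>\<theta>. vcnj (\<rho> \<theta>)) \<rho>' = vcnj (Chat S \<mu> \<rho> \<rho>')"
    if "cont_hist S \<mu>" "cont_hist S \<rho>" "cont_hist S \<rho>'" "\<And>\<theta>. vcnj (\<rho>' \<theta>) = \<rho>' \<theta>" for \<mu> \<rho> \<rho>'
    by (rule conj_linear_extend[where H = "\<lambda>\<rho>. Chat S (\<lambda>\<theta>. vcnj (\<mu> \<theta>)) \<rho> \<rho>'" and K = "\<lambda>\<rho>. Chat S \<mu> \<rho> \<rho>'"])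
       (use that in \<open>simp_all add: Chat_linear real2\<close>)
  show ?thesis
    by (rule conj_linear_extend[where H = "Chat S (\<lambda>\<theta>. vcnj (\<phi> \<theta>)) (\<lambda>\<theta>. vcnj (\<psi> \<theta>))" and K = "Chat S \<phi> \<psi>"])
       (use assms in \<open>simp_all add: Chat_linear real1\<close>)
qed

text \<open>The forms act pointwise and products of eigenfunctions are again sums of eigenfunctions, so a
  product of two modes is spread over at most two modes.\<close>

lemma Q_modes:
  assumes "cont_hist S \<phi>" "cont_hist S \<psi>"
  shows "k \<noteq> 0 \<Longrightarrow> Qop S (tens S \<phi> (beta S k)) (tens S \<psi> (beta S k)) =
      vtens S (Qhat S \<phi> \<psi>) (beta S 0) + vtens S (of_real (1 / sqrt 2) *s Qhat S \<phi> \<psi>) (beta S (2 * k))"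
    and "Qop S (tens S \<phi> (beta S k)) (tens S \<psi> (beta S 0)) = vtens S (Qhat S \<phi> \<psi>) (beta S k)"
    and "k \<noteq> 0 \<Longrightarrow> Qop S (tens S \<phi> (beta S k)) (tens S \<psi> (beta S (2 * k))) =
      vtens S (of_real (1 / sqrt 2) *s Qhat S \<phi> \<psi>) (beta S k) +
      vtens S (of_real (1 / sqrt 2) *s Qhat S \<phi> \<psi>) (beta S (3 * k))"
proof -
  have pw: "\<forall>\<phi> \<psi> b b'. cont_hist S \<phi> \<and> cont_hist S \<psi> \<longrightarrow> (\<forall>i.
        rep_eq S (Qop S (tens S \<phi> b) (tens S \<psi> b') $ i) (\<lambda>x. Qhat S \<phi> \<psi> $ i * rep S b x * rep S b' x))"
    using pointwise unfolding pointwise_def by (elim conjE)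
  have *: "rep_eq S (Qop S (tens S \<phi> (beta S j)) (tens S \<psi> (beta S k)) $ i)
      (\<lambda>x. Qhat S \<phi> \<psi> $ i * (eigfun S j x * eigfun S k x))" for i j k
    using pw[rule_format, OF conjI[OF assms], of "beta S j" "beta S k" i] rep_eq_beta[of j] rep_eq_beta[of k]
    unfolding rep_eq_def by eventually_elim simp
  note comb = rep_eq_add[OF rep_eq_cscale[OF rep_eq_beta] rep_eq_cscale[OF rep_eq_beta]]
  show "Qop S (tens S \<phi> (beta S k)) (tens S \<psi> (beta S k)) =
      vtens S (Qhat S \<phi> \<psi>) (beta S 0) + vtens S (of_real (1 / sqrt 2) *s Qhat S \<phi> \<psi>) (beta S (2 * k))"
    if "k \<noteq> 0"
    unfolding vec_eq_iff
  proof
    fix i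
    show "Qop S (tens S \<phi> (beta S k)) (tens S \<psi> (beta S k)) $ i =
      (vtens S (Qhat S \<phi> \<psi>) (beta S 0) + vtens S (of_real (1 / sqrt 2) *s Qhat S \<phi> \<psi>) (beta S (2 * k))) $ i"
      unfolding vector_add_component vtens_nth
      by (rule rep_eq_unique[OF * rep_eq_cong[OF comb]])
         (simp only: eigfun_mult_self[OF that], simp add: algebra_simps)
  qed
  show "Qop S (tens S \<phi> (beta S k)) (tens S \<psi> (beta S 0)) = vtens S (Qhat S \<phi> \<psi>) (beta S k)"
    unfolding vec_eq_iff
  proof
    fix i
    show "Qop S (tens S \<phi> (beta S k)) (tens S \<psi> (beta S 0)) $ i = vtens S (Qhat S \<phi> \<psi>) (beta S k) $ i"
      unfolding vtens_nth
      by (rule rep_eq_unique[OF * rep_eq_cong[OF rep_eq_cscale[OF rep_eq_beta]]]) simp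
  qed
  show "Qop S (tens S \<phi> (beta S k)) (tens S \<psi> (beta S (2 * k))) =
      vtens S (of_real (1 / sqrt 2) *s Qhat S \<phi> \<psi>) (beta S k) +
      vtens S (of_real (1 / sqrt 2) *s Qhat S \<phi> \<psi>) (beta S (3 * k))"
    if "k \<noteq> 0"
    unfolding vec_eq_iff
  proof
    fix i
    show "Qop S (tens S \<phi> (beta S k)) (tens S \<psi> (beta S (2 * k))) $ i =
      (vtens S (of_real (1 / sqrt 2) *s Qhat S \<phi> \<psi>) (beta S k) +
      vtens S (of_real (1 / sqrt 2) *s Qhat S \<phi> \<psi>) (beta S (3 * k))) $ i"
      unfolding vector_add_component vtens_nth
      by (rule rep_eq_unique[OF * rep_eq_cong[OF comb]])
         (simp only: eigfun_mult_double[OF that], simp add: algebra_simps)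
  qed
qed

lemma C_modes:
  assumes "cont_hist S \<phi>" "cont_hist S \<psi>" "cont_hist S \<zeta>" "k \<noteq> 0"
  shows "Cop S (tens S \<phi> (beta S k)) (tens S \<psi> (beta S k)) (tens S \<zeta> (beta S k)) =
      vtens S ((3 / 2) *s Chat S \<phi> \<psi> \<zeta>) (beta S k) + vtens S ((1 / 2) *s Chat S \<phi> \<psi> \<zeta>) (beta S (3 * k))"
  unfolding vec_eq_iff
proof
  fix i
  have pw: "\<forall>\<phi> \<psi> \<rho> b b' b''. cont_hist S \<phi> \<and> cont_hist S \<psi> \<and> cont_hist S \<rho> \<longrightarrow> (\<forall>i.
        rep_eq S (Cop S (tens S \<phi> b) (tens S \<psi> b') (tens S \<rho> b'') $ i)
          (\<lambda>x. Chat S \<phi> \<psi> \<rho> $ i * rep S b x * rep S b' x * rep S b'' x))"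
    using pointwise unfolding pointwise_def by (elim conjE)
  have "rep_eq S (Cop S (tens S \<phi> (beta S k)) (tens S \<psi> (beta S k)) (tens S \<zeta> (beta S k)) $ i)
      (\<lambda>x. Chat S \<phi> \<psi> \<zeta> $ i * (eigfun S k x * (eigfun S k x * eigfun S k x)))"
    using pw[rule_format, OF conjI[OF assms(1) conjI[OF assms(2,3)]], of "beta S k" "beta S k" "beta S k" i]
      rep_eq_beta[of k]
    unfolding rep_eq_def by eventually_elim simp
  moreover have "eigfun S k x * (eigfun S k x * eigfun S k x) = (3 / 2) * eigfun S k x + (1 / 2) * eigfun S (3 * k) x" for x
  proof -
    have "eigfun S k x * (eigfun S k x * eigfun S k x) =
        eigfun S k x + of_real (1 / sqrt 2) * (eigfun S k x * eigfun S (2 * k) x)"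
      by (simp only: eigfun_mult_self[OF assms(4)]) (simp add: algebra_simps)
    also have "\<dots> = eigfun S k x + of_real (1 / sqrt 2 * (1 / sqrt 2)) * (eigfun S k x + eigfun S (3 * k) x)"
      by (simp only: eigfun_mult_double[OF assms(4)] of_real_mult mult.assoc)
    also have "\<dots> = (3 / 2) * eigfun S k x + (1 / 2) * eigfun S (3 * k) x"
      by (simp add: algebra_simps)
    finally show ?thesis .
  qed
  ultimately have *: "rep_eq S (Cop S (tens S \<phi> (beta S k)) (tens S \<psi> (beta S k)) (tens S \<zeta> (beta S k)) $ i)
      (\<lambda>x. Chat S \<phi> \<psi> \<zeta> $ i * ((3 / 2) * eigfun S k x + (1 / 2) * eigfun S (3 * k) x))"
    by simp
  show "Cop S (tens S \<phi> (beta S k)) (tens S \<psi> (beta S k)) (tens S \<zeta> (beta S k)) $ i =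
      (vtens S ((3 / 2) *s Chat S \<phi> \<psi> \<zeta>) (beta S k) + vtens S ((1 / 2) *s Chat S \<phi> \<psi> \<zeta>) (beta S (3 * k))) $ i"
    unfolding vector_add_component vtens_nth
    by (rule rep_eq_unique[OF * rep_eq_cong[OF rep_eq_add[OF rep_eq_cscale[OF rep_eq_beta] rep_eq_cscale[OF rep_eq_beta]]]])
       (simp add: algebra_simps)
qed

end

section \<open>Characteristic matrices\<close>

lemma matrix_solve:
  fixes A :: "'a::field ^ 'n ^ 'n"
  assumes "invertible A"
  shows "A *v x = b \<longleftrightarrow> x = matrix_inv A *v b"
proof -
  have inv: "A ** matrix_inv A = mat 1 \<and> matrix_inv A ** A = mat 1"
    using assms unfolding matrix_inv_def invertible_def by (rule someI_ex)
  show ?thesis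
    by (metis inv matrix_vector_mul_assoc matrix_vector_mul_lid)
qed

lemma rs_integral_zero [simp]: "rs_integral a b e (\<lambda>_. 0) = 0"
proof -
  have "has_rs_integral a b e (\<lambda>_. 0) J \<longleftrightarrow> J = 0" for J
  proof
    assume J: "has_rs_integral a b e (\<lambda>_. 0) J"
    show "J = 0"
    proof (rule ccontr)
      assume "J \<noteq> 0"
      then have "\<exists>\<delta>>0. \<forall>p. p tagged_division_of {a..b} \<and> (\<lambda>x. ball x \<delta>) fine p \<longrightarrow>
          cmod ((\<Sum>(x, I)\<in>p. (e (Sup I) - e (Inf I)) * 0) - J) < cmod J"
        using J[unfolded has_rs_integral_def, rule_format, of "cmod J"] by simp
      then obtain \<delta> where \<delta>: "\<delta> > 0"
        "\<And>p. p tagged_division_of {a..b} \<Longrightarrow> (\<lambda>x. ball x \<delta>) fine p \<Longrightarrow>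
          cmod ((\<Sum>(x, I)\<in>p. (e (Sup I) - e (Inf I)) * 0) - J) < cmod J"
        by blast
      obtain p where "p tagged_division_of {a..b}" "(\<lambda>x. ball x \<delta>) fine p"
        using fine_division_exists_real[OF gauge_ball[OF \<delta>(1)]] by metis
      then show False
        using \<delta>(2) by fastforce
    qed
  next
    assume "J = 0"
    then show "has_rs_integral a b e (\<lambda>_. 0) J"
      unfolding has_rs_integral_def by (auto intro!: exI[of _ 1])
  qed
  then show ?thesis
    by (simp add: rs_integral_def)
qed

lemma rowdot_zero [simp]: "rowdot p 0 = 0"
  by (simp add: rowdot_def)

lemma rowdot_add: "rowdot p (v + w) = rowdot p v + rowdot p w"
  by (simp add: rowdot_def algebra_simps sum.distrib)

lemma rowdot_smult: "rowdot p (c *s v) = c * rowdot p v"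
  by (simp add: rowdot_def sum_distrib_left mult_ac)

lemma rowdot_cnj: "rowdot (vcnj p) (vcnj v) = cnj (rowdot p v)"
  by (simp add: rowdot_def vcnj_def)

lemma linear_rowdot: "bounded_linear (rowdot p)"
  unfolding rowdot_def
  by (intro bounded_linear_sum bounded_linear_compose[OF bounded_linear_mult_right bounded_linear_vec_nth])

definition expo :: "complex \<Rightarrow> complex ^ 'm \<Rightarrow> real \<Rightarrow> complex ^ 'm" where
  "expo \<zeta> a \<theta> = exp (\<zeta> * of_real \<theta>) *s a"

locale hopf_steady_model = delay_model S
  for S :: "('x::{real_inner,complete_space}, 'm::finite) rdde" +
  assumes hopf_steady: "hopf_steady_state S"
    and equal_modes: "k1 S = k2 S" and nonzero_mode: "k1 S \<noteq> 0"
    and bases: "bases S"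
begin

abbreviation kk :: nat where "kk \<equiv> k1 S"

lemma cont_hist_expo: "cont_hist S (expo \<zeta> (a :: complex ^ 'm))"
  unfolding expo_def[abs_def] by (intro cont_hist_intros)

lemma cont_hist_sum:
  fixes f :: "'i \<Rightarrow> real \<Rightarrow> complex ^ 'm"
  assumes "\<And>i. i \<in> A \<Longrightarrow> cont_hist S (f i)"
  shows "cont_hist S (\<lambda>\<theta>. \<Sum>i\<in>A. f i \<theta>)"
  using assms unfolding cont_hist_def by (rule continuous_on_sum)

lemma tens_zero: "tens S (\<lambda>_. 0) b = 0"
  by (rule bcontfun_eqI) (simp add: apply_tens cont_hist_const)

lemma tens_sum:
  assumes "finite A" "\<And>i. i \<in> A \<Longrightarrow> cont_hist S (f i)"
  shows "tens S (\<lambda>\<theta>. \<Sum>i\<in>A. f i \<theta>) b = (\<Sum>i\<in>A. tens S (f i) b)"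
  using assms by (induction A rule: finite_induct) (simp_all add: tens_zero tens_add cont_hist_sum)

lemma hat1_sum:
  fixes T :: "('x, 'm) history \<Rightarrow>\<^sub>L ('x ^ 'm)"
  assumes "finite A" "\<And>i. i \<in> A \<Longrightarrow> cont_hist S (f i)"
  shows "hat1 S T (\<lambda>\<theta>. \<Sum>i\<in>A. f i \<theta>) = (\<Sum>i\<in>A. hat1 S T (f i))"
proof -
  interpret mode: bounded_linear "mode S 0" by (rule bounded_linear_mode)
  show ?thesis
    using assms by (simp add: hat1_def tens_sum blinfun.sum_right mode.sum)
qed

lemmas L0 = pointwise_opD[OF pointwise_op_Lop[OF zero_in_nbhd]]

lemma mode_rhs_sum:
  assumes "finite A" "\<And>i. i \<in> A \<Longrightarrow> cont_hist S (f i)"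
  shows "mode_rhs S k (\<lambda>\<theta>. \<Sum>i\<in>A. c i *s f i \<theta>) = (\<Sum>i\<in>A. c i *s mode_rhs S k (f i))"
proof -
  have "hat1 S (Lop S 0) (\<lambda>\<theta>. \<Sum>i\<in>A. c i *s f i \<theta>) = (\<Sum>i\<in>A. c i *s hat1 S (Lop S 0) (f i))"
    using assms by (subst hat1_sum) (simp_all add: cont_hist_intros L0)
  moreover have "cdiag (diffus S 0) *v (\<Sum>i\<in>A. c i *s f i 0) = (\<Sum>i\<in>A. c i *s (cdiag (diffus S 0) *v f i 0))"
    by (simp add: linear_sum[OF matrix_vector_mul_linear] vector_scalar_commute)
  ultimately show ?thesis
    by (simp add: mode_rhs_def vec_eq_iff sum.distrib algebra_simps scaleR_sum_right sum_negf sum_subtractf)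
qed

lemma char_matrix_vec: "char_matrix S k 0 \<zeta> *v a = \<zeta> *s a - mode_rhs S k (expo \<zeta> a)"
proof -
  have "expo \<zeta> a = (\<lambda>\<theta>. \<Sum>j\<in>UNIV. a $ j *s expo \<zeta> (axis j 1) \<theta>)"
    by (rule ext) (simp add: expo_def vec_eq_iff axis_def if_distrib[of "(*) _"] sum.delta cong: if_cong)
  then have "hat1 S (Lop S 0) (expo \<zeta> a) = (\<Sum>j\<in>UNIV. a $ j *s hat1 S (Lop S 0) (expo \<zeta> (axis j 1)))"
    by (simp only: hat1_sum[OF finite cont_hist_smult[OF cont_hist_const cont_hist_expo]] L0(2)[OF cont_hist_expo])
  then have "(\<chi> i j. hat1 S (Lop S 0) (\<lambda>\<theta>. exp (\<zeta> * of_real \<theta>) *s axis j 1) $ i) *v a =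
      hat1 S (Lop S 0) (expo \<zeta> a)"
    by (simp add: vec_eq_iff matrix_vector_mult_def expo_def[abs_def] mult.commute)
  moreover have "mat \<zeta> *v a = \<zeta> *s a"
    by (simp add: vec_eq_iff matrix_vector_mult_def mat_def if_distrib[of "\<lambda>x. x * _"] cong: if_cong)
  moreover have "(mu S k *\<^sub>R cdiag (diffus S 0)) *v a = mu S k *\<^sub>R (cdiag (diffus S 0) *v expo \<zeta> a 0)"
    by (simp add: expo_def vec_eq_iff matrix_vector_mult_def scaleR_sum_right)
  ultimately show ?thesis
    by (simp add: char_matrix_def mode_rhs_def matrix_vector_mult_diff_rdistrib matrix_vector_mult_add_rdistrib
        algebra_simps)
qed

text \<open>The kernel \<open>\<eta>\<^sub>k\<close> is only known through the operator it represents; testing it on exponentials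
  times unit vectors recovers the characteristic matrix.\<close>

lemma eta_int_exp: "eta_int S k (\<lambda>\<theta>. exp (\<zeta> * of_real \<theta>)) = mat \<zeta> - char_matrix S k 0 \<zeta>"
proof -
  have rep: "mode_rhs S k \<psi> = (\<chi> i. \<Sum>j\<in>UNIV. rs_integral (- delay S) 0 (\<lambda>\<theta>. eta S k \<theta> $ i $ j) (\<lambda>\<theta>. \<psi> \<theta> $ j))"
    if "cont_hist S \<psi>" for \<psi>
    using bases that unfolding bases_def eta_represents_def by blast
  have "eta_int S k (\<lambda>\<theta>. exp (\<zeta> * of_real \<theta>)) $ i $ j = (mat \<zeta> - char_matrix S k 0 \<zeta>) $ i $ j" for i j
  proof -
    have "mode_rhs S k (expo \<zeta> (axis j 1)) $ i =
        (\<Sum>l\<in>UNIV. rs_integral (- delay S) 0 (\<lambda>\<theta>. eta S k \<theta> $ i $ l) (\<lambda>\<theta>. expo \<zeta> (axis j 1) \<theta> $ l))"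
      by (simp add: rep[OF cont_hist_expo])
    also have "\<dots> = (\<Sum>l\<in>UNIV. if l = j then eta_int S k (\<lambda>\<theta>. exp (\<zeta> * of_real \<theta>)) $ i $ j else 0)"
      by (rule sum.cong) (auto simp: expo_def axis_def eta_int_def)
    finally have "mode_rhs S k (expo \<zeta> (axis j 1)) $ i = eta_int S k (\<lambda>\<theta>. exp (\<zeta> * of_real \<theta>)) $ i $ j"
      by simp
    moreover have "(char_matrix S k 0 \<zeta> *v axis j 1) $ i = char_matrix S k 0 \<zeta> $ i $ j"
      by (simp add: matrix_vector_mult_def axis_def if_distrib[of "(*) _"] cong: if_cong)
    moreover have "(char_matrix S k 0 \<zeta> *v axis j 1) $ i = \<zeta> * axis j 1 $ i - mode_rhs S k (expo \<zeta> (axis j 1)) $ i"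
      by (simp add: char_matrix_vec)
    ultimately show ?thesis
      by (simp add: mat_def axis_def)
  qed
  then show ?thesis by (simp add: vec_eq_iff)
qed

lemma res_matrix_char: "res_matrix S n k = char_matrix S k 0 (of_nat n * \<i> * of_real (omega0 S))"
proof -
  have "expiw S n = (\<lambda>\<theta>. exp (of_nat n * \<i> * of_real (omega0 S) * of_real \<theta>))"
    by (rule ext) (simp add: expiw_def mult.assoc)
  then show ?thesis
    by (simp add: res_matrix_def eta_int_exp)
qed

lemma eta_int_one: "eta_int S k (\<lambda>_. 1) = - char_matrix S k 0 0"
proof -
  have "(mat 0 :: complex ^ 'm ^ 'm) = 0"
    by (simp add: vec_eq_iff mat_def)
  then show ?thesis
    using eta_int_exp[of k 0] by simp
qed

text \<open>The only roots on the imaginary axis belong to the critical mode.\<close>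

lemma char_matrix_invertible:
  assumes "k \<noteq> kk" "Re \<zeta> = 0"
  shows "invertible (char_matrix S k 0 \<zeta>)"
proof -
  have "H4 S"
    using hopf_steady by (simp add: hopf_steady_state_def)
  then obtain \<gamma> \<nu> \<omega> :: "real \<times> real \<Rightarrow> real" where
    "\<forall>k \<zeta>. char_fun S k 0 \<zeta> = 0 \<and> \<not> (k = k1 S \<and> \<zeta> = of_real (\<gamma> 0)) \<and>
            \<not> (k = k2 S \<and> (\<zeta> = Complex (\<nu> 0) (\<omega> 0) \<or> \<zeta> = Complex (\<nu> 0) (- \<omega> 0)))
          \<longrightarrow> Re \<zeta> \<noteq> 0"
    unfolding H4_def using zero_in_nbhd by blast
  then have "char_fun S k 0 \<zeta> \<noteq> 0"
    using assms equal_modes by metis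
  then show ?thesis
    by (simp add: char_fun_def invertible_det_nz)
qed

lemma char_matrix_cnj: "char_matrix S k 0 (cnj \<zeta>) *v vcnj a = vcnj (char_matrix S k 0 \<zeta> *v a)"
proof -
  have e: "expo (cnj \<zeta>) (vcnj a) = (\<lambda>\<theta>. vcnj (expo \<zeta> a \<theta>))"
    by (rule ext) (simp add: expo_def exp_cnj)
  have "vcnj (cdiag d *v x) = cdiag d *v vcnj x" for d and x :: "complex ^ 'm"
    by (auto simp: vec_eq_iff matrix_vector_mult_def cdiag_def cnj_sum intro!: sum.cong)
  moreover have "vcnj (r *\<^sub>R x) = r *\<^sub>R vcnj x" for r and x :: "complex ^ 'm"
    by (simp add: vec_eq_iff)
  ultimately have "mode_rhs S k (expo (cnj \<zeta>) (vcnj a)) = vcnj (mode_rhs S k (expo \<zeta> a))"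
    unfolding e by (simp add: mode_rhs_def L0(3)[OF cont_hist_expo])
  then show ?thesis
    by (simp add: char_matrix_vec)
qed

lemma spec_proj_zero:
  assumes "\<And>\<xi>. mode S kk (\<phi> \<xi>) = 0"
  shows "spec_proj S \<phi> \<theta> = 0"
  using assms equal_modes by (simp add: spec_proj_def pairing_def)

end

section \<open>Projection onto monomials\<close>

lemma finite_monoms: "finite (monoms N)"
proof (rule finite_subset)
  show "monoms N \<subseteq> ((({..N} \<times> {..N} \<times> {..N}) \<times> ({..N} \<times> {..N})) \<times> UNIV)"
    by (auto simp: monoms_def)
qed simp

lemma mixed_radix_unique:
  fixes a b x y M :: nat
  assumes "a < M" "b < M"
  shows "a + M * x = b + M * y \<longleftrightarrow> a = b \<and> x = y"
proof
  assume eq: "a + M * x = b + M * y"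
  have "a = (a + M * x) mod M" "b = (b + M * y) mod M"
    using assms by simp_all
  with eq have "a = b" by simp
  with eq assms show "a = b \<and> x = y" by simp
qed simp

text \<open>Kronecker substitution: putting the five variables equal to \<open>t\<close>, \<open>t\<^sup>M\<close>, \<dots> with
  \<open>M\<close> larger than the degree turns distinct monomials into distinct powers of one real variable.\<close>

lemma vmono_independent:
  assumes zero: "\<And>z \<alpha>. (\<Sum>n\<in>monoms N. c n *s vmono n z \<alpha>) = 0" and n0: "n0 \<in> monoms N"
  shows "c n0 = 0"
proof -
  define M where "M = Suc N"
  define ex :: "mono_index \<Rightarrow> nat" where
    "ex n = (case n of (((a, b, c), (d, e)), j) \<Rightarrow> a + M * (b + M * (c + M * (d + M * e))))" for n
  define J where "J = {n \<in> monoms N. snd n = snd n0}"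
  have finJ: "finite J" using finite_monoms by (simp add: J_def)
  have inj: "ex n = ex n0 \<longleftrightarrow> n = n0" if "n \<in> J" for n
  proof -
    obtain a b c d e where n: "n = (((a, b, c), (d, e)), snd n0)" "a + b + c + d + e = N"
      using \<open>n \<in> J\<close> by (auto simp: J_def monoms_def)
    obtain a' b' c' d' e' where n0': "n0 = (((a', b', c'), (d', e')), snd n0)" "a' + b' + c' + d' + e' = N"
      using n0 by (auto simp: monoms_def)
    have lt: "a < M" "b < M" "c < M" "d < M" "a' < M" "b' < M" "c' < M" "d' < M"
      using n(2) n0'(2) by (simp_all add: M_def)
    have M: "M \<noteq> 0" by (simp add: M_def)
    show ?thesis
      by (subst (1 2) n0'(1), subst (1 2) n(1)) (simp add: ex_def mixed_radix_unique lt M)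
  qed
  define P where "P = (\<Sum>n\<in>J. Polynomial.monom (c n) (ex n))"
  have "poly P (of_real t) = 0" for t
  proof -
    define z :: "complex ^ 3" where "z = vector [of_real t, of_real t ^ M, of_real t ^ (M * M)]"
    define \<alpha> :: "real \<times> real" where "\<alpha> = (t ^ (M * M * M), t ^ (M * M * M * M))"
    have vm: "vmono n z \<alpha> $ snd n0 = (if snd n = snd n0 then of_real t ^ ex n else 0)" for n
    proof -
      obtain a b c d e j where n: "n = (((a, b, c), (d, e)), j)"
        by (metis surj_pair)
      show ?thesis
        by (auto simp: n vmono_def zmono_def ex_def z_def \<alpha>_def axis_def power_mult[symmetric] power_add[symmetric]
            algebra_simps)
    qed
    have "0 = (\<Sum>n\<in>monoms N. c n *s vmono n z \<alpha>) $ snd n0"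
      by (simp add: zero)
    also have "\<dots> = (\<Sum>n\<in>monoms N. if snd n = snd n0 then c n * of_real t ^ ex n else 0)"
      by (auto simp: vm intro!: sum.cong)
    also have "\<dots> = (\<Sum>n\<in>J. c n * of_real t ^ ex n)"
      by (simp add: J_def sum.inter_filter finite_monoms)
    also have "\<dots> = poly P (of_real t)"
      by (simp add: P_def poly_sum poly_monom)
    finally show ?thesis by simp
  qed
  then have "range complex_of_real \<subseteq> {x. poly P x = 0}"
    by auto
  moreover have "infinite (range complex_of_real)"
    using infinite_UNIV_char_0 finite_imageD[of complex_of_real UNIV] by (auto simp: inj_of_real)
  ultimately have "P = 0"
    using poly_roots_finite finite_subset by blast
  then have "0 = coeff P (ex n0)" by simp
  also have "\<dots> = (\<Sum>n\<in>J. if n = n0 then c n else 0)"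
    unfolding P_def coeff_sum coeff_monom by (rule sum.cong) (auto simp: inj)
  also have "\<dots> = c n0"
    using finJ n0 by (simp add: J_def)
  finally show ?thesis by simp
qed

lemma poly_coeffs_eq:
  assumes supp: "\<And>n. n \<notin> monoms N \<Longrightarrow> c n = 0"
    and p: "\<And>z \<alpha>. p z \<alpha> = (\<Sum>n\<in>monoms N. c n *s vmono n z \<alpha>)"
  shows "poly_coeffs N p = c"
  unfolding poly_coeffs_def
proof (rule the_equality)
  show "(\<forall>n. n \<notin> monoms N \<longrightarrow> c n = 0) \<and> (\<forall>z \<alpha>. p z \<alpha> = (\<Sum>n\<in>monoms N. c n *s vmono n z \<alpha>))"
    by (intro conjI allI impI supp p)
  fix d assume d: "(\<forall>n. n \<notin> monoms N \<longrightarrow> d n = 0) \<and> (\<forall>z \<alpha>. p z \<alpha> = (\<Sum>n\<in>monoms N. d n *s vmono n z \<alpha>))"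
  have "(\<Sum>n\<in>monoms N. (d n - c n) *s vmono n z \<alpha>) = 0" for z \<alpha>
  proof -
    have "(\<Sum>n\<in>monoms N. (d n - c n) *s vmono n z \<alpha>) =
        (\<Sum>n\<in>monoms N. d n *s vmono n z \<alpha>) - (\<Sum>n\<in>monoms N. c n *s vmono n z \<alpha>)"
      by (simp add: sum_subtractf[symmetric] vector_sub_rdistrib)
    also have "\<dots> = p z \<alpha> - p z \<alpha>"
      by (simp only: conjunct2[OF d, rule_format, symmetric] p[symmetric])
    finally show ?thesis by simp
  qed
  then have "d n - c n = 0" if "n \<in> monoms N" for n
    using vmono_independent[where N = N and c = "\<lambda>n. d n - c n"] that by blast
  then show "d = c"
    using d supp by fastforce
qed

text \<open>Uniqueness of coefficients makes the projection computable.  The exponent set \<open>E\<close> may carry zero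
  coefficients, so that it can be enlarged to cover the monomials of \<open>K\<close>.\<close>

lemma Proj_components:
  fixes c :: "(nat \<times> nat \<times> nat) \<times> (nat \<times> nat) \<Rightarrow> 3 \<Rightarrow> complex"
  assumes fin: "finite E" and deg: "E \<times> UNIV \<subseteq> monoms N" and K: "K \<subseteq> E \<times> UNIV"
    and p: "\<And>z \<alpha>. p z \<alpha> = (\<chi> j. \<Sum>(q, d, e)\<in>E. c (q, d, e) j * (zmono q z * of_real (fst \<alpha> ^ d * snd \<alpha> ^ e)))"
  shows "Proj N K p z \<alpha> = (\<Sum>n\<in>K. c (fst n) (snd n) *s vmono n z \<alpha>)"
proof -
  define c' where "c' n = (if fst n \<in> E then c (fst n) (snd n) else 0)" for n
  have "p z \<alpha> = (\<Sum>n\<in>monoms N. c' n *s vmono n z \<alpha>)" for z \<alpha>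
  proof -
    have "(\<Sum>n\<in>monoms N. c' n *s vmono n z \<alpha>) = (\<Sum>n\<in>E \<times> UNIV. c' n *s vmono n z \<alpha>)"
      using deg by (intro sum.mono_neutral_right finite_monoms) (auto simp: c'_def)
    also have "\<dots> = (\<Sum>n\<in>E \<times> UNIV. c (fst n) (snd n) *s vmono n z \<alpha>)"
      by (rule sum.cong) (auto simp: c'_def)
    also have "\<dots> = (\<Sum>x\<in>E. \<Sum>j\<in>UNIV. c x j *s vmono (x, j) z \<alpha>)"
      by (simp add: sum.cartesian_product split_beta)
    also have "\<dots> = p z \<alpha>"
      unfolding p vec_eq_iff
    proof
      fix i
      have "(\<Sum>j\<in>UNIV. c x j *s vmono (x, j) z \<alpha>) $ i =
          (case x of (q, d, e) \<Rightarrow> c (q, d, e) i * (zmono q z * of_real (fst \<alpha> ^ d * snd \<alpha> ^ e)))" for x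
      proof -
        obtain q d e where x: "x = (q, d, e)" by (metis surj_pair)
        have "(\<Sum>j\<in>UNIV. c x j *s vmono (x, j) z \<alpha>) $ i =
            (\<Sum>j\<in>UNIV. if j = i then c x i * (zmono q z * of_real (fst \<alpha> ^ d * snd \<alpha> ^ e)) else 0)"
          unfolding sum_component by (rule sum.cong) (auto simp: vmono_def axis_def x)
        then show ?thesis by (simp add: x)
      qed
      then show "(\<Sum>x\<in>E. \<Sum>j\<in>UNIV. c x j *s vmono (x, j) z \<alpha>) $ i =
          (\<chi> j. \<Sum>(q, d, e)\<in>E. c (q, d, e) j * (zmono q z * of_real (fst \<alpha> ^ d * snd \<alpha> ^ e))) $ i"
        unfolding sum_component[of _ E] by (simp only: vec_lambda_beta)
    qed
    finally show ?thesis by simp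
  qed
  moreover have "c' n = 0" if "n \<notin> monoms N" for n
  proof -
    have "fst n \<notin> E"
      using deg that by (cases n) auto
    then show ?thesis by (simp add: c'_def)
  qed
  ultimately have "poly_coeffs N p = c'"
    by (intro poly_coeffs_eq)
  then show ?thesis
    unfolding Proj_def using K by (intro sum.cong) (auto simp: c'_def)
qed

section \<open>The quadratic term of the centre manifold\<close>

lemma expo_has_vector_derivative: "(expo \<zeta> a has_vector_derivative \<zeta> *s expo \<zeta> a \<theta>) (at \<theta> within A)"
proof -
  have "((\<lambda>\<theta>. exp (\<theta> *\<^sub>R \<zeta>)) has_vector_derivative exp (\<theta> *\<^sub>R \<zeta>) * \<zeta>) (at \<theta> within A)"
    by (rule exp_scaleR_has_vector_derivative_right)
  from bounded_linear.has_vector_derivative[OF bounded_linear_smult_vec(2) this, of a] show ?thesis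
    by (simp add: expo_def[abs_def] scaleR_conv_of_real mult.commute vec_eq_iff)
qed

lemma expo_smult: "expo \<zeta> (c *s a) \<theta> = c *s expo \<zeta> a \<theta>"
  by (simp add: expo_def mult.commute vec_eq_iff)

lemma scaleR_eq_smult: "r *\<^sub>R x = complex_of_real r *s x"
proof -
  have "(r *\<^sub>R x) $ i = of_real r * x $ i" for i
    unfolding vector_scaleR_component by (rule scaleR_conv_of_real)
  then show ?thesis by (simp add: vec_eq_iff)
qed

lemma finite_quad [simp]: "finite quad"
  by (simp add: quad_def)

lemma sum_quad:
  "sum f quad = f (2,0,0) + f (0,2,0) + f (0,0,2) + f (1,1,0) + f (1,0,1) + (f (0,1,1) :: 'a::comm_monoid_add)"
  by (simp add: quad_def add.assoc)

context hopf_steady_model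
begin

text \<open>\<open>B\<close> is diagonal, so differentiation along it multiplies each monomial by its frequency.\<close>

definition freq :: "nat \<times> nat \<times> nat \<Rightarrow> complex" where
  "freq q = (case q of (a, b, c) \<Rightarrow> \<i> * of_real (omega0 S) * (of_nat b - of_nat c))"

lemma zmono_derivative: "\<exists>D. (zmono q has_derivative D) (at z) \<and> D (Bmap S z) = freq q * zmono q z"
proof -
  obtain a b c where q: "q = (a, b, c)" by (metis surj_pair)
  have step: "of_nat n * x * y ^ (n - 1) = of_nat n * (w * y ^ n)" if "x = w * y" for n and w x y :: complex
    using that by (cases n) (simp_all add: mult_ac)
  have nth: "((\<lambda>z. z $ i) has_derivative (\<lambda>v. v $ i)) (at z)" for i and z :: "complex ^ 3"
    by (rule bounded_linear_imp_has_derivative) (rule bounded_linear_vec_nth)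
  define D where "D v = (of_nat a * v $ 1 * z $ 1 ^ (a - 1)) * (z $ 2 ^ b * z $ 3 ^ c) +
      z $ 1 ^ a * ((of_nat b * v $ 2 * z $ 2 ^ (b - 1)) * z $ 3 ^ c + z $ 2 ^ b * (of_nat c * v $ 3 * z $ 3 ^ (c - 1)))"
    for v :: "complex ^ 3"
  have eq: "zmono q = (\<lambda>z. z $ 1 ^ a * (z $ 2 ^ b * z $ 3 ^ c))"
    by (rule ext) (simp add: zmono_def q)
  have "(zmono q has_derivative D) (at z)"
    unfolding eq by (rule derivative_eq_intros nth refl)+ (auto simp: D_def algebra_simps)
  moreover have "D (Bmap S z) = freq q * zmono q z"
  proof -
    have m2: "of_nat b * (Bmap S z $ 2) * z $ 2 ^ (b - 1) = of_nat b * (\<i> * of_real (omega0 S) * z $ 2 ^ b)"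
      by (rule step) (simp add: Bmap_def)
    have m3: "of_nat c * (Bmap S z $ 3) * z $ 3 ^ (c - 1) = of_nat c * (- \<i> * of_real (omega0 S) * z $ 3 ^ c)"
      by (rule step) (simp add: Bmap_def)
    have m1: "Bmap S z $ 1 = 0"
      by (simp add: Bmap_def)
    show ?thesis
      unfolding D_def eq m1 m2 m3 by (simp add: freq_def q algebra_simps)
  qed
  ultimately show ?thesis by blast
qed

lemma phi2_expo: "phi2 S = expo (\<i> * of_real (omega0 S)) (phi20 S)"
  by (rule ext) (simp add: phi2_def expo_def mult.assoc)

lemma cont_phi: "cont_hist S (phi1 S)" "cont_hist S (phi2 S)" "cont_hist S (phi2c S)"
  unfolding phi1_def[abs_def] phi2c_def[abs_def] phi2_expo by (intro cont_hist_intros cont_hist_expo)+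

lemma cnj_phi: "(\<lambda>\<theta>. vcnj (phi1 S \<theta>)) = phi1 S" "(\<lambda>\<theta>. vcnj (phi2 S \<theta>)) = phi2c S" "(\<lambda>\<theta>. vcnj (phi2c S \<theta>)) = phi2 S"
proof -
  have "\<forall>i. phi10 S $ i \<in> \<real>"
    using bases unfolding bases_def by blast
  then have "vcnj (phi10 S) = phi10 S"
    by (simp add: vec_eq_iff Reals_cnj_iff)
  then show "(\<lambda>\<theta>. vcnj (phi1 S \<theta>)) = phi1 S"
    by (simp add: phi1_def[abs_def])
qed (simp_all add: phi2c_def[abs_def])

definition centre :: "complex ^ 3 \<Rightarrow> real \<Rightarrow> complex ^ 'm" where
  "centre z \<theta> = z $ 1 *s phi1 S \<theta> + (z $ 2 *s phi2 S \<theta> + z $ 3 *s phi2c S \<theta>)"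

lemma cont_centre: "cont_hist S (centre z)"
  unfolding centre_def[abs_def] by (intro cont_hist_intros cont_phi)

lemma wmap_centre: "wmap S z = tens S (centre z) (beta S kk)"
  unfolding wmap_def centre_def[abs_def] equal_modes[symmetric]
  by (subst tens_add[symmetric]) (simp_all add: cont_hist_intros cont_phi)

lemma Q_wmap: "Qop S (wmap S z) (wmap S z') =
    vtens S (Qhat S (centre z) (centre z')) (beta S 0) +
    vtens S (of_real (1 / sqrt 2) *s Qhat S (centre z) (centre z')) (beta S (2 * kk))"
  unfolding wmap_centre by (rule Q_modes(1)[OF cont_centre cont_centre nonzero_mode])

text \<open>The coefficients of \<open>Q(\<phi>,\<phi>)/2\<close>; a mixed term occurs twice in \<open>Q(\<phi>,\<phi>)\<close>, which cancels the factor
  \<open>1/2\<close>.\<close>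

definition qcoeff :: "nat \<times> nat \<times> nat \<Rightarrow> complex ^ 'm" where
  "qcoeff q =
    (if q = (2,0,0) then (1/2) *s Qhat S (phi1 S) (phi1 S)
     else if q = (0,2,0) then (1/2) *s Qhat S (phi2 S) (phi2 S)
     else if q = (0,0,2) then (1/2) *s Qhat S (phi2c S) (phi2c S)
     else if q = (1,1,0) then Qhat S (phi1 S) (phi2 S)
     else if q = (1,0,1) then Qhat S (phi1 S) (phi2c S)
     else Qhat S (phi2 S) (phi2c S))"

lemma half_Q_centre: "(1/2) *s Qhat S (centre z) (centre z) = (\<Sum>q\<in>quad. zmono q z *s qcoeff q)"
  by (simp add: sum_quad qcoeff_def zmono_def centre_def[abs_def] Qhat_linear cont_hist_intros cont_phi
      Qhat_sym[of "phi2 S" "phi1 S"] Qhat_sym[of "phi2c S" "phi1 S"] Qhat_sym[of "phi2c S" "phi2 S"]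
      vec_eq_iff algebra_simps power2_eq_square)

text \<open>Amplitude \<open>a\<close> for which \<open>a e\<^sup>\<zeta>\<^sup>\<theta> \<beta>\<^sub>k\<close>, with \<open>\<zeta>\<close> the frequency of the monomial, balances a forcing
  by the coefficient of that monomial in mode \<open>k\<close>.\<close>

definition amp :: "nat \<Rightarrow> nat \<times> nat \<times> nat \<Rightarrow> complex ^ 'm" where
  "amp k q = matrix_inv (char_matrix S k 0 (freq q)) *v qcoeff q"

lemma noncritical: "0 \<noteq> kk" "2 * kk \<noteq> kk"
  using nonzero_mode by simp_all

lemma Re_freq: "Re (freq q) = 0"
  by (cases q) (simp add: freq_def)

lemma amp_eq: "k \<noteq> kk \<Longrightarrow> char_matrix S k 0 (freq q) *v x = qcoeff q \<longleftrightarrow> x = amp k q"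
  unfolding amp_def by (rule matrix_solve[OF char_matrix_invertible[OF _ Re_freq]])

text \<open>Conjugation exchanges \<open>z\<^sub>2\<close> and \<open>z\<^sub>3\<close>, hence the last two exponents.\<close>

definition swap23 :: "nat \<times> nat \<times> nat \<Rightarrow> nat \<times> nat \<times> nat" where
  "swap23 q = (case q of (a, b, c) \<Rightarrow> (a, c, b))"

lemma amp_swap23:
  assumes "q \<in> quad" "k \<noteq> kk"
  shows "amp k (swap23 q) = vcnj (amp k q)"
proof -
  have "freq (swap23 q) = cnj (freq q)"
    by (cases q) (simp add: freq_def swap23_def algebra_simps)
  moreover have "qcoeff (swap23 q) = vcnj (qcoeff q)"
    using assms(1) Qhat_cnj[OF cont_phi(1) cont_phi(1)] Qhat_cnj[OF cont_phi(1) cont_phi(2)]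
      Qhat_cnj[OF cont_phi(1) cont_phi(3)] Qhat_cnj[OF cont_phi(2) cont_phi(2)]
      Qhat_cnj[OF cont_phi(3) cont_phi(3)] Qhat_cnj[OF cont_phi(2) cont_phi(3)]
    by (auto simp: quad_def qcoeff_def swap23_def cnj_phi Qhat_sym[of "phi2c S" "phi2 S"])
  moreover have "char_matrix S k 0 (freq q) *v amp k q = qcoeff q"
    using amp_eq[OF assms(2)] by blast
  ultimately have "char_matrix S k 0 (freq (swap23 q)) *v vcnj (amp k q) = qcoeff (swap23 q)"
    by (simp add: char_matrix_cnj)
  then show ?thesis
    using amp_eq[OF assms(2)] by simp
qed

text \<open>The amplitudes of the explicit solution in the modes \<open>0\<close> and \<open>2k\<close>, which receive the forcing with
  the weights \<open>1\<close> and \<open>1/\<surd>2\<close> of \<open>\<beta>\<^sub>k\<^sup>2\<close>.\<close>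

definition amp0 :: "nat \<times> nat \<times> nat \<Rightarrow> complex ^ 'm" where
  "amp0 q = amp 0 q"

definition amp2 :: "nat \<times> nat \<times> nat \<Rightarrow> complex ^ 'm" where
  "amp2 q = of_real (1 / sqrt 2) *s amp (2 * kk) q"

definition hsol :: "nat \<times> nat \<times> nat \<Rightarrow> ('x, 'm) history" where
  "hsol q = tens S (expo (freq q) (amp0 q)) (beta S 0) + tens S (expo (freq q) (amp2 q)) (beta S (2 * kk))"

definition profile :: "(nat \<times> nat \<times> nat \<Rightarrow> complex) \<Rightarrow> (nat \<times> nat \<times> nat \<Rightarrow> complex ^ 'm) \<Rightarrow> real \<Rightarrow> complex ^ 'm" where
  "profile w b \<theta> = (\<Sum>q\<in>quad. w q *s expo (freq q) (b q) \<theta>)"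

lemma cont_profile: "cont_hist S (profile w b)"
  unfolding profile_def[abs_def] by (intro cont_hist_sum cont_hist_intros cont_hist_expo)

lemma profile_derivative:
  "(profile w b has_vector_derivative profile (\<lambda>q. freq q * w q) b \<theta>) (at \<theta> within A)"
proof -
  have "((\<lambda>\<theta>. w q *s expo (freq q) (b q) \<theta>) has_vector_derivative w q *s (freq q *s expo (freq q) (b q) \<theta>))
      (at \<theta> within A)" for q
    by (rule bounded_linear.has_vector_derivative[OF bounded_linear_smult_vec(1) expo_has_vector_derivative])
  then show ?thesis
    unfolding profile_def[abs_def]
    by (intro has_vector_derivative_eq_rhs[OF has_vector_derivative_sum])
       (simp_all add: mult.commute vector_smult_assoc)
qed

lemma sum_hsol: "(\<Sum>q\<in>quad. hscale S (w q) (hsol q)) =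
    tens S (profile w amp0) (beta S 0) + tens S (profile w amp2) (beta S (2 * kk))"
  unfolding profile_def[abs_def] hsol_def
  by (simp add: tens_sum cont_hist_intros cont_hist_expo hscale_add_right hscale_tens sum.distrib)

lemma mode_rhs_profile:
  assumes "\<And>q. char_matrix S k 0 (freq q) *v b q = c *s qcoeff q"
  shows "mode_rhs S k (profile w b) = profile (\<lambda>q. freq q * w q) b 0 - c *s (\<Sum>q\<in>quad. w q *s qcoeff q)"
proof -
  have e: "mode_rhs S k (expo (freq q) (b q)) = freq q *s b q - c *s qcoeff q" for q
    using char_matrix_vec[of k "freq q" "b q"] assms[of q] by simp
  have p: "mode_rhs S k (profile w b) = (\<Sum>q\<in>quad. w q *s mode_rhs S k (expo (freq q) (b q)))"
    unfolding profile_def[abs_def] by (rule mode_rhs_sum) (simp_all add: cont_hist_expo)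
  show ?thesis
    unfolding p e by (simp add: profile_def expo_def vec_eq_iff sum_subtractf sum_distrib_left algebra_simps)
qed

lemma modes_derivative:
  assumes "\<And>\<theta>. (\<alpha> has_vector_derivative \<alpha>' \<theta>) (at \<theta> within {- delay S..0})"
    and "\<And>\<theta>. (\<gamma> has_vector_derivative \<gamma>' \<theta>) (at \<theta> within {- delay S..0})"
    and "\<theta> \<in> {- delay S..0}"
  shows "(apply_bcontfun (tens S \<alpha> b + tens S \<gamma> b') has_vector_derivative vtens S (\<alpha>' \<theta>) b + vtens S (\<gamma>' \<theta>) b')
    (at \<theta> within {- delay S..0})"
proof -
  have cont: "cont_hist S \<alpha>" "cont_hist S \<gamma>"
    unfolding cont_hist_def using assms(1,2)
    by (meson continuous_on_eq_continuous_within has_vector_derivative_continuous)+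
  show ?thesis
  proof (rule has_vector_derivative_transform[OF assms(3)])
    show "((\<lambda>\<theta>. vtens S (\<alpha> \<theta>) b + vtens S (\<gamma> \<theta>) b') has_vector_derivative vtens S (\<alpha>' \<theta>) b + vtens S (\<gamma>' \<theta>) b')
        (at \<theta> within {- delay S..0})"
      by (intro has_vector_derivative_add bounded_linear.has_vector_derivative[OF bounded_linear_vtens] assms)
  qed (simp add: apply_tens cont cl_id)
qed

lemma diag_lap_modes:
  "diag_app d (lap S (vtens S x (beta S j) + vtens S y (beta S k))) =
     vtens S (- (mu S j *\<^sub>R (cdiag d *v x))) (beta S j) + vtens S (- (mu S k *\<^sub>R (cdiag d *v y))) (beta S k)"
proof -
  have "diag_app d (vtens S x b + vtens S y b') = vtens S (cdiag d *v x) b + vtens S (cdiag d *v y) b'" for x y b b'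
    by (simp add: vec_eq_iff diag_app_def cdiag_def matrix_vector_mult_def scaleR_add_right scaleR_cscale
        scaleR_conv_of_real if_distribR if_distrib[of "\<lambda>x. x * _"] cong: if_cong)
  moreover have "cdiag d *v (- (r *\<^sub>R x)) = - (r *\<^sub>R (cdiag d *v x))" for r and x :: "complex ^ 'm"
    by (simp add: vec_eq_iff matrix_vector_mult_def sum_negf scaleR_sum_right)
  ultimately show ?thesis
    by (simp only: lap_modes)
qed

text \<open>At \<open>\<theta> = 0\<close> the derivative terms of \<open>A\<^sub>1\<close> cancel; what remains is the right-hand side of the delay
  equation of each mode, because \<open>L\<^sub>0\<close> and the Laplacian do not mix modes.\<close>

lemma A1_modes:
  assumes "\<And>\<theta>. (\<alpha> has_vector_derivative \<alpha>' \<theta>) (at \<theta> within {- delay S..0})"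
    and "\<And>\<theta>. (\<gamma> has_vector_derivative \<gamma>' \<theta>) (at \<theta> within {- delay S..0})"
    and \<theta>: "\<theta> \<in> {- delay S..0}"
  shows "A1 S (tens S \<alpha> (beta S j) + tens S \<gamma> (beta S k)) \<theta> =
    (if \<theta> = 0 then vtens S (mode_rhs S j \<alpha>) (beta S j) + vtens S (mode_rhs S k \<gamma>) (beta S k)
     else vtens S (\<alpha>' \<theta>) (beta S j) + vtens S (\<gamma>' \<theta>) (beta S k))"
proof -
  let ?u = "tens S \<alpha> (beta S j) + tens S \<gamma> (beta S k)"
  have cont: "cont_hist S \<alpha>" "cont_hist S \<gamma>"
    unfolding cont_hist_def using assms(1,2)
    by (meson continuous_on_eq_continuous_within has_vector_derivative_continuous)+
  have d: "hderiv S ?u \<theta> = vtens S (\<alpha>' \<theta>) (beta S j) + vtens S (\<gamma>' \<theta>) (beta S k)"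
    unfolding hderiv_def
    using vector_derivative_within_cbox[OF _ _ modes_derivative[OF assms(1,2) \<theta>, unfolded cbox_interval[symmetric]]]
      delay_pos \<theta> by (simp add: cbox_interval)
  have "cl 0 = 0"
    using delay_pos by (intro cl_id) simp
  then have "apply_bcontfun ?u 0 = vtens S (\<alpha> 0) (beta S j) + vtens S (\<gamma> 0) (beta S k)"
    by (simp add: apply_tens cont)
  then have lap: "diag_app (diffus S 0) (lap S (apply_bcontfun ?u 0)) =
      vtens S (- (mu S j *\<^sub>R (cdiag (diffus S 0) *v \<alpha> 0))) (beta S j) +
      vtens S (- (mu S k *\<^sub>R (cdiag (diffus S 0) *v \<gamma> 0))) (beta S k)"
    by (simp only: diag_lap_modes)
  have "blinfun_apply (Lop S 0) ?u = vtens S (hat1 S (Lop S 0) \<alpha>) (beta S j) + vtens S (hat1 S (Lop S 0) \<gamma>) (beta S k)"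
    by (simp add: blinfun.add_right L0(1) cont)
  with lap have "blinfun_apply (Lop S 0) ?u + diag_app (diffus S 0) (lap S (apply_bcontfun ?u 0)) =
      vtens S (mode_rhs S j \<alpha>) (beta S j) + vtens S (mode_rhs S k \<gamma>) (beta S k)"
    by (simp only: mode_rhs_def vtens_add add_ac)
  with d show ?thesis
    by (cases "\<theta> = 0") (simp_all add: A1_def X0_def)
qed

lemma hsol_in_Q1: "hsol q \<in> Q1 S"
proof -
  have cont: "cont_hist S (expo (freq q) (amp0 q))" "cont_hist S (expo (freq q) (amp2 q))"
    by (rule cont_hist_expo)+
  have ap: "apply_bcontfun (hsol q) \<theta> =
      vtens S (expo (freq q) (amp0 q) (cl \<theta>)) (beta S 0) + vtens S (expo (freq q) (amp2 q) (cl \<theta>)) (beta S (2 * kk))" for \<theta>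
    by (simp add: hsol_def apply_tens cont)
  have "hsol q \<in> hist_space S"
    unfolding hsol_def by (intro hist_space_add tens_in_hist_space cont)
  moreover have "(apply_bcontfun (hsol q) has_vector_derivative
        (\<lambda>\<theta>. vtens S (freq q *s expo (freq q) (amp0 q) \<theta>) (beta S 0) +
          vtens S (freq q *s expo (freq q) (amp2 q) \<theta>) (beta S (2 * kk))) \<theta>) (at \<theta> within {- delay S..0})"
    if "\<theta> \<in> {- delay S..0}" for \<theta>
    unfolding hsol_def using that by (intro modes_derivative expo_has_vector_derivative)
  moreover have "cont_hist S (\<lambda>\<theta>. vtens S (freq q *s expo (freq q) (amp0 q) \<theta>) (beta S 0) +
          vtens S (freq q *s expo (freq q) (amp2 q) \<theta>) (beta S (2 * kk)))"
    using cont_hist_smult[OF cont_hist_const cont(1), of "freq q"] cont_hist_smult[OF cont_hist_const cont(2), of "freq q"]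
    unfolding cont_hist_def by (intro continuous_on_add bounded_linear.continuous_on[OF bounded_linear_vtens])
  moreover have "apply_bcontfun (hsol q) 0 \<in> dom_lap S"
    unfolding ap by (rule lap_modes)
  moreover have "spec_proj S (apply_bcontfun (hsol q)) \<theta> = 0" for \<theta>
    by (rule spec_proj_zero) (use noncritical in \<open>simp add: ap mode_add mode_vtens_beta\<close>)
  ultimately show ?thesis
    unfolding Q1_def by blast
qed

lemma L1_zero: "L1 S 0 = 0"
  using linear_0[OF has_derivative_linear[OF Lop_has_derivative]] by (simp add: L1_def)

lemma diffus_has_derivative: "(diffus S has_derivative frechet_derivative (diffus S) (at 0)) (at 0)"
proof -
  have "diffus S differentiable at 0"
    using linear_part unfolding linear_part_def by (elim conjE)
  then show ?thesis
    using frechet_derivative_works by blast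
qed

lemma F2_zero: "F2 S v 0 = Qop S v v"
proof -
  have "d1 S 0 = 0"
    using linear_0[OF has_derivative_linear[OF diffus_has_derivative]] by (simp add: d1_def)
  then show ?thesis
    by (simp add: F2_def L1_zero diag_app_def vec_eq_iff)
qed

lemma f22_zero: "f22 S z 0 0 \<theta> = X0 (Qop S (wmap S z) (wmap S z)) \<theta>"
proof -
  have "spec_proj S (X0 (Qop S (wmap S z) (wmap S z))) \<theta> = 0"
    by (rule spec_proj_zero) (use noncritical in \<open>simp add: X0_def Q_wmap mode_add mode_vtens_beta\<close>)
  then show ?thesis
    by (simp add: f22_def F2_zero)
qed

text \<open>For \<open>\<theta> < 0\<close> both sides vanish, since each profile is exponential with the frequency of its
  monomial.  At \<open>\<theta> = 0\<close> the equation is the linear system that defines the amplitudes.\<close>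

lemma solves_hsol: "solves_h S hsol"
  unfolding solves_h_def
proof (intro conjI ballI allI hsol_in_Q1)
  fix z :: "complex ^ 3" and \<theta> assume \<theta>: "\<theta> \<in> {- delay S..0}"
  let ?w = "\<lambda>q. zmono q z" and ?w' = "\<lambda>q. freq q * zmono q z"
  have h: "hpoly S hsol z = tens S (profile ?w amp0) (beta S 0) + tens S (profile ?w amp2) (beta S (2 * kk))"
    unfolding hpoly_def by (rule sum_hsol)
  obtain D where D: "\<And>q. (zmono q has_derivative D q) (at z)" "\<And>q. D q (Bmap S z) = ?w' q"
    using zmono_derivative[of _ z] by metis
  have "(hpoly S hsol has_derivative (\<lambda>v. \<Sum>q\<in>quad. hscale S (D q v) (hsol q))) (at z)"
    unfolding hpoly_def[abs_def]
    by (intro has_derivative_sum bounded_linear.has_derivative[OF bounded_linear_hscale_left] D)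
  then have "frechet_derivative (hpoly S hsol) (at z) (Bmap S z) =
      tens S (profile ?w' amp0) (beta S 0) + tens S (profile ?w' amp2) (beta S (2 * kk))"
    using D(2) by (simp add: frechet_derivative_at[symmetric] sum_hsol)
  then have lhs: "apply_bcontfun (frechet_derivative (hpoly S hsol) (at z) (Bmap S z)) \<theta> =
      vtens S (profile ?w' amp0 \<theta>) (beta S 0) + vtens S (profile ?w' amp2 \<theta>) (beta S (2 * kk))"
    by (simp add: apply_tens cont_profile cl_id[OF \<theta>])
  have A: "A1 S (hpoly S hsol z) \<theta> =
    (if \<theta> = 0 then vtens S (mode_rhs S 0 (profile ?w amp0)) (beta S 0) + vtens S (mode_rhs S (2 * kk) (profile ?w amp2)) (beta S (2 * kk))
     else vtens S (profile ?w' amp0 \<theta>) (beta S 0) + vtens S (profile ?w' amp2 \<theta>) (beta S (2 * kk)))"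
    unfolding h by (rule A1_modes[OF profile_derivative profile_derivative \<theta>])
  have r0: "mode_rhs S 0 (profile ?w amp0) = profile ?w' amp0 0 - 1 *s (\<Sum>q\<in>quad. ?w q *s qcoeff q)"
    using amp_eq[OF noncritical(1)] by (intro mode_rhs_profile) (simp add: amp0_def)
  have r2: "mode_rhs S (2 * kk) (profile ?w amp2) = profile ?w' amp2 0 - of_real (1 / sqrt 2) *s (\<Sum>q\<in>quad. ?w q *s qcoeff q)"
    using amp_eq[OF noncritical(2)] by (intro mode_rhs_profile) (simp add: amp2_def vector_scalar_commute)
  let ?Q = "Qhat S (centre z) (centre z)"
  have half: "(1/2) *\<^sub>R vtens S x b = vtens S ((1/2) *s x) b" for x b
    using vtens_scaleR[of "1/2" x b] by (simp add: scaleR_eq_smult)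
  have rhs: "(1/2) *\<^sub>R Qop S (wmap S z) (wmap S z) =
      vtens S ((1/2) *s ?Q) (beta S 0) + vtens S (of_real (1 / sqrt 2) *s ((1/2) *s ?Q)) (beta S (2 * kk))"
    unfolding Q_wmap scaleR_add_right half by (simp add: mult.commute)
  show "apply_bcontfun (frechet_derivative (hpoly S hsol) (at z) (Bmap S z)) \<theta> - A1 S (hpoly S hsol z) \<theta> =
      (1/2) *\<^sub>R f22 S z 0 0 \<theta>"
  proof (cases "\<theta> = 0")
    case True
    then have "(1/2) *\<^sub>R f22 S z 0 0 \<theta> = (1/2) *\<^sub>R Qop S (wmap S z) (wmap S z)"
      by (simp add: f22_zero X0_def)
    also have "\<dots> = vtens S (\<Sum>q\<in>quad. ?w q *s qcoeff q) (beta S 0) +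
        vtens S (of_real (1 / sqrt 2) *s (\<Sum>q\<in>quad. ?w q *s qcoeff q)) (beta S (2 * kk))"
      unfolding rhs half_Q_centre ..
    finally show ?thesis
      unfolding lhs A using True by (simp add: r0 r2 vtens_diff)
  next
    case False
    then show ?thesis
      unfolding lhs A f22_zero by (simp add: X0_def)
  qed
qed

end

section \<open>The normal form\<close>

context hopf_steady_model
begin

definition adjoint_row :: "3 \<Rightarrow> complex ^ 'm" where
  "adjoint_row j = (if j = 1 then psi1 S 0 else if j = 2 then psi2 S 0 else psi2c S 0)"

lemma centre_part_eq: "centre_part S F = (\<chi> j. rowdot (adjoint_row j) (mode S kk F))"
  by (simp add: centre_part_def vec_eq_iff forall_3 adjoint_row_def equal_modes)

lemma bounded_linear_centre_part: "bounded_linear (centre_part S)"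
  unfolding centre_part_eq[abs_def]
  by (rule bounded_linear_vecI) (simp add: bounded_linear_compose[OF linear_rowdot bounded_linear_mode])

lemma bounded_linear_wmap: "bounded_linear (wmap S)"
proof -
  have "wmap S z = hscale S (z $ 1) (tens S (phi1 S) (beta S kk)) +
      (hscale S (z $ 2) (tens S (phi2 S) (beta S kk)) + hscale S (z $ 3) (tens S (phi2c S) (beta S kk)))" for z
    by (simp add: wmap_def equal_modes[symmetric] hscale_tens cont_phi tens_add cont_hist_intros)
  then have "wmap S = (\<lambda>z. hscale S (z $ 1) (tens S (phi1 S) (beta S kk)) +
      (hscale S (z $ 2) (tens S (phi2 S) (beta S kk)) + hscale S (z $ 3) (tens S (phi2c S) (beta S kk))))"
    by blast
  then show ?thesis
    by (simp only:) (intro bounded_linear_add bounded_linear_compose[OF bounded_linear_hscale_left] bounded_linear_vec_nth)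
qed

text \<open>\<open>\<beta>\<^sub>k\<^sup>2\<close> lives in the modes \<open>0\<close> and \<open>2k\<close>, both different from \<open>k\<close>.\<close>

lemma centre_Q_zero: "centre_part S (Qop S (wmap S z) (wmap S z')) = 0"
  using noncritical by (simp add: centre_part_eq Q_wmap mode_add mode_vtens_beta vec_eq_iff)

text \<open>Half its pairing with an adjoint eigenvector gives the coefficients \<open>a\<^sub>1(\<alpha>)\<close> and \<open>b\<^sub>2(\<alpha>)\<close>.\<close>

definition lin :: "real \<times> real \<Rightarrow> (real \<Rightarrow> complex ^ 'm) \<Rightarrow> complex ^ 'm" where
  "lin \<alpha> \<phi> = hat1 S (L1 S \<alpha>) \<phi> - mu S kk *\<^sub>R (cdiag (d1 S \<alpha>) *v \<phi> 0)"

lemmas L1_op = pointwise_opD[OF pointwise_op_L1]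

lemma f21_center: "f21 S z 0 \<alpha> = (\<chi> j. rowdot (adjoint_row j) (lin \<alpha> (centre z)))"
proof -
  have c0: "cl 0 = 0"
    using delay_pos by (intro cl_id) simp
  have "diag_app (d1 S \<alpha>) (lap S (apply_bcontfun (wmap S z) 0)) =
      vtens S (- (mu S kk *\<^sub>R (cdiag (d1 S \<alpha>) *v centre z 0))) (beta S kk)"
    using diag_lap_modes[of "d1 S \<alpha>" "centre z 0" kk 0 kk] by (simp add: wmap_centre apply_tens cont_centre c0)
  then have "mode S kk (F2 S (wmap S z) \<alpha>) = lin \<alpha> (centre z) + mode S kk (Qop S (wmap S z) (wmap S z))"
    by (simp add: F2_def wmap_centre L1_op(1) cont_centre mode_add mode_vtens_beta lin_def)
  moreover have "mode S kk (Qop S (wmap S z) (wmap S z)) = 0"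
    using noncritical by (simp add: Q_wmap mode_add mode_vtens_beta)
  ultimately show ?thesis
    by (simp add: f21_def centre_part_eq)
qed

lemma lin_add: "cont_hist S \<phi> \<Longrightarrow> cont_hist S \<psi> \<Longrightarrow> lin \<alpha> (\<lambda>\<theta>. \<phi> \<theta> + \<psi> \<theta>) = lin \<alpha> \<phi> + lin \<alpha> \<psi>"
  by (simp add: lin_def hat1_add matrix_vector_right_distrib scaleR_add_right)

lemma lin_scale: "cont_hist S \<phi> \<Longrightarrow> lin \<alpha> (\<lambda>\<theta>. c *s \<phi> \<theta>) = c *s lin \<alpha> \<phi>"
  by (simp add: lin_def L1_op vector_scalar_commute vec_eq_iff algebra_simps)

lemma lin_cnj:
  assumes "cont_hist S \<phi>"
  shows "lin \<alpha> (\<lambda>\<theta>. vcnj (\<phi> \<theta>)) = vcnj (lin \<alpha> \<phi>)"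
proof -
  have "vcnj (cdiag d *v x) = cdiag d *v vcnj x" for d and x :: "complex ^ 'm"
    by (auto simp: vec_eq_iff matrix_vector_mult_def cdiag_def cnj_sum intro!: sum.cong)
  moreover have "vcnj (r *\<^sub>R x) = r *\<^sub>R vcnj x" for r and x :: "complex ^ 'm"
    by (simp add: vec_eq_iff)
  ultimately show ?thesis
    by (simp add: lin_def L1_op(3) assms)
qed

lemma lin_param: "lin \<alpha> \<phi> = of_real (fst \<alpha>) *s lin (1, 0) \<phi> + of_real (snd \<alpha>) *s lin (0, 1) \<phi>"
proof -
  have \<alpha>: "\<alpha> = fst \<alpha> *\<^sub>R (1, 0) + snd \<alpha> *\<^sub>R (0, 1)"
    by (cases \<alpha>) simp
  have L: "L1 S \<alpha> = fst \<alpha> *\<^sub>R L1 S (1, 0) + snd \<alpha> *\<^sub>R L1 S (0, 1)"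
    unfolding L1_def using has_derivative_linear[OF Lop_has_derivative]
    by (subst \<alpha>) (simp only: linear_add linear_scale scaleR_add_right scaleR_left_commute)
  have D: "d1 S \<alpha> = fst \<alpha> *\<^sub>R d1 S (1, 0) + snd \<alpha> *\<^sub>R d1 S (0, 1)"
    unfolding d1_def using has_derivative_linear[OF diffus_has_derivative]
    by (subst \<alpha>) (simp only: linear_add linear_scale scaleR_add_right scaleR_left_commute)
  have "cdiag (a *\<^sub>R d + b *\<^sub>R d') *v x = a *\<^sub>R (cdiag d *v x) + b *\<^sub>R (cdiag d' *v x)" for a b d d' and x :: "complex ^ 'm"
  proof -
    have c: "(cdiag d *v x) $ i = of_real (d $ i) * x $ i" for d i
      by (simp add: matrix_vector_mult_def cdiag_def if_distrib[of "\<lambda>y. y * _"] cong: if_cong)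
    then show ?thesis
      by (simp only: vec_eq_iff vector_add_component vector_scaleR_component c)
         (simp add: scaleR_conv_of_real algebra_simps)
  qed
  moreover have "hat1 S (L1 S \<alpha>) \<phi> = fst \<alpha> *\<^sub>R hat1 S (L1 S (1, 0)) \<phi> + snd \<alpha> *\<^sub>R hat1 S (L1 S (0, 1)) \<phi>"
  proof -
    interpret H: bounded_linear "\<lambda>T. hat1 S (blinfun_apply T) \<phi>" by (rule bounded_linear_hat1)
    show ?thesis
      unfolding L by (simp only: H.add H.scaleR)
  qed
  ultimately have "lin \<alpha> \<phi> = fst \<alpha> *\<^sub>R lin (1, 0) \<phi> + snd \<alpha> *\<^sub>R lin (0, 1) \<phi>"
    by (simp add: lin_def D algebra_simps)
  then show ?thesis by (simp add: scaleR_eq_smult)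
qed

lemma a1_eq: "a1 S \<alpha> = (1/2) * rowdot (adjoint_row 1) (lin \<alpha> (phi1 S))"
  by (simp add: a1_def lin_def adjoint_row_def)

lemma b2_eq: "b2 S \<alpha> = (1/2) * rowdot (adjoint_row 2) (lin \<alpha> (phi2 S))"
  by (simp add: b2_def lin_def adjoint_row_def equal_modes)

lemma adjoint_row_cnj: "vcnj (adjoint_row 1) = adjoint_row 1" "vcnj (adjoint_row 2) = adjoint_row 3"
proof -
  have "\<forall>i. psi10 S $ i \<in> \<real>"
    using bases unfolding bases_def by blast
  then show "vcnj (adjoint_row 1) = adjoint_row 1"
    by (simp add: adjoint_row_def psi1_def vec_eq_iff Reals_cnj_iff)
  show "vcnj (adjoint_row 2) = adjoint_row 3"
    by (simp add: adjoint_row_def psi2c_def)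
qed

lemma b2_cnj: "cnj (b2 S \<alpha>) = (1/2) * rowdot (adjoint_row 3) (lin \<alpha> (phi2c S))"
  using lin_cnj[OF cont_phi(2), of \<alpha>] rowdot_cnj[of "adjoint_row 2" "lin \<alpha> (phi2 S)"]
  by (simp add: b2_eq cnj_phi adjoint_row_cnj)

lemma lin_centre:
  "lin \<alpha> (centre z) = z $ 1 *s lin \<alpha> (phi1 S) + (z $ 2 *s lin \<alpha> (phi2 S) + z $ 3 *s lin \<alpha> (phi2c S))"
  unfolding centre_def[abs_def] by (simp add: lin_add lin_scale cont_hist_intros cont_phi)

text \<open>Exponents \<open>(q, (d, e))\<close> of the quadratic monomials \<open>z\<^sub>i\<alpha>\<^sub>j\<close>, and of the resonant ones in \<open>z\<close> alone,
  whose coefficients vanish because a product of two critical modes has no critical component.  A monomial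
  linear in the parameters picks out \<^term>\<open>lin\<close> at a unit vector of the parameter plane.\<close>

definition expts2 :: "((nat \<times> nat \<times> nat) \<times> (nat \<times> nat)) set" where
  "expts2 = {((1,0,0),(1,0)), ((1,0,0),(0,1)), ((0,1,0),(1,0)), ((0,1,0),(0,1)), ((0,0,1),(1,0)), ((0,0,1),(0,1)),
     ((2,0,0),(0,0)), ((0,1,1),(0,0)), ((1,1,0),(0,0)), ((1,0,1),(0,0))}"

definition coeff2 :: "(nat \<times> nat \<times> nat) \<times> (nat \<times> nat) \<Rightarrow> 3 \<Rightarrow> complex" where
  "coeff2 n j = (case n of (q, (d, e)) \<Rightarrow> if (d, e) = (0, 0) then 0 else rowdot (adjoint_row j)
     (lin (real d, real e) (if q = (1,0,0) then phi1 S else if q = (0,1,0) then phi2 S else phi2c S)))"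

lemma g21_eq: "g21 S z \<alpha> = vector [2 * a1 S \<alpha> * z $ 1, 2 * b2 S \<alpha> * z $ 2, 2 * cnj (b2 S \<alpha>) * z $ 3]"
proof -
  have "g21 S z \<alpha> = (\<Sum>n\<in>compl2. coeff2 (fst n) (snd n) *s vmono n z \<alpha>)"
    unfolding g21_def
  proof (rule Proj_components)
    show "finite expts2" by (simp add: expts2_def)
    show "expts2 \<times> UNIV \<subseteq> monoms 2"
      by (auto simp: expts2_def monoms_def)
    show "compl2 \<subseteq> expts2 \<times> UNIV"
      by (simp add: expts2_def compl2_def)
    fix z \<alpha>
    show "f21 S z 0 \<alpha> = (\<chi> j. \<Sum>(q, d, e)\<in>expts2. coeff2 (q, d, e) j * (zmono q z * of_real (fst \<alpha> ^ d * snd \<alpha> ^ e)))"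
      unfolding f21_center lin_centre
      by (subst (1 2 3) lin_param)
         (simp add: expts2_def coeff2_def zmono_def rowdot_add rowdot_smult vec_eq_iff algebra_simps)
  qed
  also have "\<dots> = vector [2 * a1 S \<alpha> * z $ 1, 2 * b2 S \<alpha> * z $ 2, 2 * cnj (b2 S \<alpha>) * z $ 3]"
    unfolding a1_eq b2_cnj unfolding b2_eq
    by (subst (1 2 3) lin_param)
       (simp add: vec_eq_iff forall_3 compl2_def coeff2_def vmono_def zmono_def axis_def rowdot_add rowdot_smult algebra_simps)
  finally show ?thesis .
qed

lemma g21_zero: "g21 S z 0 = 0"
proof -
  have "lin 0 \<phi> = 0" for \<phi>
    using lin_param[of 0 \<phi>] by simp
  then have "a1 S 0 = 0" "b2 S 0 = 0"
    by (simp_all add: a1_eq b2_eq)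
  then show ?thesis
    by (simp add: g21_eq vec_eq_iff forall_3)
qed

lemma f21_derivative:
  "frechet_derivative (\<lambda>(z, y). f21 S z y 0) (at (z, 0)) (u, y) =
    centre_part S (Qop S (wmap S z) (wmap S u + y) + Qop S (wmap S u + y) (wmap S z))"
proof -
  define W where "W p = wmap S (fst p) + snd p" for p
  have W: "bounded_linear W"
    unfolding W_def[abs_def]
    by (intro bounded_linear_add bounded_linear_compose[OF bounded_linear_wmap] bounded_linear_fst bounded_linear_snd)
  have eq: "(\<lambda>(z, y). f21 S z y 0) = (\<lambda>p. centre_part S (Qop S (W p) (W p)))"
    by (auto simp: W_def f21_def F2_zero)
  have "((\<lambda>p. centre_part S (Qop S (W p) (W p))) has_derivative
      (\<lambda>q. centre_part S (Qop S (W (z, 0)) (W q) + Qop S (W q) (W (z, 0))))) (at (z, 0))"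
    by (intro bounded_linear.has_derivative[OF bounded_linear_centre_part] bounded_bilinear.FDERIV[OF Q_bilinear]
        bounded_linear_imp_has_derivative W)
  then have "frechet_derivative (\<lambda>(z, y). f21 S z y 0) (at (z, 0)) =
      (\<lambda>q. centre_part S (Qop S (W (z, 0)) (W q) + Qop S (W q) (W (z, 0))))"
    unfolding eq by (rule frechet_derivative_at[symmetric])
  then show ?thesis
    by (simp add: W_def)
qed

text \<open>The derivative of \<open>U\<close> is applied to \<open>g\<^sub>2\<^sup>1 = 0\<close>; to conclude that the result is zero it has to be an
  actual derivative, hence linear.\<close>

lemma U21_differentiable:
  assumes "is_U21 S U"
  shows "U differentiable (at z)"
proof -
  obtain c where c: "\<forall>z. U z = (\<Sum>n\<in>{n \<in> monoms 2 - compl2. snd (fst n) = (0, 0)}. c n *s vmono n z 0)"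
    using assms unfolding is_U21_def by blast
  have "(\<lambda>z. vmono n z 0) differentiable (at z)" for n
  proof -
    obtain q d e j where n: "n = ((q, (d, e)), j)" by (metis surj_pair)
    obtain D where "(zmono q has_derivative D) (at z)"
      using zmono_derivative by blast
    then have "(zmono q) differentiable (at z)"
      by (rule differentiableI)
    then have "(\<lambda>z. zmono q z * of_real (0 ^ d * 0 ^ e)) differentiable (at z)"
      by (intro differentiable_mult differentiable_const)
    moreover have "bounded_linear (\<lambda>x :: complex. axis j x)"
    proof (rule bounded_linear_vecI)
      show "bounded_linear (\<lambda>x :: complex. axis j x $ i)" for i
        by (cases "i = j") (simp_all add: axis_def bounded_linear_ident bounded_linear_zero)
    qed
    ultimately have "(\<lambda>z. axis j (zmono q z * of_real (0 ^ d * 0 ^ e))) differentiable (at z)"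
      unfolding differentiable_def using bounded_linear.has_derivative by blast
    then show ?thesis
      by (simp add: n vmono_def)
  qed
  then have "(\<lambda>z. c n *s vmono n z 0) differentiable (at z)" for n
    unfolding differentiable_def using bounded_linear.has_derivative[OF bounded_linear_smult_vec(1)] by blast
  then have "(\<lambda>z. \<Sum>n\<in>{n \<in> monoms 2 - compl2. snd (fst n) = (0, 0)}. c n *s vmono n z 0) differentiable (at z)"
    using finite_monoms by (intro differentiable_sum) auto
  moreover have "U = (\<lambda>z. \<Sum>n\<in>{n \<in> monoms 2 - compl2. snd (fst n) = (0, 0)}. c n *s vmono n z 0)"
    using c by blast
  ultimately show ?thesis by simp
qed


text \<open>The combination of the two modes of \<open>h\<close> that acts on the critical mode, with weights
  \<open>\<langle>\<beta>\<^sub>0 \<beta>\<^sub>k, \<beta>\<^sub>k\<rangle>\<close> and \<open>\<langle>\<beta>\<^sub>2\<^sub>k \<beta>\<^sub>k, \<beta>\<^sub>k\<rangle>\<close>.\<close>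

definition combined :: "nat \<times> nat \<times> nat \<Rightarrow> real \<Rightarrow> complex ^ 'm" where
  "combined q \<theta> = expo (freq q) (amp0 q) \<theta> + of_real (1 / sqrt 2) *s expo (freq q) (amp2 q) \<theta>"

lemma cont_combined: "cont_hist S (combined q)"
  unfolding combined_def[abs_def] by (intro cont_hist_intros cont_hist_expo)

lemma combined_cnj:
  assumes "q \<in> quad"
  shows "(\<lambda>\<theta>. vcnj (combined q \<theta>)) = combined (swap23 q)"
proof
  fix \<theta>
  have "freq (swap23 q) = cnj (freq q)"
    by (cases q) (simp add: freq_def swap23_def algebra_simps)
  then have "expo (freq (swap23 q)) (vcnj a) \<theta> = vcnj (expo (freq q) a \<theta>)" for a :: "complex ^ 'm"
    by (simp add: expo_def exp_cnj)
  moreover have "amp0 (swap23 q) = vcnj (amp0 q)" "amp2 (swap23 q) = vcnj (amp2 q)"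
    using amp_swap23[OF assms noncritical(1)] amp_swap23[OF assms noncritical(2)] by (simp_all add: amp0_def amp2_def)
  ultimately show "vcnj (combined q \<theta>) = combined (swap23 q) \<theta>"
    by (simp add: combined_def)
qed

lemma hmode_hsol:
  assumes "h q = hsol q" "\<theta> \<in> {- delay S..0}"
  shows "hmode S h q 0 \<theta> = expo (freq q) (amp0 q) \<theta>"
    and "hmode S h q (2 * kk) \<theta> = expo (freq q) (amp2 q) \<theta>"
  using nonzero_mode
  by (simp_all add: hmode_def assms hsol_def apply_tens cont_hist_expo cl_id[OF assms(2)] mode_add mode_vtens_beta)

lemma Qhat_hcomb:
  assumes "h q = hsol q"
  shows "Qhat S \<phi> (hcomb S h q) = Qhat S \<phi> (combined q)"
proof -
  have "tens S (hcomb S h q) (beta S 0) = tens S (combined q) (beta S 0)"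
    by (rule tens_cong) (simp add: hcomb_def combined_def hmode_hsol assms)
  then show ?thesis
    by (simp add: Qhat_def)
qed

lemma Qhat_sum_right:
  assumes "finite A" "\<And>i. i \<in> A \<Longrightarrow> cont_hist S (f i)"
  shows "Qhat S \<phi> (\<lambda>\<theta>. \<Sum>i\<in>A. f i \<theta>) = (\<Sum>i\<in>A. Qhat S \<phi> (f i))"
  using assms
proof (induction A rule: finite_induct)
  case empty
  show ?case
    using bounded_bilinear.zero_right[OF Q_bilinear] by (simp add: Qhat_def tens_zero)
qed (simp add: Qhat_add_right cont_hist_sum)

lemma mode_Q_hpoly:
  assumes "\<And>q. q \<in> quad \<Longrightarrow> h q = hsol q"
  shows "mode S kk (Qop S (wmap S z) (hpoly S h z)) = (\<Sum>q\<in>quad. zmono q z *s Qhat S (centre z) (combined q))"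
proof -
  let ?w = "\<lambda>q. zmono q z"
  have "hpoly S h z = tens S (profile ?w amp0) (beta S 0) + tens S (profile ?w amp2) (beta S (2 * kk))"
    unfolding hpoly_def using assms by (simp add: sum_hsol[symmetric])
  then have "mode S kk (Qop S (wmap S z) (hpoly S h z)) =
      Qhat S (centre z) (profile ?w amp0) + of_real (1 / sqrt 2) *s Qhat S (centre z) (profile ?w amp2)"
    using nonzero_mode
    by (simp add: wmap_centre bounded_bilinear.add_right[OF Q_bilinear] Q_modes cont_centre cont_profile mode_add
        mode_vtens_beta)
  also have "\<dots> = Qhat S (centre z) (\<lambda>\<theta>. profile ?w amp0 \<theta> + of_real (1 / sqrt 2) *s profile ?w amp2 \<theta>)"
    by (simp add: Qhat_linear cont_profile cont_hist_intros)
  also have "(\<lambda>\<theta>. profile ?w amp0 \<theta> + of_real (1 / sqrt 2) *s profile ?w amp2 \<theta>) =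
      (\<lambda>\<theta>. \<Sum>q\<in>quad. zmono q z *s combined q \<theta>)"
    by (rule ext) (simp add: profile_def combined_def vec_eq_iff sum_distrib_left sum.distrib algebra_simps)
  also have "Qhat S (centre z) \<dots> = (\<Sum>q\<in>quad. zmono q z *s Qhat S (centre z) (combined q))"
    by (simp add: Qhat_sum_right Qhat_scale_right cont_hist_intros cont_combined)
  finally show ?thesis .
qed

definition cubics :: "(nat \<times> nat \<times> nat) set" where
  "cubics = {(3,0,0), (0,3,0), (0,0,3), (1,1,1), (2,1,0), (2,0,1), (0,2,1), (1,2,0), (1,0,2), (0,1,2)}"

abbreviation Qh :: "(real \<Rightarrow> complex ^ 'm) \<Rightarrow> nat \<times> nat \<times> nat \<Rightarrow> complex ^ 'm" where
  "Qh \<phi> q \<equiv> Qhat S \<phi> (combined q)"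

text \<open>Coefficients of the cubic part before projection.  The factor \<open>6\<close> is \<open>3/2\<close> times the derivative
  \<open>2 Q(w,\<cdot>)\<close> in the direction \<open>2h\<close>; the factors \<open>3/2\<close>, \<open>9/2\<close> and \<open>9\<close> are \<open>\<langle>\<beta>\<^sub>k\<^sup>3, \<beta>\<^sub>k\<rangle> = 3/2\<close> times the
  multinomial coefficients \<open>1\<close>, \<open>3\<close> and \<open>6\<close>.\<close>

definition ccoeff :: "nat \<times> nat \<times> nat \<Rightarrow> complex ^ 'm" where
  "ccoeff q =
    (let f1 = phi1 S; f2 = phi2 S; f3 = phi2c S in
     if q = (3,0,0) then (3/2) *s Chat S f1 f1 f1 + 6 *s Qh f1 (2,0,0)
     else if q = (0,3,0) then (3/2) *s Chat S f2 f2 f2 + 6 *s Qh f2 (0,2,0)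
     else if q = (0,0,3) then (3/2) *s Chat S f3 f3 f3 + 6 *s Qh f3 (0,0,2)
     else if q = (1,1,1) then 9 *s Chat S f1 f2 f3 + 6 *s (Qh f1 (0,1,1) + Qh f2 (1,0,1) + Qh f3 (1,1,0))
     else if q = (2,1,0) then (9/2) *s Chat S f1 f1 f2 + 6 *s (Qh f1 (1,1,0) + Qh f2 (2,0,0))
     else if q = (2,0,1) then (9/2) *s Chat S f1 f1 f3 + 6 *s (Qh f1 (1,0,1) + Qh f3 (2,0,0))
     else if q = (0,2,1) then (9/2) *s Chat S f2 f2 f3 + 6 *s (Qh f2 (0,1,1) + Qh f3 (0,2,0))
     else if q = (1,2,0) then (9/2) *s Chat S f1 f2 f2 + 6 *s (Qh f1 (0,2,0) + Qh f2 (1,1,0))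
     else if q = (1,0,2) then (9/2) *s Chat S f1 f3 f3 + 6 *s (Qh f1 (0,0,2) + Qh f3 (1,0,1))
     else (9/2) *s Chat S f2 f3 f3 + 6 *s (Qh f3 (0,1,1) + Qh f2 (0,0,2)))"

lemma cubic_expansion:
  "(3/2) *s Chat S (centre z) (centre z) (centre z) + 6 *s (\<Sum>q\<in>quad. zmono q z *s Qhat S (centre z) (combined q)) =
    (\<Sum>q\<in>cubics. zmono q z *s ccoeff q)"
proof -
  note C_norm = Chat_sym(1)[of "phi2 S" "phi1 S"] Chat_sym(1)[of "phi2c S" "phi1 S"] Chat_sym(1)[of "phi2c S" "phi2 S"]
    Chat_sym(2)[of _ "phi2 S" "phi1 S"] Chat_sym(2)[of _ "phi2c S" "phi1 S"] Chat_sym(2)[of _ "phi2c S" "phi2 S"]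
  show ?thesis
    unfolding sum_quad
    by (simp add: cubics_def ccoeff_def Let_def zmono_def centre_def[abs_def] Chat_linear Qhat_linear cont_hist_intros
        cont_phi cont_combined C_norm vec_eq_iff algebra_simps power2_eq_square power3_eq_cube)
qed

lemma g31_eq:
  assumes U: "is_U21 S U" and h: "\<And>q. q \<in> quad \<Longrightarrow> h q = hsol q"
  shows "g31 S U h z = vector [
    rowdot (adjoint_row 1) (ccoeff (3,0,0)) * z $ 1 ^ 3 + rowdot (adjoint_row 1) (ccoeff (1,1,1)) * z $ 1 * z $ 2 * z $ 3,
    rowdot (adjoint_row 2) (ccoeff (2,1,0)) * (z $ 1)\<^sup>2 * z $ 2 + rowdot (adjoint_row 2) (ccoeff (0,2,1)) * (z $ 2)\<^sup>2 * z $ 3,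
    rowdot (adjoint_row 3) (ccoeff (2,0,1)) * (z $ 1)\<^sup>2 * z $ 3 + rowdot (adjoint_row 3) (ccoeff (0,1,2)) * z $ 2 * (z $ 3)\<^sup>2]"
proof -
  define p where "p z = f31 S z 0 + (3/2) *\<^sub>R
     (frechet_derivative (\<lambda>(z, y). f21 S z y 0) (at (z, 0)) (U z, 2 *\<^sub>R hpoly S h z)
      - frechet_derivative U (at z) (g21 S z 0))" for z
  have p: "p z = (\<chi> j. \<Sum>q\<in>cubics. zmono q z * rowdot (adjoint_row j) (ccoeff q))" for z
  proof -
    interpret cp: bounded_linear "centre_part S" by (rule bounded_linear_centre_part)
    interpret Q: bounded_bilinear "Qop S" by (rule Q_bilinear)
    have "frechet_derivative U (at z) (g21 S z 0) = 0"
      using linear_0[OF linear_frechet_derivative[OF U21_differentiable[OF U]]] by (simp add: g21_zero)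
    moreover have "frechet_derivative (\<lambda>(z, y). f21 S z y 0) (at (z, 0)) (U z, 2 *\<^sub>R hpoly S h z) =
        4 *\<^sub>R centre_part S (Qop S (wmap S z) (hpoly S h z))"
    proof -
      have "Qop S (2 *\<^sub>R hpoly S h z) (wmap S z) = Qop S (wmap S z) (2 *\<^sub>R hpoly S h z)"
        using Q_sym by blast
      then show ?thesis
        by (simp add: f21_derivative Q.add_left Q.add_right cp.add centre_Q_zero Q.scaleR_right cp.scaleR)
    qed
    moreover have "f31 S z 0 = centre_part S (Cop S (wmap S z) (wmap S z) (wmap S z))"
      by (simp add: f31_def F3_def)
    ultimately have "p z = centre_part S (Cop S (wmap S z) (wmap S z) (wmap S z) + 6 *\<^sub>R Qop S (wmap S z) (hpoly S h z))"
      by (simp add: p_def cp.add cp.scaleR)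
    moreover have "mode S kk (Cop S (wmap S z) (wmap S z) (wmap S z)) = (3/2) *s Chat S (centre z) (centre z) (centre z)"
      using nonzero_mode
      by (simp add: wmap_centre C_modes[OF cont_centre cont_centre cont_centre] mode_add mode_vtens_beta)
    moreover have "6 *\<^sub>R x = 6 *s x" for x :: "complex ^ 'm"
      by (simp add: scaleR_eq_smult)
    ultimately have "p z = (\<chi> j. rowdot (adjoint_row j) (\<Sum>q\<in>cubics. zmono q z *s ccoeff q))"
      by (simp only: centre_part_eq mode_add mode_scaleR mode_Q_hpoly[OF h] cubic_expansion)
    then show ?thesis
      by (simp add: linear_sum[OF bounded_linear.linear[OF linear_rowdot]] rowdot_smult)
  qed
  have "g31 S U h z = Proj 3 compl3 (\<lambda>z _. p z) z 0"
    by (simp add: g31_def p_def)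
  also have "\<dots> = (\<Sum>n\<in>compl3. rowdot (adjoint_row (snd n)) (ccoeff (fst (fst n))) *s vmono n z 0)"
  proof (rule Proj_components[where c = "\<lambda>n j. rowdot (adjoint_row j) (ccoeff (fst n))"])
    show "finite (cubics \<times> {(0::nat, 0::nat)})" by (simp add: cubics_def)
    show "(cubics \<times> {(0, 0)}) \<times> UNIV \<subseteq> monoms 3"
      by (auto simp: cubics_def monoms_def)
    show "compl3 \<subseteq> (cubics \<times> {(0, 0)}) \<times> UNIV"
      by (simp add: cubics_def compl3_def)
    fix z and \<alpha> :: "real \<times> real"
    show "p z = (\<chi> j. \<Sum>(q, d, e)\<in>cubics \<times> {(0, 0)}. rowdot (adjoint_row j) (ccoeff (fst (q, d, e))) *
        (zmono q z * of_real (fst \<alpha> ^ d * snd \<alpha> ^ e)))"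
      unfolding p by (simp add: sum.cartesian_product[symmetric] mult.commute)
  qed
  also have "\<dots> = vector [
    rowdot (adjoint_row 1) (ccoeff (3,0,0)) * z $ 1 ^ 3 + rowdot (adjoint_row 1) (ccoeff (1,1,1)) * z $ 1 * z $ 2 * z $ 3,
    rowdot (adjoint_row 2) (ccoeff (2,1,0)) * (z $ 1)\<^sup>2 * z $ 2 + rowdot (adjoint_row 2) (ccoeff (0,2,1)) * (z $ 2)\<^sup>2 * z $ 3,
    rowdot (adjoint_row 3) (ccoeff (2,0,1)) * (z $ 1)\<^sup>2 * z $ 3 + rowdot (adjoint_row 3) (ccoeff (0,1,2)) * z $ 2 * (z $ 3)\<^sup>2]"
    by (simp add: compl3_def vec_eq_iff forall_3 vmono_def zmono_def axis_def mult.assoc)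
  finally show ?thesis .
qed

lemma ccoeff_cnj: "ccoeff (2,0,1) = vcnj (ccoeff (2,1,0))" "ccoeff (0,1,2) = vcnj (ccoeff (0,2,1))"
proof -
  have Q: "vcnj (Qh \<phi> q) = Qh (\<lambda>\<theta>. vcnj (\<phi> \<theta>)) (swap23 q)" if "cont_hist S \<phi>" "q \<in> quad" for \<phi> q
    using Qhat_cnj[OF that(1) cont_combined[of q]] by (simp add: combined_cnj that(2))
  note C = Chat_cnj[OF cont_phi(1) cont_phi(1) cont_phi(2)] Chat_cnj[OF cont_phi(2) cont_phi(2) cont_phi(3)]
  have q: "(1,1,0) \<in> quad" "(2,0,0) \<in> quad" "(0,1,1) \<in> quad" "(0,2,0) \<in> quad"
    by (simp_all add: quad_def)
  show "ccoeff (2,0,1) = vcnj (ccoeff (2,1,0))"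
    using C(1) q by (simp add: ccoeff_def Let_def Q cont_phi cnj_phi swap23_def)
  have "Chat S (phi2c S) (phi2c S) (phi2 S) = Chat S (phi2 S) (phi2c S) (phi2c S)"
    using Chat_sym by metis
  then show "ccoeff (0,1,2) = vcnj (ccoeff (0,2,1))"
    using C(2) q by (simp add: ccoeff_def Let_def Q cont_phi cnj_phi swap23_def)
qed

lemma normal_form_eq:
  assumes U: "is_U21 S U" and h: "\<And>q. q \<in> quad \<Longrightarrow> h q = hsol q"
    and "c111 = rowdot (adjoint_row 1) (ccoeff (3,0,0)) / 6" "c123 = rowdot (adjoint_row 1) (ccoeff (1,1,1)) / 6"
    and "c112 = rowdot (adjoint_row 2) (ccoeff (2,1,0)) / 6" "c223 = rowdot (adjoint_row 2) (ccoeff (0,2,1)) / 6"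
  shows "normal_form_coeffs S U h 0 0 c111 c123 0 c112 c223"
proof -
  have "rowdot (adjoint_row 3) (ccoeff (2,0,1)) = cnj (rowdot (adjoint_row 2) (ccoeff (2,1,0)))"
    "rowdot (adjoint_row 3) (ccoeff (0,1,2)) = cnj (rowdot (adjoint_row 2) (ccoeff (0,2,1)))"
    unfolding ccoeff_cnj adjoint_row_cnj(2)[symmetric] rowdot_cnj by (rule refl)+
  then show ?thesis
    unfolding normal_form_coeffs_def normal_form_def g21_eq
    by (simp add: g31_eq[OF U h] assms(3-) vec_eq_iff forall_3 Bmap_def scaleR_conv_of_real[where 'a = complex] algebra_simps)
qed

end

text \<open>At \<open>\<alpha> = 0\<close> the points with coordinates \<open>0\<close> and \<open>\<plusminus>1\<close> separate the monomials; the sign of \<open>z\<^sub>1\<close> distinguishes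
  quadratic from cubic terms.\<close>

lemma normal_form_coeffs_unique:
  assumes "normal_form_coeffs S U h a11 a23 a111 a123 b12 b112 b223"
    and "normal_form_coeffs S U h a11' a23' a111' a123' b12' b112' b223'"
  shows "a11 = a11' \<and> a23 = a23' \<and> a111 = a111' \<and> a123 = a123' \<and> b12 = b12' \<and> b112 = b112' \<and> b223 = b223'"
proof -
  have 1: "a11 * (z $ 1)\<^sup>2 + a23 * z $ 2 * z $ 3 + a111 * (z $ 1) ^ 3 + a123 * z $ 1 * z $ 2 * z $ 3 =
      a11' * (z $ 1)\<^sup>2 + a23' * z $ 2 * z $ 3 + a111' * (z $ 1) ^ 3 + a123' * z $ 1 * z $ 2 * z $ 3" for z :: "complex ^ 3"
    using assms[unfolded normal_form_coeffs_def, rule_format, of z 0]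
    by (simp add: vec_eq_iff forall_3 add.assoc)
  have 2: "b12 * z $ 1 * z $ 2 + b112 * (z $ 1)\<^sup>2 * z $ 2 + b223 * (z $ 2)\<^sup>2 * z $ 3 =
      b12' * z $ 1 * z $ 2 + b112' * (z $ 1)\<^sup>2 * z $ 2 + b223' * (z $ 2)\<^sup>2 * z $ 3" for z :: "complex ^ 3"
    using assms[unfolded normal_form_coeffs_def, rule_format, of z 0]
    by (simp add: vec_eq_iff forall_3 add.assoc)
  have a: "a11 + a111 = a11' + a111'" "a11 - a111 = a11' - a111'" "a23 = a23'"
    "a11 + a23 + a111 + a123 = a11' + a23' + a111' + a123'"
    using 1[of "vector [1, 0, 0]"] 1[of "vector [-1, 0, 0]"] 1[of "vector [0, 1, 1]"] 1[of "vector [1, 1, 1]"]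
    by simp_all
  have b: "b12 + b112 = b12' + b112'" "- b12 + b112 = - b12' + b112'" "b223 = b223'"
    using 2[of "vector [1, 1, 0]"] 2[of "vector [-1, 1, 0]"] 2[of "vector [0, 1, 1]"]
    by simp_all
  have sum_diff: "x = x' \<and> y = y'" if "x + y = x' + y'" "x - y = x' - y'" for x y x' y' :: complex
  proof -
    have "2 * x = 2 * x'" "2 * y = 2 * y'"
      using arg_cong2[OF that, of "(+)"] arg_cong2[OF that, of "(-)"] by simp_all
    then show ?thesis by simp
  qed
  have "a11 = a11' \<and> a111 = a111'"
    using sum_diff[OF a(1,2)] .
  moreover have "b112 = b112' \<and> b12 = b12'"
    using b(1,2) by (intro sum_diff) (simp_all add: algebra_simps)
  ultimately show ?thesis
    using a(3,4) b(3) by simp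
qed


section \<open>Explicit coefficients\<close>

context hopf_steady_model
begin

lemma matrix_inv_uminus:
  fixes A :: "complex ^ 'm ^ 'm"
  assumes "invertible A"
  shows "invertible (- A)" "matrix_inv (- A) *v b = - (matrix_inv A *v b)"
proof -
  have neg: "(- A) *v x = - (A *v x)" for A :: "complex ^ 'm ^ 'm" and x
    by (simp add: vec_eq_iff matrix_vector_mult_def sum_negf)
  have neg2: "A *v (- x) = - (A *v x)" for A :: "complex ^ 'm ^ 'm" and x
    by (simp add: vec_eq_iff matrix_vector_mult_def sum_negf)
  obtain B where B: "A ** B = mat 1" "B ** A = mat 1"
    using assms unfolding invertible_def by blast
  have "(- A) ** (- B) = A ** B" "(- B) ** (- A) = B ** A"
    by (simp_all add: matrix_matrix_mult_def)
  with B show i: "invertible (- A)"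
    unfolding invertible_def by metis
  have "(- A) *v (- (matrix_inv A *v b)) = b"
    using matrix_solve[OF assms] by (simp add: neg neg2)
  then show "matrix_inv (- A) *v b = - (matrix_inv A *v b)"
    using matrix_solve[OF i] by metis
qed

lemma matrix_vector_smult: "A *v (c *s x) = c *s (A *v x)" for A :: "complex ^ 'm ^ 'm"
  by (simp add: vector_scalar_commute)

lemma invertible_matrices:
  assumes "k \<noteq> kk"
  shows "invertible (eta_int S k (\<lambda>_. 1))" "invertible (res_matrix S n k)"
  using char_matrix_invertible[OF assms] by (simp_all add: eta_int_one matrix_inv_uminus res_matrix_char)

lemma freq_zero: "freq (2,0,0) = 0" "freq (0,1,1) = 0"
  by (simp_all add: freq_def)

lemma amp_static:
  assumes "k \<noteq> kk"
  shows "amp k (2,0,0) = - (1/2) *s (matrix_inv (eta_int S k (\<lambda>_. 1)) *v Qhat S (phi1 S) (phi1 S))"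
    and "amp k (0,1,1) = - (matrix_inv (eta_int S k (\<lambda>_. 1)) *v Qhat S (phi2 S) (phi2c S))"
proof -
  have "invertible (char_matrix S k 0 0)"
    by (rule char_matrix_invertible[OF assms]) simp
  note inv = matrix_inv_uminus(2)[OF this]
  show "amp k (2,0,0) = - (1/2) *s (matrix_inv (eta_int S k (\<lambda>_. 1)) *v Qhat S (phi1 S) (phi1 S))"
    unfolding eta_int_one inv by (simp add: amp_def freq_zero qcoeff_def matrix_vector_smult vec_eq_iff)
  show "amp k (0,1,1) = - (matrix_inv (eta_int S k (\<lambda>_. 1)) *v Qhat S (phi2 S) (phi2c S))"
    unfolding eta_int_one inv amp_def freq_zero by (simp add: qcoeff_def)
qed

lemma amp_oscillating:
  "amp k (0,2,0) = (1/2) *s (matrix_inv (res_matrix S 2 k) *v Qhat S (phi2 S) (phi2 S))"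
  "amp k (1,1,0) = matrix_inv (res_matrix S 1 k) *v Qhat S (phi1 S) (phi2 S)"
proof -
  have f: "freq (0,2,0) = of_nat 2 * \<i> * of_real (omega0 S)" "freq (1,1,0) = of_nat 1 * \<i> * of_real (omega0 S)"
    by (simp_all add: freq_def)
  show "amp k (0,2,0) = (1/2) *s (matrix_inv (res_matrix S 2 k) *v Qhat S (phi2 S) (phi2 S))"
    "amp k (1,1,0) = matrix_inv (res_matrix S 1 k) *v Qhat S (phi1 S) (phi2 S)"
    unfolding amp_def res_matrix_char f by (simp_all add: qcoeff_def matrix_vector_smult)
qed

lemma expo_freq:
  "expo (freq (2,0,0)) a \<theta> = a" "expo (freq (0,1,1)) a \<theta> = a"
  "expo (freq (0,2,0)) a \<theta> = expiw S 2 \<theta> *s a" "expo (freq (1,1,0)) a \<theta> = expiw S 1 \<theta> *s a"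
  by (simp_all add: freq_def expo_def expiw_def mult_ac)

lemma expo_swap23: "expo (freq (swap23 q)) (vcnj a) \<theta> = vcnj (expo (freq q) a \<theta>)"
  by (cases q) (simp add: freq_def swap23_def expo_def exp_cnj algebra_simps)

end

theorem proposition4p2:
  fixes S :: "('x::{real_inner,complete_space}, 'm::finite) rdde"
    and U :: "complex ^ 3 \<Rightarrow> complex ^ 3"
    and h :: "nat \<times> nat \<times> nat \<Rightarrow> ('x, 'm) history"
  assumes space: "function_space S"
    and equation: "linear_part S" "nonlinear_part S" "pointwise S"
    and bifurcation: "hopf_steady_state S"
    and modes: "k1 S = k2 S" "k1 S \<noteq> 0"
    and bases: "bases S"
    and U: "is_U21 S U"
    and h: "is_unique_h S h"
  shows
    "(\<forall>a11 a23 a111 a123 b12 b112 b223.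
        normal_form_coeffs S U h a11 a23 a111 a123 b12 b112 b223 \<longleftrightarrow>
          a11 = 0 \<and> a23 = 0 \<and> b12 = 0 \<and>
          a111 = 1/4 * rowdot (psi1 S 0) (Chat S (phi1 S) (phi1 S) (phi1 S))
               + rowdot (psi1 S 0) (Qhat S (phi1 S) (hcomb S h (2,0,0))) \<and>
          a123 = 3/2 * rowdot (psi1 S 0) (Chat S (phi1 S) (phi2 S) (phi2c S))
               + rowdot (psi1 S 0) (Qhat S (phi1 S) (hcomb S h (0,1,1)) + Qhat S (phi2 S) (hcomb S h (1,0,1))
                                    + Qhat S (phi2c S) (hcomb S h (1,1,0))) \<and>
          b112 = 3/4 * rowdot (psi2 S 0) (Chat S (phi1 S) (phi1 S) (phi2 S))
               + rowdot (psi2 S 0) (Qhat S (phi1 S) (hcomb S h (1,1,0)) + Qhat S (phi2 S) (hcomb S h (2,0,0))) \<and>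
          b223 = 3/4 * rowdot (psi2 S 0) (Chat S (phi2 S) (phi2 S) (phi2c S))
               + rowdot (psi2 S 0) (Qhat S (phi2 S) (hcomb S h (0,1,1)) + Qhat S (phi2c S) (hcomb S h (0,2,0)))) \<and>
     (\<forall>k\<in>{0, 2 * k1 S}. invertible (eta_int S k (\<lambda>_. 1)) \<and> invertible (res_matrix S 1 k) \<and> invertible (res_matrix S 2 k)) \<and>
     (\<forall>\<theta>\<in>{- delay S..0}.
        hmode S h (2,0,0) 0 \<theta> =
          - (1/2) *s (matrix_inv (eta_int S 0 (\<lambda>_. 1)) *v Qhat S (phi1 S) (phi1 S)) \<and>
        hmode S h (2,0,0) (2 * k1 S) \<theta> =
          - of_real (1 / (2 * sqrt 2)) *s
            (matrix_inv (eta_int S (2 * k1 S) (\<lambda>_. 1)) *v Qhat S (phi1 S) (phi1 S)) \<and>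
        hmode S h (0,1,1) 0 \<theta> =
          - (matrix_inv (eta_int S 0 (\<lambda>_. 1)) *v Qhat S (phi2 S) (phi2c S)) \<and>
        hmode S h (0,1,1) (2 * k1 S) \<theta> =
          - of_real (1 / sqrt 2) *s
            (matrix_inv (eta_int S (2 * k1 S) (\<lambda>_. 1)) *v Qhat S (phi2 S) (phi2c S)) \<and>
        hmode S h (0,2,0) 0 \<theta> =
          (1/2) *s (expiw S 2 \<theta> *s (matrix_inv (res_matrix S 2 0) *v Qhat S (phi2 S) (phi2 S))) \<and>
        hmode S h (0,2,0) (2 * k1 S) \<theta> =
          of_real (1 / (2 * sqrt 2)) *s
            (expiw S 2 \<theta> *s (matrix_inv (res_matrix S 2 (2 * k1 S)) *v Qhat S (phi2 S) (phi2 S))) \<and>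
        hmode S h (1,1,0) 0 \<theta> =
          expiw S 1 \<theta> *s (matrix_inv (res_matrix S 1 0) *v Qhat S (phi1 S) (phi2 S)) \<and>
        hmode S h (1,1,0) (2 * k1 S) \<theta> =
          of_real (1 / sqrt 2) *s
            (expiw S 1 \<theta> *s (matrix_inv (res_matrix S 1 (2 * k1 S)) *v Qhat S (phi1 S) (phi2 S))) \<and>
        hmode S h (0,0,2) 0 \<theta> = vcnj (hmode S h (0,2,0) 0 \<theta>) \<and>
        hmode S h (0,0,2) (2 * k1 S) \<theta> = vcnj (hmode S h (0,2,0) (2 * k1 S) \<theta>) \<and>
        hmode S h (1,0,1) 0 \<theta> = vcnj (hmode S h (1,1,0) 0 \<theta>) \<and>
        hmode S h (1,0,1) (2 * k1 S) \<theta> = vcnj (hmode S h (1,1,0) (2 * k1 S) \<theta>))"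
proof -
  interpret hopf_steady_model S
    by unfold_locales (use assms in auto)
  \<comment> \<open>Uniqueness identifies the given solution with the explicit one.\<close>
  have hq: "h q = hsol q" if "q \<in> quad" for q
    using h solves_hsol that unfolding is_unique_h_def by metis
  have quad: "(2,0,0) \<in> quad" "(0,1,1) \<in> quad" "(1,1,0) \<in> quad" "(1,0,1) \<in> quad" "(0,2,0) \<in> quad" "(0,0,2) \<in> quad"
    by (simp_all add: quad_def)
  note hc = Qhat_hcomb[where h = h, OF hq]
  let ?c111 = "1/4 * rowdot (psi1 S 0) (Chat S (phi1 S) (phi1 S) (phi1 S))
               + rowdot (psi1 S 0) (Qhat S (phi1 S) (hcomb S h (2,0,0)))"
  let ?c123 = "3/2 * rowdot (psi1 S 0) (Chat S (phi1 S) (phi2 S) (phi2c S))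
               + rowdot (psi1 S 0) (Qhat S (phi1 S) (hcomb S h (0,1,1)) + Qhat S (phi2 S) (hcomb S h (1,0,1))
                                    + Qhat S (phi2c S) (hcomb S h (1,1,0)))"
  let ?c112 = "3/4 * rowdot (psi2 S 0) (Chat S (phi1 S) (phi1 S) (phi2 S))
               + rowdot (psi2 S 0) (Qhat S (phi1 S) (hcomb S h (1,1,0)) + Qhat S (phi2 S) (hcomb S h (2,0,0)))"
  let ?c223 = "3/4 * rowdot (psi2 S 0) (Chat S (phi2 S) (phi2 S) (phi2c S))
               + rowdot (psi2 S 0) (Qhat S (phi2 S) (hcomb S h (0,1,1)) + Qhat S (phi2c S) (hcomb S h (0,2,0)))"
  have "normal_form_coeffs S U h 0 0 ?c111 ?c123 0 ?c112 ?c223"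
  proof (rule normal_form_eq[OF U hq])
    show "?c111 = rowdot (adjoint_row 1) (ccoeff (3,0,0)) / 6"
      unfolding hc[OF quad(1)] by (simp add: adjoint_row_def ccoeff_def Let_def rowdot_add rowdot_smult)
    show "?c123 = rowdot (adjoint_row 1) (ccoeff (1,1,1)) / 6"
      unfolding hc[OF quad(2)] hc[OF quad(3)] hc[OF quad(4)]
      by (simp add: adjoint_row_def ccoeff_def Let_def rowdot_add rowdot_smult)
    show "?c112 = rowdot (adjoint_row 2) (ccoeff (2,1,0)) / 6"
      unfolding hc[OF quad(3)] hc[OF quad(1)] by (simp add: adjoint_row_def ccoeff_def Let_def rowdot_add rowdot_smult)
    show "?c223 = rowdot (adjoint_row 2) (ccoeff (0,2,1)) / 6"
      unfolding hc[OF quad(2)] hc[OF quad(5)] by (simp add: adjoint_row_def ccoeff_def Let_def rowdot_add rowdot_smult)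
  qed
  then have coeffs: "\<forall>a11 a23 a111 a123 b12 b112 b223.
        normal_form_coeffs S U h a11 a23 a111 a123 b12 b112 b223 \<longleftrightarrow>
          a11 = 0 \<and> a23 = 0 \<and> b12 = 0 \<and> a111 = ?c111 \<and> a123 = ?c123 \<and> b112 = ?c112 \<and> b223 = ?c223"
    using normal_form_coeffs_unique by blast
  have inv: "\<forall>k\<in>{0, 2 * kk}. invertible (eta_int S k (\<lambda>_. 1)) \<and> invertible (res_matrix S 1 k) \<and> invertible (res_matrix S 2 k)"
    using invertible_matrices noncritical by (metis insertE singletonD)
  have "hmode S h (2,0,0) 0 \<theta> =
          - (1/2) *s (matrix_inv (eta_int S 0 (\<lambda>_. 1)) *v Qhat S (phi1 S) (phi1 S)) \<and>
        hmode S h (2,0,0) (2 * kk) \<theta> =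
          - of_real (1 / (2 * sqrt 2)) *s
            (matrix_inv (eta_int S (2 * kk) (\<lambda>_. 1)) *v Qhat S (phi1 S) (phi1 S)) \<and>
        hmode S h (0,1,1) 0 \<theta> =
          - (matrix_inv (eta_int S 0 (\<lambda>_. 1)) *v Qhat S (phi2 S) (phi2c S)) \<and>
        hmode S h (0,1,1) (2 * kk) \<theta> =
          - of_real (1 / sqrt 2) *s
            (matrix_inv (eta_int S (2 * kk) (\<lambda>_. 1)) *v Qhat S (phi2 S) (phi2c S)) \<and>
        hmode S h (0,2,0) 0 \<theta> =
          (1/2) *s (expiw S 2 \<theta> *s (matrix_inv (res_matrix S 2 0) *v Qhat S (phi2 S) (phi2 S))) \<and>
        hmode S h (0,2,0) (2 * kk) \<theta> =
          of_real (1 / (2 * sqrt 2)) *s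
            (expiw S 2 \<theta> *s (matrix_inv (res_matrix S 2 (2 * kk)) *v Qhat S (phi2 S) (phi2 S))) \<and>
        hmode S h (1,1,0) 0 \<theta> =
          expiw S 1 \<theta> *s (matrix_inv (res_matrix S 1 0) *v Qhat S (phi1 S) (phi2 S)) \<and>
        hmode S h (1,1,0) (2 * kk) \<theta> =
          of_real (1 / sqrt 2) *s
            (expiw S 1 \<theta> *s (matrix_inv (res_matrix S 1 (2 * kk)) *v Qhat S (phi1 S) (phi2 S))) \<and>
        hmode S h (0,0,2) 0 \<theta> = vcnj (hmode S h (0,2,0) 0 \<theta>) \<and>
        hmode S h (0,0,2) (2 * kk) \<theta> = vcnj (hmode S h (0,2,0) (2 * kk) \<theta>) \<and>
        hmode S h (1,0,1) 0 \<theta> = vcnj (hmode S h (1,1,0) 0 \<theta>) \<and>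
        hmode S h (1,0,1) (2 * kk) \<theta> = vcnj (hmode S h (1,1,0) (2 * kk) \<theta>)"
    if \<theta>: "\<theta> \<in> {- delay S..0}" for \<theta>
  proof -
    have swap: "swap23 (0,2,0) = (0,0,2)" "swap23 (1,1,0) = (1,0,1)"
      by (simp_all add: swap23_def)
    have cnj: "hmode S h (swap23 q) 0 \<theta> = vcnj (hmode S h q 0 \<theta>)"
      "hmode S h (swap23 q) (2 * kk) \<theta> = vcnj (hmode S h q (2 * kk) \<theta>)"
      if "q \<in> quad" "swap23 q \<in> quad" for q
      using amp_swap23[OF that(1) noncritical(1)] amp_swap23[OF that(1) noncritical(2)]
      by (simp_all add: hmode_hsol[where h = h, OF hq[OF that(1)] \<theta>] hmode_hsol[where h = h, OF hq[OF that(2)] \<theta>] amp0_def amp2_def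
          expo_swap23 expo_smult)
    note m = hmode_hsol[where h = h, OF hq \<theta>]
    note base = m[OF quad(1)] m[OF quad(2)] m[OF quad(3)] m[OF quad(5)]
    note conj = cnj[OF quad(5), unfolded swap, OF quad(6)] cnj[OF quad(3), unfolded swap, OF quad(4)]
    show ?thesis
      unfolding conj base expo_freq amp0_def amp2_def amp_static[OF noncritical(1)] amp_static[OF noncritical(2)] amp_oscillating
      by (simp add: vec_eq_iff)
  qed
  with coeffs inv show ?thesis
    by simp
qed

end
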